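(* There is no connected quandle of order $14$, and up to isomorphism there is only one connected quandle of order $10$.
   Context: A quandle is a set $Q$ with a binary operation $\star$ such that: (i) $a\star a=a$ for all $a\in Q$; (ii) $(a\star b)\star c=(a\star c)\star(b\star c)$ for all $a,b,c\in Q$; (iii) for all $a,b\in Q$ there is a unique $c\in Q$ with $c\star b=a$. A quandle homomorphism is a map $\rho$ with $\rho(a\star b)=\rho(a)\star\rho(b)$; isomorphisms and automorphisms are bijective homomorphisms. For $a\in Q$ let $\phi_a\colon Q\to Q$, $\phi_a(b)=b\star a$; this is a quandle automorphism. $\operatorname{Int}(Q)$ is the subgroup of $\operatorname{Aut}(Q)$ generated by all $\phi_a$, $a\in Q$. $Q$ is connected if $\operatorname{Int}(Q)$ acts transitively on $Q$. The order of $Q$ is its cardinality. *)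

theory Defs
  imports "HOL-Algebra.Generated_Groups" "HOL-Algebra.Group_Action"
begin

locale quandle =
  fixes Q :: "'a set" and star :: "'a \<Rightarrow> 'a \<Rightarrow> 'a"  (infixl "\<star>" 70)
  assumes closed: "\<lbrakk>a \<in> Q; b \<in> Q\<rbrakk> \<Longrightarrow> a \<star> b \<in> Q"
    and idem: "a \<in> Q \<Longrightarrow> a \<star> a = a"
    and distrib: "\<lbrakk>a \<in> Q; b \<in> Q; c \<in> Q\<rbrakk> \<Longrightarrow> (a \<star> b) \<star> c = (a \<star> c) \<star> (b \<star> c)"
    and ex1_right_quotient: "\<lbrakk>a \<in> Q; b \<in> Q\<rbrakk> \<Longrightarrow> \<exists>!c. c \<in> Q \<and> c \<star> b = a"

definition quandle_hom ::
  "'a set \<Rightarrow> ('a \<Rightarrow> 'a \<Rightarrow> 'a) \<Rightarrow> 'b set \<Rightarrow> ('b \<Rightarrow> 'b \<Rightarrow> 'b) \<Rightarrow> ('a \<Rightarrow> 'b) set" where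
  "quandle_hom Q s R t = {f \<in> Q \<rightarrow> R. \<forall>a\<in>Q. \<forall>b\<in>Q. f (s a b) = t (f a) (f b)}"

definition quandle_iso ::
  "'a set \<Rightarrow> ('a \<Rightarrow> 'a \<Rightarrow> 'a) \<Rightarrow> 'b set \<Rightarrow> ('b \<Rightarrow> 'b \<Rightarrow> 'b) \<Rightarrow> ('a \<Rightarrow> 'b) set" where
  "quandle_iso Q s R t = {f \<in> quandle_hom Q s R t. bij_betw f Q R}"

definition isomorphic_quandles ::
  "'a set \<Rightarrow> ('a \<Rightarrow> 'a \<Rightarrow> 'a) \<Rightarrow> 'b set \<Rightarrow> ('b \<Rightarrow> 'b \<Rightarrow> 'b) \<Rightarrow> bool" where
  "isomorphic_quandles Q s R t \<longleftrightarrow> quandle_iso Q s R t \<noteq> {}"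

text \<open>
  As for \<^const>\<open>AutoGroup\<close>, automorphisms are represented by functions that are
  \<^const>\<open>extensional\<close> on the carrier, so that each automorphism is a single element.
\<close>

definition quandle_Aut :: "'a set \<Rightarrow> ('a \<Rightarrow> 'a \<Rightarrow> 'a) \<Rightarrow> ('a \<Rightarrow> 'a) monoid" where
  "quandle_Aut Q s = BijGroup Q \<lparr>carrier := quandle_iso Q s Q s \<inter> extensional Q\<rparr>"

definition right_translation :: "'a set \<Rightarrow> ('a \<Rightarrow> 'a \<Rightarrow> 'a) \<Rightarrow> 'a \<Rightarrow> 'a \<Rightarrow> 'a" where
  "right_translation Q s a = (\<lambda>b\<in>Q. s b a)"

definition quandle_Int :: "'a set \<Rightarrow> ('a \<Rightarrow> 'a \<Rightarrow> 'a) \<Rightarrow> ('a \<Rightarrow> 'a) monoid" where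
  "quandle_Int Q s =
     quandle_Aut Q s \<lparr>carrier := generate (quandle_Aut Q s) (right_translation Q s ` Q)\<rparr>"

definition connected_quandle :: "'a set \<Rightarrow> ('a \<Rightarrow> 'a \<Rightarrow> 'a) \<Rightarrow> bool" where
  "connected_quandle Q s \<longleftrightarrow> quandle Q s \<and> transitive_action (quandle_Int Q s) Q (\<lambda>f. f)"

context quandle
begin

lemma subgroup_Aut: "subgroup (quandle_iso Q star Q star \<inter> extensional Q) (BijGroup Q)"
proof (rule group.subgroupI[OF group_BijGroup])
  show "quandle_iso Q star Q star \<inter> extensional Q \<subseteq> carrier (BijGroup Q)"
    by (auto simp: quandle_iso_def BijGroup_def Bij_def)
  have "(\<lambda>x\<in>Q. x) \<in> quandle_iso Q star Q star \<inter> extensional Q"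
    using id_Bij[of Q] by (auto simp: quandle_iso_def quandle_hom_def Bij_def closed)
  then show "quandle_iso Q star Q star \<inter> extensional Q \<noteq> {}" by blast
next
  fix f assume f: "f \<in> quandle_iso Q star Q star \<inter> extensional Q"
  then have B: "f \<in> Bij Q" by (auto simp: quandle_iso_def Bij_def)
  have "inv_into Q f (a \<star> b) = inv_into Q f a \<star> inv_into Q f b" if "a \<in> Q" "b \<in> Q" for a b
    by (rule Bij_inv_into_lemma[where S = Q]) (use f B that closed in \<open>auto simp: quandle_iso_def quandle_hom_def\<close>)
  then show "inv\<^bsub>BijGroup Q\<^esub> f \<in> quandle_iso Q star Q star \<inter> extensional Q"
    using restrict_inv_into_Bij[OF B] Bij_inv_into_mem[OF B] closed
    by (auto simp: inv_BijGroup[OF B] quandle_iso_def quandle_hom_def Bij_def)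
next
  fix f g assume fg: "f \<in> quandle_iso Q star Q star \<inter> extensional Q"
    "g \<in> quandle_iso Q star Q star \<inter> extensional Q"
  then have B: "f \<in> Bij Q" "g \<in> Bij Q" by (auto simp: quandle_iso_def Bij_def)
  then show "f \<otimes>\<^bsub>BijGroup Q\<^esub> g \<in> quandle_iso Q star Q star \<inter> extensional Q"
    using compose_Bij[OF B] fg closed
    by (auto simp: BijGroup_def quandle_iso_def quandle_hom_def Bij_def compose_def Pi_iff)
qed

lemma group_Aut: "group (quandle_Aut Q star)"
  unfolding quandle_Aut_def
  by (rule subgroup.subgroup_is_group[OF subgroup_Aut group_BijGroup])

lemma right_translation_Aut:
  assumes "a \<in> Q" shows "right_translation Q star a \<in> carrier (quandle_Aut Q star)"
proof -
  have "bij_betw (\<lambda>b. b \<star> a) Q Q"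
  proof (rule bij_betwI')
    show "(x \<star> a = y \<star> a) = (x = y)" if "x \<in> Q" "y \<in> Q" for x y
      using that assms closed ex1_right_quotient[of "x \<star> a" a] by metis
    show "x \<star> a \<in> Q" if "x \<in> Q" for x
      using that assms closed by simp
    show "\<exists>x\<in>Q. y = x \<star> a" if "y \<in> Q" for y
      using that assms ex1_right_quotient[of y a] by metis
  qed
  then have "bij_betw (right_translation Q star a) Q Q"
    unfolding right_translation_def by (simp cong: bij_betw_cong)
  then show ?thesis
    using assms closed distrib[OF _ _ assms]
    by (simp add: quandle_Aut_def quandle_iso_def quandle_hom_def right_translation_def)
qed

lemma subgroup_Int: "subgroup (carrier (quandle_Int Q star)) (quandle_Aut Q star)"
  unfolding quandle_Int_def
  using group.generate_is_subgroup[OF group_Aut] right_translation_Aut by (simp add: image_subset_iff)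

lemma Int_hom: "group_hom (quandle_Int Q star) (BijGroup Q) (\<lambda>f. f)"
proof -
  have "group (quandle_Int Q star)"
    using subgroup.subgroup_is_group[OF subgroup_Int group_Aut] by (simp add: quandle_Int_def)
  moreover have "carrier (quandle_Int Q star) \<subseteq> carrier (BijGroup Q)"
    using subgroup.subset[OF subgroup_Int] subgroup.subset[OF subgroup_Aut]
    by (auto simp: quandle_Aut_def)
  ultimately show ?thesis
    by (auto simp: group_hom_def group_hom_axioms_def group_BijGroup hom_def quandle_Int_def
        quandle_Aut_def)
qed

lemma connected_iff:
  "connected_quandle Q star \<longleftrightarrow>
    (\<forall>x\<in>Q. \<forall>y\<in>Q. \<exists>f\<in>generate (quandle_Aut Q star) (right_translation Q star ` Q). f x = y)"
  using Int_hom quandle_axioms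
  unfolding connected_quandle_def transitive_action_def transitive_action_axioms_def
    group_action_def
  by (auto simp: quandle_Int_def)

end

end

(*
  Let Q be a connected quandle of order 2p, p prime. By Cauchy's theorem its inner automorphism
  group contains some z of order p, and connectedness forces z to be fixpoint free, so that Q
  consists of two cycles of z. Some translation by an element a leads out of the z-orbit of a;
  replacing z by a power, (z a) * a is not in the orbit of a, and the elements z^i a and
  z^i ((z a) * a) exhaust Q. In this labelling the operation table is invariant under z, so it is
  determined by two columns, and a small backtracking search in which the self-distributive law
  propagates known entries finds all such tables for p = 5 and p = 7.
*)

theory Submission
  imports Defs "HOL-Algebra.Sylow" "HOL-Algebra.Multiplicative_Group" "HOL-Number_Theory.Cong"
begin

section \<open>Permutations of prime order\<close>

text \<open>Fixpoint freeness of \<open>z\<close> is the mathematical core: the columns of fixed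
  points would not be shifts of one another, and two of them would no longer determine the table.
  Connectedness enters again inside the search, where it removes branches that the equations alone
  need not refute, namely those in which \<open>{1, p}\<close> is closed under all translations. The
  search is replayed by rewriting, so all choices of branching and propagation are fixed in advance
  as a list of instructions. One fact is proved about them: some state of the worklist always agrees
  with the given table. The lists therefore need no trust; a badly chosen instruction can only leave
  too many states. For \<open>p = 5\<close> the normalisation \<open>t 1 0 = p\<close> leaves a
  single table, so uniqueness follows without comparing solutions; for \<open>p = 7\<close> it
  leaves none.\<close>

locale prime_order_perm =
  fixes p :: nat and Q :: "'a set" and z :: "'a \<Rightarrow> 'a"
  assumes prime: "prime p"
    and bij: "bij_betw z Q Q"
    and pow_p: "x \<in> Q \<Longrightarrow> (z ^^ p) x = x"
begin

definition orb :: "'a \<Rightarrow> 'a set" where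
  "orb x = (\<lambda>i. (z ^^ i) x) ` {..<p}"

lemma pow_bij: "bij_betw (z ^^ i) Q Q"
  using bij by (rule bij_betw_funpow)

lemma pow_in: "x \<in> Q \<Longrightarrow> (z ^^ i) x \<in> Q"
  using pow_bij by (rule bij_betw_apply)

lemma pow_cancel: "\<lbrakk>x \<in> Q; y \<in> Q; (z ^^ i) x = (z ^^ i) y\<rbrakk> \<Longrightarrow> x = y"
  using pow_bij by (auto simp: bij_betw_def inj_on_def)

lemma pow_mod: "x \<in> Q \<Longrightarrow> (z ^^ (i mod p)) x = (z ^^ i) x"
  using pow_p by (rule funpow_mod_eq)

text \<open>By Bezout, \<open>i\<close> is invertible modulo \<open>p\<close>, so at
  \<open>x\<close> the map \<open>z\<close> itself is a power of \<open>z ^^ i\<close>. The claim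
  concerns a single point because other points of \<open>Q\<close> may be fixed by
  \<open>z\<close>.\<close>

lemma pow_moved:
  assumes x: "x \<in> Q" "z x \<noteq> x" and i: "\<not> p dvd i"
  shows "(z ^^ i) x \<noteq> x"
proof
  assume *: "(z ^^ i) x = x"
  have "i \<noteq> 0" using i by (cases i) auto
  then obtain u v where uv: "i * u = p * v + gcd i p"
    using bezout_nat by blast
  moreover have "gcd i p = 1"
    using prime i by (metis coprime_commute coprime_iff_gcd_eq_1 prime_imp_coprime)
  ultimately have "i * u = Suc (p * v)" by simp
  then have "(z ^^ (i * u)) x = z ((z ^^ (p * v)) x)" by simp
  moreover have "(z ^^ (i * u)) x = x"
    using funpow_mod_eq[OF *, of "i * u"] by simp
  moreover have "(z ^^ (p * v)) x = x"
    using pow_mod[OF x(1), of "p * v"] by simp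
  ultimately show False using x(2) by simp
qed

lemma orb_iff: "x \<in> Q \<Longrightarrow> y \<in> orb x \<longleftrightarrow> (\<exists>i. y = (z ^^ i) x)"
  unfolding orb_def using prime prime_gt_0_nat pow_mod
  by (metis (no_types, lifting) imageE image_eqI lessThan_iff mod_less_divisor)

lemma self_in_orb: "x \<in> Q \<Longrightarrow> x \<in> orb x"
  by (auto simp: orb_iff intro: exI[of _ 0])

lemma orb_subset: "x \<in> Q \<Longrightarrow> orb x \<subseteq> Q"
  by (auto simp: orb_def pow_in)

lemma pow_in_orb: "x \<in> Q \<Longrightarrow> y \<in> orb x \<Longrightarrow> (z ^^ i) y \<in> orb x"
  by (metis orb_iff funpow_add comp_apply)

lemma pow_inj:
  assumes x: "x \<in> Q" "z x \<noteq> x"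
  shows "inj_on (\<lambda>i. (z ^^ i) x) {..<p}"
proof (rule linorder_inj_onI')
  fix i j assume ij: "i \<in> {..<p}" "j \<in> {..<p}" "i < j"
  then have "(z ^^ j) x = (z ^^ i) ((z ^^ (j - i)) x)"
    by (metis comp_apply funpow_add le_add_diff_inverse less_imp_le)
  moreover have "\<not> p dvd j - i"
    using ij by (auto dest: dvd_imp_le)
  ultimately show "(z ^^ i) x \<noteq> (z ^^ j) x"
    using pow_moved[OF x] pow_cancel x(1) pow_in by metis
qed

lemma card_orb: "\<lbrakk>x \<in> Q; z x \<noteq> x\<rbrakk> \<Longrightarrow> card (orb x) = p"
  unfolding orb_def using card_image[OF pow_inj] by simp

lemma orb_moved: "\<lbrakk>x \<in> Q; z x \<noteq> x; y \<in> orb x\<rbrakk> \<Longrightarrow> z y \<noteq> y"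
  using pow_cancel[of "z x" x] pow_in[of x 1] orb_iff by (auto simp: funpow_swap1)

lemma orb_disjoint:
  assumes "x \<in> Q" "y \<in> Q" "y \<notin> orb x"
  shows "orb x \<inter> orb y = {}"
proof (rule ccontr)
  assume "orb x \<inter> orb y \<noteq> {}"
  then obtain i j where ij: "j < p" "(z ^^ i) x = (z ^^ j) y"
    by (auto simp: orb_def)
  \<comment> \<open>On \<open>Q\<close> the power \<open>z ^^ (p - j)\<close> inverts
    \<open>z ^^ j\<close>, which spares negative exponents.\<close>
  have "(z ^^ (p - j + i)) x = (z ^^ (p - j)) ((z ^^ j) y)"
    using ij(2) by (simp add: funpow_add)
  also have "\<dots> = y"
    using ij(1) pow_p[OF assms(2)] by (metis comp_apply funpow_add le_add_diff_inverse2 less_imp_le)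
  finally show False
    using assms orb_iff by metis
qed

lemma orb_eq:
  assumes "x \<in> Q" "y \<in> orb x"
  shows "orb y = orb x"
proof -
  have y: "y \<in> Q" using assms orb_subset by blast
  then have "x \<in> orb y"
    using orb_disjoint[OF y assms(1)] self_in_orb[OF y] assms(2) by auto
  show ?thesis
  proof
    show "orb y \<subseteq> orb x"
      using pow_in_orb[OF assms] orb_iff[OF y] by auto
    show "orb x \<subseteq> orb y"
      using pow_in_orb[OF y \<open>x \<in> orb y\<close>] orb_iff[OF assms(1)] by auto
  qed
qed

lemma orb_Un_eq:
  assumes "finite Q" "card Q = 2 * p" "x \<in> Q" "y \<in> Q" "z x \<noteq> x" "z y \<noteq> y" "y \<notin> orb x"
  shows "orb x \<union> orb y = Q"
proof (rule card_subset_eq)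
  have "card (orb x \<union> orb y) = card (orb x) + card (orb y)"
    using assms orb_disjoint by (intro card_Un_disjoint) (auto simp: orb_def)
  then show "card (orb x \<union> orb y) = card Q"
    using assms by (simp add: card_orb)
qed (use assms orb_subset in auto)

end

text \<open>Pigeonhole: two of the first \<open>n + 1\<close> iterates agree, so \<open>x\<close>
  has a period at most \<open>n\<close>, and every such period divides \<open>fact n\<close>. With
  \<open>n = p - 1\<close> this gives an exponent that kills permutations of fewer than
  \<open>p\<close> points but is prime to \<open>p\<close>.\<close>

lemma fact_pow_eq_self:
  assumes "finite C" "bij_betw f C C" "x \<in> C" "card C \<le> n"
  shows "(f ^^ fact n) x = x"
proof -
  have "(f ^^ i) x \<in> C" for i
    using bij_betw_funpow[OF assms(2)] assms(3) by (rule bij_betw_apply)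
  then have "card ((\<lambda>i. (f ^^ i) x) ` {..n}) \<le> card C"
    using assms(1) by (intro card_mono) auto
  then have "\<not> inj_on (\<lambda>i. (f ^^ i) x) {..n}"
    using assms(4) card_image by fastforce
  then obtain i j where ij: "i < j" "j \<le> n" "(f ^^ i) x = (f ^^ j) x"
    using linorder_inj_onI'[of "{..n}" "\<lambda>i. (f ^^ i) x"] by auto
  then have "(f ^^ i) x = (f ^^ i) ((f ^^ (j - i)) x)"
    by (metis comp_apply funpow_add le_add_diff_inverse less_imp_le)
  then have "(f ^^ (j - i)) x = x"
    using bij_betw_funpow[OF assms(2), of i] assms(3) \<open>\<And>i. (f ^^ i) x \<in> C\<close>
    by (metis bij_betw_imp_inj_on inj_on_def)
  moreover have "(j - i) dvd fact n"
    using ij by (intro dvd_fact) auto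
  ultimately show ?thesis
    using funpow_mod_eq[of "j - i" f x "fact n"] by simp
qed

section \<open>Shift-invariant tables\<close>

text \<open>The action of the \<open>k\<close>-th power of the automorphism on labels:
  \<open>i < p\<close> names the \<open>i\<close>-th point of one cycle, \<open>p + i\<close> that
  of the other. In the second case the surplus \<open>p\<close> in \<open>a\<close> vanishes modulo
  \<open>p\<close>.\<close>

definition shift :: "nat \<Rightarrow> nat \<Rightarrow> nat \<Rightarrow> nat" where
  "shift p k a = (if a < p then (a + k) mod p else p + (a + k) mod p)"

lemma shift_less: "a < 2 * p \<Longrightarrow> shift p k a < 2 * p"
  by (cases "p = 0") (auto simp: shift_def intro: order_less_le_trans[OF mod_less_divisor])

lemma shift_shift: "0 < p \<Longrightarrow> shift p k (shift p l a) = shift p (k + l) a"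
  by (auto simp: shift_def not_less mod_simps add.assoc add.left_commute[of _ p] add.commute[of l k])

lemma shift_full [simp]: "a < 2 * p \<Longrightarrow> shift p (2 * p) a = a"
  by (auto simp: shift_def not_less le_mod_geq)

text \<open>Shifting back uses \<open>2 * p - b\<close> rather than \<open>p - b\<close>: the amount
  \<open>b\<close> is itself a label and may exceed \<open>p\<close>, while \<open>2 * p\<close> is
  a multiple of \<open>p\<close> that bounds all labels.\<close>

lemma shift_unshift:
  assumes "a < 2 * p" "b \<le> 2 * p"
  shows "shift p b (shift p (2 * p - b) a) = a" "shift p (2 * p - b) (shift p b a) = a"
  using assms by (simp_all add: shift_shift)

text \<open>Only the residue of a shift amount modulo \<open>p\<close> matters, so a label
  \<open>b\<close> of either cycle can serve as the amount that leads to it from the start of its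
  cycle. Hence columns \<open>0\<close> and \<open>p\<close> generate all columns.\<close>

lemma shift_base:
  assumes "b < 2 * p"
  shows "shift p b (if b < p then 0 else p) = b"
  using assms by (auto simp: shift_def le_mod_geq)

text \<open>Connectedness is phrased through invariant sets, the form that a partially known table
  can violate. Idempotence is left to the seeds \<open>t 0 0 = 0\<close> and
  \<open>t p p = p\<close>, from which \<open>t_shift\<close> carries it to all labels.\<close>

locale shift_table =
  fixes p :: nat and t :: "nat \<Rightarrow> nat \<Rightarrow> nat"
  assumes t_less: "\<lbrakk>a < 2 * p; b < 2 * p\<rbrakk> \<Longrightarrow> t a b < 2 * p"
    and t_distrib: "\<lbrakk>a < 2 * p; b < 2 * p; c < 2 * p\<rbrakk> \<Longrightarrow> t (t a b) c = t (t a c) (t b c)"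
    and t_cancel: "\<lbrakk>a < 2 * p; b < 2 * p; c < 2 * p; t a c = t b c\<rbrakk> \<Longrightarrow> a = b"
    and t_shift: "\<lbrakk>a < 2 * p; b < 2 * p\<rbrakk> \<Longrightarrow> t (shift p k a) (shift p k b) = shift p k (t a b)"
    and t_connected: "\<lbrakk>S \<subseteq> {..<2 * p}; S \<noteq> {}; \<And>a b. a \<in> S \<Longrightarrow> b < 2 * p \<Longrightarrow> t a b \<in> S\<rbrakk>
      \<Longrightarrow> S = {..<2 * p}"

section \<open>Connected quandles of order \<open>2p\<close>\<close>

context quandle
begin

lemma star_cancel: "\<lbrakk>x \<in> Q; y \<in> Q; a \<in> Q; x \<star> a = y \<star> a\<rbrakk> \<Longrightarrow> x = y"
  using ex1_right_quotient[of "x \<star> a" a] closed by metis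

text \<open>Extensionality is dropped because plain iterates \<open>z ^^ k\<close> need not be
  extensional.\<close>

abbreviation Aut_set :: "('a \<Rightarrow> 'a) set" where
  "Aut_set \<equiv> quandle_iso Q star Q star"

lemma Aut_setD:
  assumes "g \<in> Aut_set"
  shows "bij_betw g Q Q" "\<And>x. x \<in> Q \<Longrightarrow> g x \<in> Q" "\<And>x y. \<lbrakk>x \<in> Q; y \<in> Q\<rbrakk> \<Longrightarrow> g (x \<star> y) = g x \<star> g y"
  using assms by (auto simp: quandle_iso_def quandle_hom_def)

lemma Int_carrier:
  "carrier (quandle_Int Q star) = generate (quandle_Aut Q star) (right_translation Q star ` Q)"
  by (simp add: quandle_Int_def)

lemma Int_carrier_subset:
  "carrier (quandle_Int Q star) \<subseteq> Aut_set \<inter> extensional Q"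
  using subgroup.subset[OF subgroup_Int] by (simp add: quandle_Aut_def)

lemma Aut_mult:
  assumes "f \<in> carrier (quandle_Aut Q star)" "g \<in> carrier (quandle_Aut Q star)"
  shows "f \<otimes>\<^bsub>quandle_Aut Q star\<^esub> g = compose Q f g"
  using assms by (auto simp: quandle_Aut_def BijGroup_def quandle_iso_def Bij_def)

lemma Aut_one: "\<one>\<^bsub>quandle_Aut Q star\<^esub> = (\<lambda>x\<in>Q. x)"
  by (simp add: quandle_Aut_def BijGroup_def)

lemma Aut_inv:
  assumes "f \<in> carrier (quandle_Aut Q star)"
  shows "inv\<^bsub>quandle_Aut Q star\<^esub> f = (\<lambda>x\<in>Q. inv_into Q f x)"
proof -
  have "f \<in> Bij Q"
    using assms by (auto simp: quandle_Aut_def quandle_iso_def Bij_def)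
  with assms show ?thesis
    using group.m_inv_consistent[OF group_BijGroup subgroup_Aut] inv_BijGroup
    by (simp add: quandle_Aut_def)
qed

section \<open>Connectedness and sets invariant under translations\<close>

lemma connected_transitive:
  assumes "connected_quandle Q star" "x \<in> Q" "y \<in> Q"
  obtains g where "g \<in> Aut_set" "g x = y"
  using assms connected_iff Int_carrier Int_carrier_subset by blast

text \<open>Invariance passes from the translations to the group they generate. Finiteness serves
  the inverses: an injective map that sends the finite set \<open>S\<close> into itself sends it
  onto itself, so its inverse preserves \<open>S\<close> too.\<close>

lemma connected_imp_no_invariant:
  assumes conn: "connected_quandle Q star" and fin: "finite Q"
    and S: "S \<subseteq> Q" "S \<noteq> {}" and inv: "\<And>a b. \<lbrakk>a \<in> S; b \<in> Q\<rbrakk> \<Longrightarrow> a \<star> b \<in> S"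
  shows "S = Q"
proof -
  have Aut: "generate (quandle_Aut Q star) (right_translation Q star ` Q) \<subseteq> carrier (quandle_Aut Q star)"
    using subgroup.subset[OF subgroup_Int] by (simp add: Int_carrier)
  have "f ` S \<subseteq> S" if "f \<in> generate (quandle_Aut Q star) (right_translation Q star ` Q)" for f
    using that
  proof induction
    case one
    then show ?case using S by (auto simp: Aut_one)
  next
    case (incl h)
    then show ?case using S inv by (auto simp: right_translation_def)
  next
    case (inv h)
    then have h: "h \<in> carrier (quandle_Aut Q star)" and sub: "h ` S \<subseteq> S"
      using right_translation_Aut S \<open>\<And>a b. \<lbrakk>a \<in> S; b \<in> Q\<rbrakk> \<Longrightarrow> a \<star> b \<in> S\<close>
      by (auto simp: right_translation_def)
    have inj: "inj_on h Q"
      using h by (auto simp: quandle_Aut_def quandle_iso_def bij_betw_def)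
    then have "h ` S = S"
      using sub S(1) fin by (meson endo_inj_surj inj_on_subset finite_subset)
    then have "inv_into Q h x \<in> S" if "x \<in> S" for x
      using that S(1) inj by (metis (no_types, lifting) imageE inv_into_f_f subsetD)
    then show ?case
      using S(1) by (auto simp: Aut_inv[OF h])
  next
    case (eng f g)
    then show ?case
      using S(1) Aut by (subst Aut_mult) (auto simp: compose_def)
  qed
  moreover obtain x where "x \<in> S" using S(2) by blast
  moreover have "\<exists>f\<in>generate (quandle_Aut Q star) (right_translation Q star ` Q). f x = y" if "y \<in> Q" for y
    using conn connected_iff that \<open>x \<in> S\<close> S(1) by blast
  ultimately show ?thesis using S(1) by blast
qed

text \<open>The orbit of a point under the generated group is itself an invariant set, because
  composing with a further translation stays inside the group.\<close>

lemma no_invariant_imp_connected: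
  assumes "\<And>S. \<lbrakk>S \<subseteq> Q; S \<noteq> {}; \<And>a b. \<lbrakk>a \<in> S; b \<in> Q\<rbrakk> \<Longrightarrow> a \<star> b \<in> S\<rbrakk> \<Longrightarrow> S = Q"
  shows "connected_quandle Q star"
  unfolding connected_iff
proof (intro ballI)
  let ?gen = "generate (quandle_Aut Q star) (right_translation Q star ` Q)"
  have Aut: "?gen \<subseteq> carrier (quandle_Aut Q star)"
    using subgroup.subset[OF subgroup_Int] by (simp add: Int_carrier)
  fix x y assume x: "x \<in> Q" and y: "y \<in> Q"
  have "(\<lambda>f. f x) ` ?gen = Q"
  proof (rule assms)
    show "(\<lambda>f. f x) ` ?gen \<subseteq> Q"
      using Aut x by (auto simp: quandle_Aut_def quandle_iso_def quandle_hom_def)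
    show "(\<lambda>f. f x) ` ?gen \<noteq> {}"
      using generate.one by fast
  next
    fix a b assume "a \<in> (\<lambda>f. f x) ` ?gen" and b: "b \<in> Q"
    then obtain f where f: "f \<in> ?gen" "a = f x" by blast
    have r: "right_translation Q star b \<in> ?gen"
      using b by (auto intro: generate.incl)
    have "f x \<in> Q"
      using f Aut x by (auto simp: quandle_Aut_def quandle_iso_def quandle_hom_def)
    then have "(right_translation Q star b \<otimes>\<^bsub>quandle_Aut Q star\<^esub> f) x = a \<star> b"
      using Aut f r x by (subst Aut_mult) (auto simp: compose_def right_translation_def)
    then show "a \<star> b \<in> (\<lambda>f. f x) ` ?gen"
      using generate.eng[OF r f(1)] by (metis imageI)
  qed
  with y have "y \<in> (\<lambda>f. f x) ` ?gen" by simp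
  then show "\<exists>f\<in>?gen. f x = y" by auto
qed

section \<open>An inner automorphism of prime order\<close>

lemma Int_pow_apply:
  assumes "z \<in> carrier (quandle_Int Q star)" "x \<in> Q"
  shows "(z [^]\<^bsub>quandle_Int Q star\<^esub> (k :: nat)) x = (z ^^ k) x"
proof (induction k)
  case 0
  then show ?case
    using assms by (simp add: quandle_Int_def Aut_one)
next
  case (Suc k)
  interpret G: group "quandle_Int Q star"
    using Int_hom by (simp add: group_hom_def)
  have z: "z \<in> Aut_set"
    using assms Int_carrier_subset by blast
  have "z [^]\<^bsub>quandle_Int Q star\<^esub> Suc k = z \<otimes>\<^bsub>quandle_Int Q star\<^esub> z [^]\<^bsub>quandle_Int Q star\<^esub> k"
    using assms(1) by (rule G.nat_pow_Suc2)
  also have "\<dots> = compose Q z (z [^]\<^bsub>quandle_Int Q star\<^esub> k)"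
    using assms Int_carrier_subset G.nat_pow_closed[OF assms(1), of k]
    by (subst Aut_mult[symmetric]) (auto simp: quandle_Int_def quandle_Aut_def)
  finally show ?case
    using Suc assms by (simp add: compose_def)
qed

text \<open>By transitivity \<open>Q\<close> is a single orbit, so its cardinality, and with it
  \<open>p\<close>, divides the group order. Cauchy's theorem is the Sylow existence theorem with
  exponent 1, whose cofactor \<open>m\<close> may still be divisible by \<open>p\<close>; any
  nontrivial element of the resulting subgroup of order \<open>p\<close> will do.\<close>

lemma ex_Aut_prime_order:
  assumes conn: "connected_quandle Q star" and fin: "finite Q" and "Q \<noteq> {}"
    and p: "prime p" "p dvd card Q"
  obtains z where "z \<in> Aut_set" "\<And>x. x \<in> Q \<Longrightarrow> (z ^^ p) x = x" "\<exists>x\<in>Q. z x \<noteq> x"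
proof -
  let ?G = "quandle_Int Q star"
  interpret transitive_action ?G Q "\<lambda>f. f"
    using conn by (simp add: connected_quandle_def)
  interpret G: group ?G
    using group_hom by (simp add: group_hom_def)
  have "carrier ?G \<subseteq> Q \<rightarrow>\<^sub>E Q"
    using Int_carrier_subset Aut_setD(2) by (auto simp: PiE_def Pi_iff)
  then have finG: "finite (carrier ?G)"
    using fin by (meson finite_PiE finite_subset)
  obtain x where x: "x \<in> Q" using \<open>Q \<noteq> {}\<close> by blast
  have "orbit ?G (\<lambda>f. f) x = Q"
    using unique_orbit[OF x] element_image[OF _ x] by (auto simp: orbit_def)
  then have "p dvd order ?G"
    using orbit_stabilizer_theorem[OF x] p(2) by (metis dvd_mult2)
  then obtain m where "order ?G = p ^ 1 * m"
    by auto
  then obtain H where H: "subgroup H ?G" "card H = p"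
    using sylow_thm[OF p(1) G.is_group _ finG, of 1 m] by auto
  then have "finite H" "H \<noteq> {\<one>\<^bsub>?G\<^esub>}"
    using p(1) finG finite_subset[OF subgroup.subset[OF H(1)]] by auto
  then obtain z where z: "z \<in> H" "z \<noteq> \<one>\<^bsub>?G\<^esub>"
    using subgroup.one_closed[OF H(1)] by blast
  interpret H: group "?G\<lparr>carrier := H\<rparr>"
    using H(1) by (rule subgroup.subgroup_is_group) (rule G.is_group)
  have zG: "z \<in> carrier ?G"
    using z subgroup.subset[OF H(1)] by blast
  have "z [^]\<^bsub>?G\<lparr>carrier := H\<rparr>\<^esub> order (?G\<lparr>carrier := H\<rparr>) = \<one>\<^bsub>?G\<^esub>"
    using H.pow_order_eq_1[of z] z by simp
  then have "z [^]\<^bsub>?G\<^esub> p = \<one>\<^bsub>?G\<^esub>"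
    using H(2) by (simp add: order_def G.nat_pow_consistent[symmetric])
  then have "(z ^^ p) x = x" if "x \<in> Q" for x
    using Int_pow_apply[OF zG that, of p] that by (simp add: quandle_Int_def Aut_one)
  moreover have "z \<in> Aut_set" "z \<in> extensional Q"
    using zG Int_carrier_subset by auto
  moreover have "\<exists>x\<in>Q. z x \<noteq> x"
  proof (rule ccontr)
    assume "\<not> (\<exists>x\<in>Q. z x \<noteq> x)"
    then have "z = (\<lambda>x\<in>Q. x)"
      using \<open>z \<in> extensional Q\<close> by (intro extensionalityI[where A = Q]) auto
    with z(2) show False
      by (simp add: quandle_Int_def Aut_one)
  qed
  ultimately show ?thesis
    using that by blast
qed

section \<open>Powers of translations, and removal of fixed points\<close>

lemma star_bij: "a \<in> Q \<Longrightarrow> bij_betw (\<lambda>x. x \<star> a) Q Q"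
  using right_translation_Aut[of a]
  by (simp add: quandle_Aut_def quandle_iso_def right_translation_def cong: bij_betw_cong)

lemma star_pow_in: "\<lbrakk>c \<in> Q; x \<in> Q\<rbrakk> \<Longrightarrow> ((\<lambda>x. x \<star> c) ^^ k) x \<in> Q"
  by (induction k) (auto simp: closed)

lemma star_pow_self: "c \<in> Q \<Longrightarrow> ((\<lambda>x. x \<star> c) ^^ k) c = c"
  by (induction k) (simp_all add: idem)

lemma star_pow_star:
  assumes "c \<in> Q" "x \<in> Q" "y \<in> Q"
  shows "((\<lambda>x. x \<star> c) ^^ k) (x \<star> y) = ((\<lambda>x. x \<star> c) ^^ k) x \<star> ((\<lambda>x. x \<star> c) ^^ k) y"
  using assms by (induction k) (auto simp: star_pow_in intro: distrib)

text \<open>Conjugation by \<open>g\<close> turns the translation by \<open>c\<close> into that by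
  \<open>g c\<close>. This is how the support of a power of one translation is transported to
  another.\<close>

lemma Aut_star_pow:
  assumes "g \<in> Aut_set" "c \<in> Q" "x \<in> Q"
  shows "g (((\<lambda>x. x \<star> c) ^^ k) x) = ((\<lambda>x. x \<star> g c) ^^ k) (g x)"
  using assms by (induction k) (auto simp: Aut_setD star_pow_in)

lemma Aut_pow:
  assumes "g \<in> Aut_set" "x \<in> Q" "y \<in> Q"
  shows "(g ^^ k) x \<in> Q" "(g ^^ k) (x \<star> y) = (g ^^ k) x \<star> (g ^^ k) y"
proof (induction k)
  case (Suc k)
  have "(g ^^ k) u \<in> Q" if "u \<in> Q" for u
    using bij_betw_funpow[OF Aut_setD(1)[OF assms(1)]] that by (rule bij_betw_apply)
  with Suc assms show "(g ^^ Suc k) x \<in> Q" "(g ^^ Suc k) (x \<star> y) = (g ^^ Suc k) x \<star> (g ^^ Suc k) y"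
    by (simp_all add: Aut_setD)
qed (use assms in simp_all)

text \<open>Otherwise \<open>z\<close> is a \<open>p\<close>-cycle on a set \<open>A\<close> and fixes its complement \<open>B\<close> pointwise. The
  translations by \<open>b \<in> B\<close> then commute with \<open>z\<close>, so on \<open>A\<close> they are powers of \<open>z\<close>. Either they
  all are trivial there, or suitable powers of them are \<open>p\<close>-cycles with support \<open>A\<close>, whose
  conjugates have support \<open>B\<close>; both contradict connectedness.\<close>

lemma ex_fixpoint_free_Aut:
  assumes conn: "connected_quandle Q star" and card: "card Q = 2 * p" and p: "prime p"
  obtains z where "z \<in> Aut_set" "\<And>x. x \<in> Q \<Longrightarrow> (z ^^ p) x = x" "\<And>x. x \<in> Q \<Longrightarrow> z x \<noteq> x"
proof -
  have p0: "0 < p" using p by (rule prime_gt_0_nat)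
  have fin: "finite Q" and ne: "Q \<noteq> {}"
    using card p0 card_gt_0_iff[of Q] by simp_all
  obtain z where z: "z \<in> Aut_set" and zp: "\<And>x. x \<in> Q \<Longrightarrow> (z ^^ p) x = x" and nt: "\<exists>x\<in>Q. z x \<noteq> x"
    using ex_Aut_prime_order[OF conn fin ne p] card by auto
  interpret prime_order_perm p Q z
    using p Aut_setD(1)[OF z] zp by unfold_locales
  have "z x \<noteq> x" if "x \<in> Q" for x
  proof
    assume "z x = x"
    obtain a where a: "a \<in> Q" "z a \<noteq> a" using nt by blast
    define A where "A = orb a"
    define B where "B = Q - A"
    have A: "A \<subseteq> Q" "a \<in> A" "card A = p" "finite A"
      using self_in_orb[OF a(1)] orb_subset[OF a(1)] card_orb[OF a] finite_subset[OF _ fin]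
      unfolding A_def by simp_all
    have B: "B \<subseteq> Q" "card B = p" "finite B"
      using A card fin by (auto simp: B_def card_Diff_subset)
    have moved: "z y \<noteq> y" if "y \<in> A" for y
      using orb_moved[OF a] that by (simp add: A_def)
    \<comment> \<open>A second orbit of moved points would fill \<open>Q\<close> together with
      \<open>A\<close> and leave no room for the fixed point \<open>x\<close>.\<close>
    have fixed: "z y = y" if "y \<in> B" for y
    proof (rule ccontr)
      assume "z y \<noteq> y"
      then have "orb a \<union> orb y = Q"
        using orb_Un_eq[OF fin card a(1) _ a(2), of y] that by (simp add: B_def A_def)
      then have "z x \<noteq> x"
        using \<open>x \<in> Q\<close> orb_moved[OF a] orb_moved[of y x] \<open>z y \<noteq> y\<close> that by (auto simp: B_def)
      with \<open>z x = x\<close> show False by simp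
    qed
    have not_inv: "\<exists>x\<in>S. \<exists>y\<in>Q. x \<star> y \<notin> S" if "S \<subseteq> Q" "card S = p" for S
    proof (rule ccontr)
      assume "\<not> ?thesis"
      moreover have "S \<noteq> {}" using that p0 by auto
      ultimately have "S = Q"
        using connected_imp_no_invariant[OF conn fin that(1)] by blast
      with that card p0 show False by simp
    qed
    have mem: "y \<in> B \<longleftrightarrow> y \<notin> A" if "y \<in> Q" for y
      using that by (simp add: B_def)
    \<comment> \<open>Since \<open>z b = b\<close>, the translation by \<open>b\<close> commutes
      with \<open>z\<close>, so it preserves the fixed set \<open>B\<close> and the moved set
      \<open>A\<close>.\<close>
    have z_star: "z (x \<star> b) = z x \<star> b" if "x \<in> Q" "b \<in> B" for x b
      using fixed[OF that(2)] Aut_setD(3)[OF z that(1), of b] B(1) that(2) by auto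
    have pow_star: "(z ^^ i) x \<star> b = (z ^^ i) (x \<star> b)" if xb: "x \<in> Q" "b \<in> B" for x b i
    proof (induction i)
      case (Suc i)
      then show ?case
        using z_star[OF pow_in[OF xb(1)] xb(2), of i] by simp
    qed simp
    have A_star: "x \<star> b \<in> A" if xb: "x \<in> A" "b \<in> B" for x b
    proof (rule ccontr)
      have Q: "x \<in> Q" "b \<in> Q" using xb A B by blast+
      assume "x \<star> b \<notin> A"
      then have "z x \<star> b = x \<star> b"
        using mem closed[OF Q] fixed z_star[OF Q(1) xb(2)] by simp
      then show False
        using star_cancel[OF Aut_setD(2)[OF z Q(1)] Q] moved[OF xb(1)] by simp
    qed
    have B_star: "x \<star> b \<in> B" if xb: "x \<in> B" "b \<in> B" for x b
    proof (rule ccontr)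
      have Q: "x \<in> Q" "b \<in> Q" using xb B by blast+
      assume "x \<star> b \<notin> B"
      then have "z (x \<star> b) \<noteq> x \<star> b"
        using mem closed[OF Q] moved by simp
      then show False
        using z_star[OF Q(1) xb(2)] fixed[OF xb(1)] by simp
    qed
    \<comment> \<open>Some translation must leave \<open>B\<close>. Those by elements of
      \<open>B\<close> do not, so the element responsible lies in \<open>A\<close>.\<close>
    obtain b a' where ba': "b \<in> B" "a' \<in> Q" "b \<star> a' \<notin> B"
      using not_inv[OF B(1,2)] by blast
    have ab: "b \<in> B" "a' \<in> A" "b \<star> a' \<in> A"
      using ba' B_star mem closed[OF subsetD[OF B(1) ba'(1)] ba'(2)] by blast+
    have not_A_star: "\<exists>x\<in>A. \<exists>y\<in>A. x \<star> y \<notin> A"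
    proof -
      obtain x y where "x \<in> A" "y \<in> Q" "x \<star> y \<notin> A"
        using not_inv[OF A(1,3)] by blast
      then show ?thesis
        using A_star mem by blast
    qed
    have A_eq: "\<exists>i. y = (z ^^ i) x" if xy: "x \<in> A" "y \<in> A" for x y
    proof -
      obtain i j where "x = (z ^^ i) a" "y = (z ^^ j) a" "i < p"
        using xy by (auto simp: A_def orb_def)
      then have "y = (z ^^ (j + (p - i))) x"
        using zp[OF a(1)] funpow_add[of j "p - i" z] funpow_add[of "p - i" i z]
        by simp
      then show ?thesis by blast
    qed
    \<comment> \<open>If \<open>a\<close> were fixed, the translation by \<open>b\<close> would be
      trivial on all of \<open>A\<close>, a single orbit of \<open>z\<close>. It would fix
      \<open>a'\<close>, hence commute with the translation by \<open>a'\<close> and coincide with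
      its own conjugate, the translation by \<open>c\<close>. Conjugating by powers of
      \<open>z\<close>, all translations by elements of \<open>A\<close> would preserve
      \<open>A\<close>.\<close>
    have ex_moved: "a \<star> b \<noteq> a"
    proof
      assume triv: "a \<star> b = a"
      define c where "c = b \<star> a'"
      obtain i where "a' = (z ^^ i) a" using A_eq A ab by blast
      then have a'b: "a' \<star> b = a'"
        using pow_star[OF a(1) ab(1), of i] triv by simp
      have same: "y \<star> b = y \<star> c" if y: "y \<in> Q" for y
      proof -
        obtain x where x: "x \<in> Q" "y = x \<star> a'"
          using ex1_right_quotient[OF y ba'(2)] by blast
        then have "y \<star> b = (x \<star> b) \<star> (a' \<star> b)"
          using distrib[OF x(1) ba'(2)] ab B by blast
        also have "\<dots> = (x \<star> a') \<star> (b \<star> a')"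
          using a'b distrib[OF x(1) _ ba'(2), of b] ab B by auto
        finally show ?thesis
          using x by (simp add: c_def)
      qed
      have "x \<star> y \<in> A" if xy: "x \<in> A" "y \<in> A" for x y
      proof -
        obtain i where i: "y = (z ^^ i) c" using A_eq ab(3) xy(2) unfolding c_def by blast
        obtain x' where x': "x' \<in> Q" "x = (z ^^ i) x'"
          using pow_bij[of i] xy A by (metis bij_betw_imp_surj_on imageE subsetD)
        have "x' \<in> A"
        proof (rule ccontr)
          assume "x' \<notin> A"
          then have "z x' = x'"
            using x'(1) mem fixed by simp
          then have "(z ^^ i) x' = x'"
            by (induction i) simp_all
          with x' \<open>x' \<notin> A\<close> xy show False by simp
        qed
        have "x \<star> y = (z ^^ i) (x' \<star> c)"
          using Aut_pow(2)[OF z x'(1), of c i] ab(3) A(1) i x' by (auto simp: c_def)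
        also have "x' \<star> c = x' \<star> b"
          using same x' by simp
        finally show ?thesis
          using A_star[OF \<open>x' \<in> A\<close> ab(1)] pow_in_orb[OF a(1)] by (simp add: A_def)
      qed
      with not_A_star show False by blast
    qed
    have fix_b: "x \<in> B" if "x \<in> Q" "x \<star> b = x" for x
    proof (rule ccontr)
      assume "x \<notin> B"
      then have "x \<in> A" using that by (auto simp: B_def)
      then obtain i where "a = (z ^^ i) x" using A_eq A by blast
      then have "a \<star> b = a"
        using pow_star[of x b i] that ab by simp
      with ex_moved show False ..
    qed
    \<comment> \<open>A count of fixed points. By \<open>fix_b\<close> those of the translation by
      \<open>b\<close> lie in \<open>B\<close>, so its conjugate, the translation by
      \<open>b'\<close>, has at most \<open>p\<close> of them. If it fixed \<open>x\<close> it would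
      fix all of \<open>A\<close> and also \<open>b'\<close>, which makes
      \<open>p + 1\<close>.\<close>
    have star_moved: "x \<star> b' \<noteq> x" if b': "b' \<in> B" and x: "x \<in> A" for b' x
    proof
      assume xb: "x \<star> b' = x"
      obtain h where h: "h \<in> Aut_set" "h b = b'"
        using connected_transitive[OF conn] ab B b' by blast
      have "y \<in> h ` B" if y: "y \<in> insert b' A" for y
      proof -
        have "y \<in> Q" using y A B b' by auto
        have yb: "y \<star> b' = y"
        proof (cases "y = b'")
          case True
          then show ?thesis using idem b' B by auto
        next
          case False
          then obtain i where "y = (z ^^ i) x" using A_eq x y by blast
          then show ?thesis using pow_star[of x b' i] xb x A b' by auto
        qed
        obtain w where w: "w \<in> Q" "y = h w"
          using Aut_setD(1)[OF h(1)] \<open>y \<in> Q\<close> by (metis bij_betw_imp_surj_on imageE)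
        then have "h (w \<star> b) = h w"
          using yb h ab B Aut_setD(3)[OF h(1), of w b] by auto
        then have "w \<star> b = w"
          using Aut_setD(1)[OF h(1)] w ab B closed[of w b] by (auto simp: bij_betw_def inj_on_def)
        then show ?thesis
          using fix_b w by blast
      qed
      then have "card (insert b' A) \<le> card (h ` B)"
        using B by (intro card_mono) auto
      also have "\<dots> \<le> p"
        using card_image_le[OF B(3), of h] B by simp
      finally show False
        using A b' by (simp add: B_def)
    qed
    \<comment> \<open>The exponent \<open>fact (p - 1)\<close> annihilates the permutation of the
      \<open>p - 1\<close> points of \<open>B - {b}\<close>, yet it is prime to \<open>p\<close>, so
      the action on \<open>A\<close> as a nontrivial power of \<open>z\<close> survives. The support
      of \<open>w b\<close> is thus exactly \<open>A\<close>.\<close>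
    define w where "w c = (\<lambda>x. x \<star> c) ^^ fact (p - 1)" for c
    have w_star: "w c (x \<star> y) = w c x \<star> w c y" if "c \<in> Q" "x \<in> Q" "y \<in> Q" for c x y
      using that by (simp add: w_def star_pow_star)
    have w_in: "w c x \<in> Q" if "c \<in> Q" "x \<in> Q" for c x
      using that by (simp add: w_def star_pow_in)
    have w_B: "w b x = x" if "x \<in> B" for x
    proof (cases "x = b")
      case True
      then show ?thesis
        using star_pow_self ab B by (auto simp: w_def)
    next
      case False
      have inj: "inj_on (\<lambda>x. x \<star> b) (B - {b})"
        using star_cancel ab B by (auto simp: inj_on_def)
      have "x \<star> b \<noteq> b" if "x \<in> B" "x \<noteq> b" for x
        using that star_cancel[of x b b] idem[of b] ab B by auto
      then have sub: "(\<lambda>x. x \<star> b) ` (B - {b}) \<subseteq> B - {b}"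
        using B_star ab by auto
      then have "bij_betw (\<lambda>x. x \<star> b) (B - {b}) (B - {b})"
        using inj B(3) by (simp add: bij_betw_def endo_inj_surj)
      then show ?thesis
        unfolding w_def using False that ab B by (intro fact_pow_eq_self[where C = "B - {b}"]) auto
    qed
    \<comment> \<open>The translation by \<open>b\<close> commutes with \<open>z\<close>, so its
      value at \<open>a\<close> determines it on \<open>A\<close>: there it acts as
      \<open>z ^^ k\<close>.\<close>
    obtain k where k: "a \<star> b = (z ^^ k) a"
      using A_eq A_star A ab by blast
    have w_A: "w b x \<noteq> x" if x: "x \<in> A" for x
    proof -
      obtain i where i: "x = (z ^^ i) a" using A_eq A x by blast
      have "((\<lambda>x. x \<star> b) ^^ j) x = (z ^^ (k * j)) x" for j
      proof (induction j)
        case (Suc j)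
        have "((\<lambda>x. x \<star> b) ^^ Suc j) x = (z ^^ (k * j + i)) (a \<star> b)"
          using Suc pow_star[of a b "k * j + i"] a ab i by (simp add: funpow_add)
        also have "\<dots> = (z ^^ (k * Suc j)) x"
          unfolding i k by (simp add: funpow_add[symmetric, THEN fun_cong, unfolded comp_apply] ac_simps)
        finally show ?case .
      qed simp
      moreover have "\<not> p dvd k * fact (p - 1)"
      proof -
        have "\<not> p dvd k"
          using ex_moved k pow_mod[OF a(1), of k] by auto
        moreover have "\<not> p dvd fact (p - 1)"
          using p p0 by (simp add: prime_dvd_fact_iff)
        ultimately show ?thesis
          using p by (simp add: prime_dvd_mult_iff)
      qed
      ultimately show ?thesis
        using pow_moved[of x] moved[OF x] x A by (auto simp: w_def)
    qed
    \<comment> \<open>This contradicts the choice of \<open>b\<close> and \<open>a'\<close>. The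
      support of \<open>w c\<close> is the image of \<open>A\<close> under \<open>g\<close>; once it
      is known to be \<open>B\<close>, the translation by \<open>c\<close> preserves it because it
      commutes with its own power \<open>w c\<close>.\<close>
    have inv_B: "x \<star> c \<in> B" if x: "x \<in> B" and c: "c \<in> A" for x c
    proof -
      obtain g where g: "g \<in> Aut_set" "g b = c"
        using connected_transitive[OF conn] ab A B c by blast
      have w_g: "w c (g x) = g (w b x)" if "x \<in> Q" for x
        using Aut_star_pow[OF g(1) _ that, of b] ab B g(2) by (auto simp: w_def)
      have inj: "inj_on g Q"
        using Aut_setD(1)[OF g(1)] by (simp add: bij_betw_def)
      have supp: "w c y \<noteq> y \<longleftrightarrow> y \<in> g ` A" if y: "y \<in> Q" for y
      proof -
        obtain u where u: "u \<in> Q" "y = g u"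
          using Aut_setD(1)[OF g(1)] y by (metis bij_betw_imp_surj_on imageE)
        have "w c y = y \<longleftrightarrow> w b u = u"
          using u w_g[OF u(1)] inj w_in[of b u] ab B by (auto simp: inj_on_def)
        also have "\<dots> \<longleftrightarrow> u \<notin> A"
          using w_A w_B u by (auto simp: B_def)
        also have "u \<in> A \<longleftrightarrow> y \<in> g ` A"
          using u inj A by (auto simp: inj_on_def)
        finally show ?thesis by blast
      qed
      have cQ: "c \<in> Q" using c A by blast
      have wc: "w c c = c" by (simp add: w_def star_pow_self cQ)
      \<comment> \<open>An automorphism that fixes \<open>c\<close> and \<open>y\<close> fixes
        everything reached from \<open>c\<close> by repeated translation by \<open>y\<close>. That
        is all of \<open>A\<close>, where this translation acts as \<open>z ^^ l\<close> with
        \<open>p\<close> not dividing \<open>l\<close>. The support of \<open>w c\<close> would then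
        avoid \<open>A\<close>, hence equal \<open>B\<close>, although \<open>y\<close> is not in
        it.\<close>
      have "w c y \<noteq> y" if y: "y \<in> B" for y
      proof
        assume wy: "w c y = y"
        have yQ: "y \<in> Q" using y B by blast
        obtain l where l: "c \<star> y = (z ^^ l) c"
          using A_eq A_star c y by blast
        have ndvd: "\<not> p dvd l"
          using star_moved[OF y c] l pow_mod[OF cQ, of l] by auto
        have "w c ((z ^^ (l * j)) c) = (z ^^ (l * j)) c" for j
        proof (induction j)
          case (Suc j)
          have *: "(z ^^ (l * Suc j)) c = (z ^^ (l * j)) c \<star> y"
            using pow_star[OF cQ y, of "l * j"] l by (simp add: funpow_add[symmetric, THEN fun_cong, unfolded comp_apply] ac_simps)
          show ?case
            unfolding * using w_star[OF cQ pow_in[OF cQ] yQ] Suc wy by simp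
        qed (simp add: wc)
        moreover have "\<exists>j. u = (z ^^ (l * j)) c" if u: "u \<in> A" for u
        proof -
          obtain i where i: "u = (z ^^ i) c" using A_eq c u by blast
          have "coprime l p"
            using p ndvd by (metis coprime_commute prime_imp_coprime)
          \<comment> \<open>With an inverse of \<open>l\<close> modulo \<open>p\<close>, the
            exponents \<open>l * j\<close> reach every residue.\<close>
          then obtain j where "[l * j = 1] (mod p)"
            using cong_solve_coprime_nat by auto
          then have "(l * (j * i)) mod p = i mod p"
            using cong_scalar_right[of "l * j" 1 p i] by (simp add: cong_def mult.assoc)
          then have "u = (z ^^ (l * (j * i))) c"
            unfolding i using pow_mod[OF cQ, of "l * (j * i)"] pow_mod[OF cQ, of i] by simp
          then show ?thesis by blast
        qed
        ultimately have "w c u = u" if "u \<in> A" for u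
          using that by metis
        then have "A \<inter> g ` A = {}"
          using supp A(1) by blast
        moreover have "g ` A \<subseteq> Q"
          using A(1) Aut_setD(2)[OF g(1)] by blast
        ultimately have "g ` A \<subseteq> B" unfolding B_def by blast
        moreover have "card (g ` A) = p"
          using card_image inj_on_subset[OF inj] A by metis
        ultimately have "g ` A = B"
          using B by (intro card_subset_eq) auto
        then show False
          using supp[OF yQ] wy y by blast
      qed
      then have "B \<subseteq> g ` A"
        using supp B by blast
      moreover have "card (g ` A) = p"
        using card_image inj_on_subset[OF inj] A by metis
      ultimately have gA: "g ` A = B"
        using B A by (metis card_subset_eq finite_imageI)
      have xQ: "x \<in> Q" using x B by blast
      have "w c (x \<star> c) = w c x \<star> c"
        using w_star[OF cQ xQ cQ] wc by simp
      moreover have "w c x \<noteq> x"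
        using supp xQ x gA by blast
      ultimately have "w c (x \<star> c) \<noteq> x \<star> c"
        using star_cancel[OF w_in[OF cQ xQ] xQ cQ] by auto
      then show ?thesis
        using supp closed xQ cQ gA by blast
    qed
    with ab show False by (auto simp: B_def)
  qed
  with z zp show ?thesis using that by blast
qed

text \<open>Some translation by \<open>y\<close> leaves the orbit of \<open>a\<close>. If
  \<open>y\<close> lies in the other orbit and its translation preserved that orbit, it would map it
  onto itself; but it also sends \<open>x\<close>, from the orbit of \<open>a\<close>, into it,
  against injectivity.\<close>

lemma ex_star_leaves_orb:
  assumes conn: "connected_quandle Q star" and card: "card Q = 2 * p"
    and "prime_order_perm p Q z" and moved: "\<And>x. x \<in> Q \<Longrightarrow> z x \<noteq> x"
  obtains x y where "y \<in> Q" "x \<in> prime_order_perm.orb p z y" "x \<star> y \<notin> prime_order_perm.orb p z y"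
proof -
  interpret prime_order_perm p Q z by fact
  have p0: "0 < p" using prime by (rule prime_gt_0_nat)
  have fin: "finite Q" and "Q \<noteq> {}"
    using card p0 card_gt_0_iff[of Q] by simp_all
  then obtain a where a: "a \<in> Q" by blast
  have A: "orb a \<subseteq> Q" "card (orb a) = p" "a \<in> orb a"
    using a orb_subset card_orb moved self_in_orb by simp_all
  have "orb a \<noteq> Q" using A(2) card p0 by auto
  then obtain x y where xy: "x \<in> orb a" "y \<in> Q" "x \<star> y \<notin> orb a"
    using connected_imp_no_invariant[OF conn fin A(1)] A(3) by blast
  show ?thesis
  proof (cases "y \<in> orb a")
    case True
    then have "orb y = orb a" using a orb_eq by blast
    with xy that show ?thesis by blast
  next
    case False
    then have un: "orb a \<union> orb y = Q" and dis: "orb a \<inter> orb y = {}"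
      using orb_Un_eq[OF fin card a xy(2)] moved orb_disjoint[OF a xy(2)] a xy(2) by simp_all
    have "\<exists>x'\<in>orb y. x' \<star> y \<notin> orb y"
    proof (rule ccontr)
      assume "\<not> ?thesis"
      then have "(\<lambda>u. u \<star> y) ` orb y \<subseteq> orb y" by blast
      moreover have "inj_on (\<lambda>u. u \<star> y) (orb y)"
        using star_bij[OF xy(2)] orb_subset[OF xy(2)] by (meson bij_betw_def inj_on_subset)
      ultimately have "(\<lambda>u. u \<star> y) ` orb y = orb y"
        using fin orb_subset[OF xy(2)] by (meson endo_inj_surj finite_subset)
      moreover have "x \<star> y \<in> orb y"
        using xy A(1) closed[of x y] un by blast
      ultimately obtain x' where x': "x' \<in> orb y" "x' \<star> y = x \<star> y"
        by (metis imageE)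
      then have "x' = x"
        using star_cancel[OF _ _ xy(2)] orb_subset[OF xy(2)] A(1) xy(1) by blast
      with x' xy dis show False by blast
    qed
    with xy that show ?thesis by blast
  qed
qed

lemma ex_shift_table:
  assumes conn: "connected_quandle Q star" and card: "card Q = 2 * p" and p: "prime p"
  obtains e t where "bij_betw e {..<2 * p} Q" "shift_table p t" "t 0 0 = 0" "t p p = p" "t 1 0 = p"
    "\<forall>i<2 * p. \<forall>j<2 * p. e (t i j) = e i \<star> e j"
proof -
  have p1: "1 < p" using p by (rule prime_gt_1_nat)
  have fin: "finite Q"
    using card p1 card_gt_0_iff[of Q] by simp
  obtain z where z: "z \<in> Aut_set" "\<And>x. x \<in> Q \<Longrightarrow> (z ^^ p) x = x" "\<And>x. x \<in> Q \<Longrightarrow> z x \<noteq> x"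
    using ex_fixpoint_free_Aut[OF conn card p] by blast
  then interpret Z: prime_order_perm p Q z
    using p Aut_setD(1) by unfold_locales auto
  obtain y x where yx: "y \<in> Q" "x \<in> Z.orb y" "x \<star> y \<notin> Z.orb y"
    using ex_star_leaves_orb[OF conn card Z.prime_order_perm_axioms z(3)] by blast
  obtain k where k: "x = (z ^^ k) y"
    using yx Z.orb_iff by blast
  have "x \<noteq> y"
    using yx idem Z.self_in_orb by auto
  then have ndvd: "\<not> p dvd k"
    using k Z.pow_mod[OF yx(1), of k] by auto
  \<comment> \<open>This power of \<open>z\<close> carries \<open>y\<close> to \<open>x\<close>, so
    that \<open>x \<star> y\<close> becomes \<open>g y \<star> y\<close>. As \<open>p\<close> does
    not divide \<open>k\<close>, the map \<open>g\<close> is again fixpoint free with trivial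
    \<open>p\<close>-th power.\<close>
  define g where "g = z ^^ k"
  have g_hom: "g (u \<star> v) = g u \<star> g v" if "u \<in> Q" "v \<in> Q" for u v
    using Aut_pow(2)[OF z(1) that] by (simp add: g_def)
  have g: "g \<in> Aut_set"
    using Z.pow_bij g_hom by (auto simp: g_def quandle_iso_def quandle_hom_def Z.pow_in)
  have gp: "(g ^^ p) u = u" if "u \<in> Q" for u
    using Z.pow_mod[OF that, of "p * k"] by (simp add: g_def funpow_mult mult.commute)
  interpret prime_order_perm p Q g
    using p gp Aut_setD(1)[OF g] by unfold_locales
  have moved: "g u \<noteq> u" if "u \<in> Q" for u
    using Z.pow_moved[OF that z(3)[OF that] ndvd] by (simp add: g_def)
  have "orb y \<subseteq> Z.orb y"
    using Z.orb_iff[OF yx(1)] orb_iff[OF yx(1)] by (auto simp: g_def funpow_mult)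
  \<comment> \<open>The start of the second cycle. Because \<open>c\<close> lies outside the orbit
    of \<open>y\<close>, the two cycles are disjoint; as \<open>1 < p\<close>, label
    \<open>1\<close> is \<open>g y\<close>, and the choice of \<open>c\<close> reads
    \<open>t 1 0 = p\<close>.\<close>
  define c where "c = g y \<star> y"
  have c: "c \<in> Q" "c \<notin> orb y"
    using yx k closed Aut_setD(2)[OF g] \<open>orb y \<subseteq> Z.orb y\<close> by (auto simp: c_def g_def)
  define e where "e i = (if i < p then (g ^^ i) y else (g ^^ (i - p)) c)" for i
  have "{..<2 * p} = {..<p} \<union> (+) p ` {..<p}"
    by (auto simp: lessThan_atLeast0 image_add_atLeastLessThan)
  then have "e ` {..<2 * p} = e ` {..<p} \<union> (\<lambda>i. e (p + i)) ` {..<p}"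
    by (simp add: image_Un image_image)
  also have "\<dots> = orb y \<union> orb c"
    unfolding orb_def by (intro arg_cong2[where f = union] image_cong) (auto simp: e_def)
  also have "\<dots> = Q"
    using orb_Un_eq[OF fin card] yx(1) c moved by blast
  finally have im: "e ` {..<2 * p} = Q" .
  then have inj: "inj_on e {..<2 * p}"
    using card by (intro eq_card_imp_inj_on) simp_all
  with im have bij: "bij_betw e {..<2 * p} Q" by (simp add: bij_betw_def)
  have e_in: "e i \<in> Q" if "i < 2 * p" for i
    using im that by auto
  have e_eq: "i = j" if "e i = e j" "i < 2 * p" "j < 2 * p" for i j
    using inj that by (auto simp: inj_on_def)
  have e_shift: "e (shift p l i) = (g ^^ l) (e i)" if i: "i < 2 * p" for l i
  proof -
    have *: "(g ^^ ((m + l) mod p)) u = (g ^^ l) ((g ^^ m) u)" if "u \<in> Q" for m u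
      using pow_mod[OF that, of "m + l"] funpow_add[of l m g] by (simp add: add.commute)
    show ?thesis
    proof (cases "i < p")
      case True
      then show ?thesis
        using *[OF yx(1), of i] p1 by (simp add: e_def shift_def)
    next
      case False
      then have "(i - p + l) mod p = (i + l) mod p"
        by (metis add.commute add_diff_inverse_nat mod_add_self1 add.assoc)
      then show ?thesis
        using *[OF c(1), of "i - p"] False by (simp add: e_def shift_def)
    qed
  qed
  define t where "t i j = inv_into {..<2 * p} e (e i \<star> e j)" for i j
  have t: "e (t i j) = e i \<star> e j" "t i j < 2 * p" if "i < 2 * p" "j < 2 * p" for i j
  proof -
    have ij: "e i \<star> e j \<in> e ` {..<2 * p}"
      using closed e_in that im by simp
    show "e (t i j) = e i \<star> e j"
      unfolding t_def using ij by (rule f_inv_into_f)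
    show "t i j < 2 * p"
      unfolding t_def using inv_into_into[OF ij] by simp
  qed
  have "shift_table p t"
  proof
    fix a b d assume a: "a < 2 * p" and b: "b < 2 * p" and d: "d < 2 * p"
    show "t (t a b) d = t (t a d) (t b d)"
      by (rule e_eq) (use a b d distrib e_in in \<open>simp_all add: t\<close>)
    show "a = b" if "t a d = t b d"
    proof (rule e_eq[OF _ a b])
      show "e a = e b"
        using t(1)[OF a d] t(1)[OF b d] that
        by (intro star_cancel[OF e_in[OF a] e_in[OF b] e_in[OF d]]) simp
    qed
  next
    fix a b l assume a: "a < 2 * p" and b: "b < 2 * p"
    show "t a b < 2 * p" using a b by (rule t)
    have "e (t (shift p l a) (shift p l b)) = e (shift p l (t a b))"
      using a b Aut_pow(2)[OF g e_in e_in, of a b l] by (simp add: t shift_less e_shift)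
    then show "t (shift p l a) (shift p l b) = shift p l (t a b)"
      using a b by (intro e_eq) (simp_all add: t shift_less)
  next
    fix S assume S: "S \<subseteq> {..<2 * p}" "S \<noteq> {}" and inv: "\<And>a b. \<lbrakk>a \<in> S; b < 2 * p\<rbrakk> \<Longrightarrow> t a b \<in> S"
    have "e ` S = Q"
    proof (rule connected_imp_no_invariant[OF conn fin])
      show "e ` S \<subseteq> Q" "e ` S \<noteq> {}" using S e_in by auto
      fix u v assume "u \<in> e ` S" "v \<in> Q"
      then obtain a b where "a \<in> S" "u = e a" "b < 2 * p" "v = e b"
        using im by auto
      moreover from this have "a < 2 * p" using S by auto
      ultimately show "u \<star> v \<in> e ` S"
        using inv t(1) by (metis imageI)
    qed
    then show "S = {..<2 * p}"
      using S(1) im inj by (metis inj_on_image_eq_iff order_refl)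
  qed
  moreover have "t 0 0 = 0" "t p p = p" "t 1 0 = p"
    using p1 t idem yx(1) c(1) by (auto intro!: e_eq simp: e_def c_def)
  ultimately show ?thesis
    using that bij t(1) by blast
qed

end

section \<open>Searching for tables\<close>

type_synonym row = "nat option list"

text \<open>A state records partial knowledge of the columns \<open>0\<close> and \<open>p\<close> of a table, each as a pair of
  the column and its inverse; shift invariance yields the other columns.\<close>

type_synonym state = "(row \<times> row) \<times> (row \<times> row)"

fun column :: "nat \<Rightarrow> state \<Rightarrow> nat \<Rightarrow> row \<times> row" where
  "column p (x, y) b = (if b < p then x else y)"

text \<open>Entry \<open>(a, b)\<close> is found in the base column of \<open>b\<close> at the row
  shifted back by \<open>b\<close>; the value read there is shifted forward again.\<close>

definition val :: "nat \<Rightarrow> state \<Rightarrow> nat \<Rightarrow> nat \<Rightarrow> nat option" where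
  "val p s a b = map_option (shift p b) (fst (column p s b) ! shift p (2 * p - b) a)"

definition ival :: "nat \<Rightarrow> state \<Rightarrow> nat \<Rightarrow> nat \<Rightarrow> nat option" where
  "ival p s v b = map_option (shift p b) (snd (column p s b) ! shift p (2 * p - b) v)"

fun upd :: "nat \<Rightarrow> nat \<Rightarrow> row \<times> row \<Rightarrow> row \<times> row" where
  "upd a v (c, i) = (c[a := Some v], i[v := Some a])"

text \<open>\<open>None\<close> signals a contradiction: the entry already has another value, or
  \<open>v\<close> already occurs elsewhere in column \<open>b\<close>, which right cancellation
  forbids. New knowledge is stored in the base column only.\<close>

definition setv :: "nat \<Rightarrow> nat \<Rightarrow> nat \<Rightarrow> state \<Rightarrow> nat \<Rightarrow> state option" where
  "setv p a b s v =
    (case val p s a b of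
      Some w \<Rightarrow> if w = v then Some s else None
    | None \<Rightarrow> (case ival p s v b of
        Some w \<Rightarrow> if w = a then Some s else None
      | None \<Rightarrow> Some ((if b < p then apfst else apsnd)
          (upd (shift p (2 * p - b) a) (shift p (2 * p - b) v)) s)))"

text \<open>One use of \<open>(a \<star> b) \<star> c = (a \<star> c) \<star> (b \<star> c)\<close>: whichever entry is determined by the
  known ones is filled in.\<close>

definition step :: "nat \<Rightarrow> nat \<Rightarrow> nat \<Rightarrow> nat \<Rightarrow> state \<Rightarrow> state option" where
  "step p a b c s =
    (case val p s b c of None \<Rightarrow> Some s | Some g \<Rightarrow>
      (case val p s a b of
        Some d \<Rightarrow> (case val p s a c of
          Some e \<Rightarrow> (case val p s e g of
            Some h \<Rightarrow> setv p d c s h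
          | None \<Rightarrow> (case val p s d c of None \<Rightarrow> Some s | Some h \<Rightarrow> setv p e g s h))
        | None \<Rightarrow> (case val p s d c of None \<Rightarrow> Some s | Some h \<Rightarrow>
            (case ival p s h g of None \<Rightarrow> Some s | Some e \<Rightarrow> setv p a c s e)))
      | None \<Rightarrow> (case val p s a c of None \<Rightarrow> Some s | Some e \<Rightarrow>
          (case val p s e g of None \<Rightarrow> Some s | Some h \<Rightarrow>
            (case ival p s h c of None \<Rightarrow> Some s | Some d \<Rightarrow> setv p a b s d)))))"

text \<open>The language of certificates, acting on the first state of a worklist.
  \<open>Split\<close> branches over the values of an entry, and \<open>Defer\<close> sets a state
  aside so that a surviving one does not block the others.\<close>

datatype instr =
    Use nat nat nat
  | Split nat nat
  | Closed "nat list"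
  | Defer

text \<open>Absence of label \<open>0\<close> certifies that the set is proper. An unknown entry
  counts as failure, so the set is invariant in every table that the state describes.\<close>

definition closed_under :: "nat \<Rightarrow> nat list \<Rightarrow> state \<Rightarrow> bool" where
  "closed_under p xs s \<longleftrightarrow> xs \<noteq> [] \<and> 0 \<notin> set xs \<and>
    list_all (\<lambda>a. a < 2 * p \<and> list_all (\<lambda>b. case val p s a b of None \<Rightarrow> False | Some v \<Rightarrow> v \<in> set xs)
      [0..<2 * p]) xs"

fun push :: "'s option \<Rightarrow> 's list \<Rightarrow> 's list" where
  "push None ss = ss"
| "push (Some s) ss = s # ss"

fun drop_if :: "bool \<Rightarrow> 's \<Rightarrow> 's list \<Rightarrow> 's list" where
  "drop_if True s ss = ss"
| "drop_if False s ss = s # ss"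

text \<open>An instruction with labels out of range leaves the worklist unchanged, so soundness
  holds for arbitrary instruction lists.\<close>

fun exec :: "nat \<Rightarrow> state list \<Rightarrow> instr \<Rightarrow> state list" where
  "exec p [] i = []"
| "exec p (s # ss) (Use a b c) =
    (if a < 2 * p \<and> b < 2 * p \<and> c < 2 * p then push (step p a b c s) ss else s # ss)"
| "exec p (s # ss) (Split a b) =
    (if a < 2 * p \<and> b < 2 * p then List.map_filter (setv p a b s) [0..<2 * p] @ ss else s # ss)"
| "exec p (s # ss) (Closed xs) = drop_if (closed_under p xs s) s ss"
| "exec p (s # ss) Defer = ss @ [s]"

definition run :: "nat \<Rightarrow> state list \<Rightarrow> instr list \<Rightarrow> state list" where
  "run p = foldl (exec p)"

text \<open>The seeds are idempotence at the two base labels and \<open>t 1 0 = p\<close>, which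
  records how the second cycle was chosen.\<close>

definition initial_state :: "nat \<Rightarrow> state" where
  "initial_state p =
    (upd 1 p (upd 0 0 (replicate (2 * p) None, replicate (2 * p) None)),
     upd p p (replicate (2 * p) None, replicate (2 * p) None))"

section \<open>Soundness of the search\<close>

context shift_table
begin

text \<open>Only recorded entries are constrained, so an empty column is known. The bound on a
  recorded preimage lets \<open>t_cancel\<close> apply to it.\<close>

definition knows_column :: "nat \<Rightarrow> row \<times> row \<Rightarrow> bool" where
  "knows_column b r \<longleftrightarrow> length (fst r) = 2 * p \<and> length (snd r) = 2 * p \<and>
    (\<forall>a<2 * p. \<forall>v. fst r ! a = Some v \<longrightarrow> t a b = v) \<and>
    (\<forall>v<2 * p. \<forall>a. snd r ! v = Some a \<longrightarrow> a < 2 * p \<and> t a b = v)"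

definition knows :: "state \<Rightarrow> bool" where
  "knows s \<longleftrightarrow> knows_column 0 (fst s) \<and> knows_column p (snd s)"

lemma knows_columnD:
  assumes "knows s"
  shows "knows_column (if b < p then 0 else p) (column p s b)"
  using assms by (cases s) (simp add: knows_def)

text \<open>An instance of \<open>t_shift\<close> with amount \<open>b\<close>, which takes the base
  label \<open>0\<close> or \<open>p\<close> to \<open>b\<close> itself.\<close>

lemma t_unshift:
  assumes "a < 2 * p" "b < 2 * p"
  shows "shift p b (t (shift p (2 * p - b) a) (if b < p then 0 else p)) = t a b"
proof -
  have "t (shift p b (shift p (2 * p - b) a)) (shift p b (if b < p then 0 else p)) =
      shift p b (t (shift p (2 * p - b) a) (if b < p then 0 else p))"
    using assms by (intro t_shift) (auto intro: shift_less)
  then show ?thesis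
    using assms by (simp only: shift_unshift shift_base less_imp_le)
qed

lemma val_sound:
  assumes "knows s" "a < 2 * p" "b < 2 * p" "val p s a b = Some v"
  shows "t a b = v" "v < 2 * p"
proof -
  obtain w where w: "fst (column p s b) ! shift p (2 * p - b) a = Some w" "v = shift p b w"
    using assms(4) by (auto simp: val_def)
  have "t (shift p (2 * p - b) a) (if b < p then 0 else p) = w"
    using knows_columnD[OF assms(1), of b] w(1) shift_less[OF assms(2)]
    by (simp add: knows_column_def)
  then show *: "t a b = v"
    using t_unshift[OF assms(2,3)] w(2) by simp
  show "v < 2 * p"
    using t_less[OF assms(2,3)] * by simp
qed

lemma ival_sound:
  assumes "knows s" "v < 2 * p" "b < 2 * p" "ival p s v b = Some a"
  shows "t a b = v" "a < 2 * p"
proof -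
  obtain w where w: "snd (column p s b) ! shift p (2 * p - b) v = Some w" "a = shift p b w"
    using assms(4) by (auto simp: ival_def)
  have *: "w < 2 * p" "t w (if b < p then 0 else p) = shift p (2 * p - b) v"
    using knows_columnD[OF assms(1), of b] w(1) shift_less[OF assms(2), of "2 * p - b"]
    unfolding knows_column_def by blast+
  show a: "a < 2 * p"
    using * w(2) by (simp add: shift_less)
  have "shift p (2 * p - b) a = w"
    using * w(2) assms(3) by (simp add: shift_unshift)
  then show "t a b = v"
    using t_unshift[OF a assms(3)] * assms(2,3) by (simp add: shift_unshift)
qed

lemma knows_column_upd:
  assumes "knows_column b r" "a < 2 * p" "v < 2 * p" "t a b = v"
  shows "knows_column b (upd a v r)"
  using assms by (cases r) (auto simp: knows_column_def nth_list_update split: if_splits)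

text \<open>The true value never causes a contradiction: a recorded value is correct by
  \<open>val_sound\<close>, and a recorded preimage of \<open>v\<close> equals \<open>a\<close> by
  right cancellation.\<close>

lemma setv_sound:
  assumes s: "knows s" and ab: "a < 2 * p" "b < 2 * p" and v: "t a b = v"
  shows "\<exists>s'. setv p a b s v = Some s' \<and> knows s'"
proof (cases "val p s a b")
  case (Some w)
  with val_sound[OF s ab] v s show ?thesis by (simp add: setv_def)
next
  case None
  have v': "v < 2 * p" using t_less[OF ab] v by simp
  show ?thesis
  proof (cases "ival p s v b")
    case (Some w)
    then have "w = a"
      using ival_sound[OF s v' ab(2)] t_cancel ab v by blast
    with Some None s show ?thesis by (simp add: setv_def)
  next
    case None': None
    have "shift p b (t (shift p (2 * p - b) a) (if b < p then 0 else p)) = v"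
      using t_unshift ab v by simp
    moreover have "t (shift p (2 * p - b) a) (if b < p then 0 else p) < 2 * p"
      using ab by (intro t_less) (auto intro: shift_less)
    ultimately have "t (shift p (2 * p - b) a) (if b < p then 0 else p) = shift p (2 * p - b) v"
      using ab by (metis shift_unshift(2) less_imp_le)
    then show ?thesis
      using s ab v' None None'
      by (cases s)
        (auto simp: setv_def knows_def shift_less simp del: upd.simps intro!: knows_column_upd
          split: if_splits)
  qed
qed

text \<open>Every branch that changes the state ends in one of four calls of \<open>setv\<close>,
  each with a true entry. Where an argument was found by inverse lookup, right cancellation
  identifies it as \<open>t a b\<close> or \<open>t a c\<close>.\<close>

lemma step_sound:
  assumes s: "knows s" and a: "a < 2 * p" and b: "b < 2 * p" and c: "c < 2 * p"
  shows "\<exists>s'. step p a b c s = Some s' \<and> knows s'"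
proof -
  have ab: "t a b < 2 * p" and ac: "t a c < 2 * p" and bc: "t b c < 2 * p"
    using a b c by (auto intro: t_less)
  have distr: "t (t a c) (t b c) = t (t a b) c"
    using t_distrib[OF a b c] by simp
  have left: "d = t a b" if "ival p s (t (t a b) c) c = Some d" for d
    using ival_sound[OF s t_less[OF ab c] c that] t_cancel[OF _ ab c] by simp
  have right: "e = t a c" if "ival p s (t (t a b) c) (t b c) = Some e" for e
    using ival_sound[OF s t_less[OF ab c] bc that] t_cancel[OF _ ac bc] distr by simp
  \<comment> \<open>Folding the existential keeps it opaque while the cases of \<open>step\<close>
    are split.\<close>
  define sound where "sound r \<longleftrightarrow> (\<exists>s'. r = Some s' \<and> knows s')" for r
  have "sound (Some s)"
    using s by (auto simp: sound_def)
  moreover have "sound (setv p (t a b) c s (t (t a b) c))" "sound (setv p (t a c) (t b c) s (t (t a b) c))"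
    "sound (setv p a b s (t a b))" "sound (setv p a c s (t a c))"
    using setv_sound[OF s] ab ac bc a b c distr unfolding sound_def by blast+
  ultimately have "sound (step p a b c s)"
    unfolding step_def
    by (auto split: option.split dest!: val_sound(1)[OF s a b] val_sound(1)[OF s a c] val_sound(1)[OF s b c]
        val_sound(1)[OF s ab c] val_sound(1)[OF s ac bc] left right simp: distr)
  then show ?thesis
    by (simp add: sound_def)
qed

text \<open>\<open>t_connected\<close> would force the closed set to contain all labels, including
  \<open>0\<close>.\<close>

lemma not_closed_under:
  assumes "knows s"
  shows "\<not> closed_under p xs s"
proof
  assume cl: "closed_under p xs s"
  have "set xs = {..<2 * p}"
  proof (rule t_connected)
    show "set xs \<subseteq> {..<2 * p}" "set xs \<noteq> {}"
      using cl by (auto simp: closed_under_def list_all_iff)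
  next
    fix a b assume a: "a \<in> set xs" and b: "b < 2 * p"
    then have "a < 2 * p" "case val p s a b of None \<Rightarrow> False | Some v \<Rightarrow> v \<in> set xs"
      using cl by (auto simp: closed_under_def list_all_iff)
    then show "t a b \<in> set xs"
      using val_sound(1)[OF assms \<open>a < 2 * p\<close> b] by (simp split: option.splits)
  qed
  moreover have "0 < 2 * p" "0 \<notin> set xs"
    using cl by (cases xs; force simp: closed_under_def)+
  ultimately show False
    by blast
qed

text \<open>The invariant of the search. If the head agrees with \<open>t\<close>, every instruction
  keeps it or a refinement of it; \<open>Split\<close> does so since \<open>t a b\<close> is among
  the values tried. If the head does not agree, the state that does is in the tail, which no
  instruction discards.\<close>

lemma exec_sound:
  assumes "\<exists>s\<in>set ss. knows s"
  shows "\<exists>s\<in>set (exec p ss i). knows s"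
proof -
  obtain s ss' where ss: "ss = s # ss'"
    using assms by (cases ss) auto
  show ?thesis
  proof (cases "knows s")
    case True
    show ?thesis
    proof (cases i)
      case (Use a b c)
      then show ?thesis
        using True step_sound[OF True, of a b c] by (auto simp: ss)
    next
      case (Split a b)
      have "\<exists>s'\<in>set (List.map_filter (setv p a b s) [0..<2 * p]). knows s'" if "a < 2 * p" "b < 2 * p"
        using setv_sound[OF True that refl] t_less[OF that]
        by (fastforce simp: List.map_filter_def)
      then show ?thesis
        using Split True by (auto simp: ss)
    next
      case (Closed xs)
      then show ?thesis
        using True not_closed_under[OF True, of xs] by (auto simp: ss)
    qed (use True in \<open>auto simp: ss\<close>)
  next
    case False
    then have *: "\<exists>s'\<in>set ss'. knows s'"
      using assms ss by simp
    have "\<exists>s'\<in>set (push r ss'). knows s'" "\<exists>s'\<in>set (drop_if b s ss'). knows s'" for r b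
      using * by (cases r; cases b; auto)+
    then show ?thesis
      using * by (cases i) (auto simp: ss)
  qed
qed

lemma run_sound: "\<exists>s\<in>set ss. knows s \<Longrightarrow> \<exists>s\<in>set (run p ss is). knows s"
  unfolding run_def by (induction "is" arbitrary: ss) (auto intro: exec_sound)

lemma initial_state_sound:
  assumes "1 < p" "t 0 0 = 0" "t p p = p" "t 1 0 = p"
  shows "knows (initial_state p)"
proof -
  have "knows_column b (replicate (2 * p) None, replicate (2 * p) None)" for b
    by (simp add: knows_column_def)
  then show ?thesis
    unfolding knows_def initial_state_def fst_conv snd_conv
    using assms by (intro conjI knows_column_upd) auto
qed

end

section \<open>Orders 10 and 14\<close>

lemmas run_eval = foldl.simps foldl_append exec.simps push.simps drop_if.simps step_def setv_def
  val_def ival_def column.simps upd.simps closed_under_def initial_state_def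
  list.pred_inject list.size map_filter_simps append.simps fst_conv snd_conv apfst_conv apsnd_conv
  option.map option.case option.inject if_True if_False simp_thms list.set insert_iff empty_iff list.distinct
  rel_simps

text \<open>The ground facts below let the simplifier index lists and shift numerals in a single step;
  this is what makes running the searches by rewriting feasible.\<close>

lemma nth_10_rows:
  "map ((!) [x0, x1, x2, x3, x4, x5, x6, x7, x8, x9]) [0, 1, 2, 3, 4, 5, 6, 7, 8, 9] =
    [x0, x1, x2, x3, x4, x5, x6, x7, x8, x9]"
  by simp

text \<open>Injectivity of list construction breaks the equation of lists into one rewrite rule per
  position.\<close>

lemmas nth_10 = nth_10_rows[simplified list.map list.inject simp_thms]

lemma update_10_rows:
  "map (\<lambda>i. [x0, x1, x2, x3, x4, x5, x6, x7, x8, x9][i := y])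
      [0, 1, 2, 3, 4, 5, 6, 7, 8, 9] =
    [[y, x1, x2, x3, x4, x5, x6, x7, x8, x9],
     [x0, y, x2, x3, x4, x5, x6, x7, x8, x9],
     [x0, x1, y, x3, x4, x5, x6, x7, x8, x9],
     [x0, x1, x2, y, x4, x5, x6, x7, x8, x9],
     [x0, x1, x2, x3, y, x5, x6, x7, x8, x9],
     [x0, x1, x2, x3, x4, y, x6, x7, x8, x9],
     [x0, x1, x2, x3, x4, x5, y, x7, x8, x9],
     [x0, x1, x2, x3, x4, x5, x6, y, x8, x9],
     [x0, x1, x2, x3, x4, x5, x6, x7, y, x9],
     [x0, x1, x2, x3, x4, x5, x6, x7, x8, y]]"
  by simp

lemmas update_10 = update_10_rows[simplified list.map list.inject simp_thms]

text \<open>The amounts run to \<open>10\<close> inclusive, because column \<open>0\<close> is read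
  with the shift \<open>2 * 5 - 0\<close>.\<close>

lemma shift_5_rows:
  "map (\<lambda>k. map (shift 5 k) [0, 1, 2, 3, 4, 5, 6, 7, 8, 9]) [0, 1, 2, 3, 4, 5, 6, 7, 8, 9, 10] =
    [[0, 1, 2, 3, 4, 5, 6, 7, 8, 9],
     [1, 2, 3, 4, 0, 6, 7, 8, 9, 5],
     [2, 3, 4, 0, 1, 7, 8, 9, 5, 6],
     [3, 4, 0, 1, 2, 8, 9, 5, 6, 7],
     [4, 0, 1, 2, 3, 9, 5, 6, 7, 8],
     [0, 1, 2, 3, 4, 5, 6, 7, 8, 9],
     [1, 2, 3, 4, 0, 6, 7, 8, 9, 5],
     [2, 3, 4, 0, 1, 7, 8, 9, 5, 6],
     [3, 4, 0, 1, 2, 8, 9, 5, 6, 7],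
     [4, 0, 1, 2, 3, 9, 5, 6, 7, 8],
     [0, 1, 2, 3, 4, 5, 6, 7, 8, 9]]"
  by (simp add: shift_def)

lemmas shift_5 = shift_5_rows[simplified list.map list.inject simp_thms]

lemma replicate_10: "replicate 10 x = [x, x, x, x, x, x, x, x, x, x]"
  by (simp add: numeral_eq_Suc)

lemma upt_10: "[0..<10] = [0, 1, 2, 3, 4, 5, 6, 7, 8, 9]"
  by (simp add: upt_rec)

lemma diff_10_row: "map ((-) 10) [0, 1, 2, 3, 4, 5, 6, 7, 8, 9] = ([10, 9, 8, 7, 6, 5, 4, 3, 2, 1] :: nat list)"
  by simp

lemma double_5: "2 * 5 = (10 :: nat)"
  by simp

lemmas eval_5 = run_eval nth_10 update_10 shift_5 replicate_10 upt_10 double_5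
  diff_10_row[simplified list.map list.inject simp_thms]

lemma nth_14_rows:
  "map ((!) [x0, x1, x2, x3, x4, x5, x6, x7, x8, x9, x10, x11, x12, x13]) [0, 1, 2, 3, 4, 5, 6, 7, 8, 9, 10, 11, 12, 13] =
    [x0, x1, x2, x3, x4, x5, x6, x7, x8, x9, x10, x11, x12, x13]"
  by simp

lemmas nth_14 = nth_14_rows[simplified list.map list.inject simp_thms]

lemma update_14_rows:
  "map (\<lambda>i. [x0, x1, x2, x3, x4, x5, x6, x7, x8, x9, x10, x11, x12, x13][i := y])
      [0, 1, 2, 3, 4, 5, 6, 7, 8, 9, 10, 11, 12, 13] =
    [[y, x1, x2, x3, x4, x5, x6, x7, x8, x9, x10, x11, x12, x13],
     [x0, y, x2, x3, x4, x5, x6, x7, x8, x9, x10, x11, x12, x13],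
     [x0, x1, y, x3, x4, x5, x6, x7, x8, x9, x10, x11, x12, x13],
     [x0, x1, x2, y, x4, x5, x6, x7, x8, x9, x10, x11, x12, x13],
     [x0, x1, x2, x3, y, x5, x6, x7, x8, x9, x10, x11, x12, x13],
     [x0, x1, x2, x3, x4, y, x6, x7, x8, x9, x10, x11, x12, x13],
     [x0, x1, x2, x3, x4, x5, y, x7, x8, x9, x10, x11, x12, x13],
     [x0, x1, x2, x3, x4, x5, x6, y, x8, x9, x10, x11, x12, x13],
     [x0, x1, x2, x3, x4, x5, x6, x7, y, x9, x10, x11, x12, x13],
     [x0, x1, x2, x3, x4, x5, x6, x7, x8, y, x10, x11, x12, x13],
     [x0, x1, x2, x3, x4, x5, x6, x7, x8, x9, y, x11, x12, x13],
     [x0, x1, x2, x3, x4, x5, x6, x7, x8, x9, x10, y, x12, x13],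
     [x0, x1, x2, x3, x4, x5, x6, x7, x8, x9, x10, x11, y, x13],
     [x0, x1, x2, x3, x4, x5, x6, x7, x8, x9, x10, x11, x12, y]]"
  by simp

lemmas update_14 = update_14_rows[simplified list.map list.inject simp_thms]

lemma shift_7_rows:
  "map (\<lambda>k. map (shift 7 k) [0, 1, 2, 3, 4, 5, 6, 7, 8, 9, 10, 11, 12, 13]) [0, 1, 2, 3, 4, 5, 6, 7, 8, 9, 10, 11, 12, 13, 14] =
    [[0, 1, 2, 3, 4, 5, 6, 7, 8, 9, 10, 11, 12, 13],
     [1, 2, 3, 4, 5, 6, 0, 8, 9, 10, 11, 12, 13, 7],
     [2, 3, 4, 5, 6, 0, 1, 9, 10, 11, 12, 13, 7, 8],
     [3, 4, 5, 6, 0, 1, 2, 10, 11, 12, 13, 7, 8, 9],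
     [4, 5, 6, 0, 1, 2, 3, 11, 12, 13, 7, 8, 9, 10],
     [5, 6, 0, 1, 2, 3, 4, 12, 13, 7, 8, 9, 10, 11],
     [6, 0, 1, 2, 3, 4, 5, 13, 7, 8, 9, 10, 11, 12],
     [0, 1, 2, 3, 4, 5, 6, 7, 8, 9, 10, 11, 12, 13],
     [1, 2, 3, 4, 5, 6, 0, 8, 9, 10, 11, 12, 13, 7],
     [2, 3, 4, 5, 6, 0, 1, 9, 10, 11, 12, 13, 7, 8],
     [3, 4, 5, 6, 0, 1, 2, 10, 11, 12, 13, 7, 8, 9],
     [4, 5, 6, 0, 1, 2, 3, 11, 12, 13, 7, 8, 9, 10],
     [5, 6, 0, 1, 2, 3, 4, 12, 13, 7, 8, 9, 10, 11],
     [6, 0, 1, 2, 3, 4, 5, 13, 7, 8, 9, 10, 11, 12],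
     [0, 1, 2, 3, 4, 5, 6, 7, 8, 9, 10, 11, 12, 13]]"
  by (simp add: shift_def)

lemmas shift_7 = shift_7_rows[simplified list.map list.inject simp_thms]

lemma replicate_14: "replicate 14 x = [x, x, x, x, x, x, x, x, x, x, x, x, x, x]"
  by (simp add: numeral_eq_Suc)

lemma upt_14: "[0..<14] = [0, 1, 2, 3, 4, 5, 6, 7, 8, 9, 10, 11, 12, 13]"
  by (simp add: upt_rec)

lemma diff_14_row: "map ((-) 14) [0, 1, 2, 3, 4, 5, 6, 7, 8, 9, 10, 11, 12, 13] = ([14, 13, 12, 11, 10, 9, 8, 7, 6, 5, 4, 3, 2, 1] :: nat list)"
  by simp

lemma double_7: "2 * 7 = (14 :: nat)"
  by simp

lemmas eval_7 = run_eval nth_14 update_14 shift_7 replicate_14 upt_14 double_7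
  diff_14_row[simplified list.map list.inject simp_thms]

section \<open>Certificate for p = 5\<close>

text \<open>The instruction lists are the output of a computer search.\<close>

definition search5_1 :: "instr list" where
  "search5_1 =
    [Split 4 0, Use 0 4 0, Split 2 0, Use 0 2 0, Use 4 2 0, Use 0 1 0, Use 4 2 0, Use 1 4 0, 
     Use 5 4 0, Use 6 5 0, Use 1 6 0, Use 0 1 0, Use 4 2 0, Use 1 4 0, Use 2 6 0, Use 6 9 0, 
     Use 1 0 5, Use 2 0 5, Use 7 0 5, Use 0 1 5, Use 7 2 5, Split 3 0, Use 3 1 0, Use 0 1 0, 
     Use 1 4 0, Use 1 7 0, Use 3 9 0, Use 4 0 5, Use 8 1 5, Use 1 4 5, Use 5 7 5, Use 8 7 5, 
     Use 2 1 0, Split 5 0, Use 5 1 0, Use 0 1 0, Use 1 4 0, Use 1 9 0, Use 2 0 5, Use 9 0 5, 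
     Use 5 1 5, Split 3 0, Use 1 3 0, Use 2 3 0, Use 4 3 0, Use 0 4 0, Use 1 4 0, Use 0 1 0, 
     Use 0 4 0, Use 1 3 0, Split 5 0, Use 5 1 0, Use 4 3 0, Use 1 4 0, Use 5 4 0, Split 7 0, 
     Use 4 1 0, Use 4 5 0, Use 9 5 0, Use 1 7 0, Use 5 7 0, Use 9 7 0, Use 6 9 0, Split 8 0, 
     Use 7 1 0, Use 5 1 0, Use 4 5 0, Use 8 3 0, Use 2 4 0, Use 7 4 0, Use 4 5 0, Split 6 0, 
     Use 2 1 0, Use 5 1 0, Use 0 1 0, Use 4 3 0, Use 0 4 0, Use 0 4 0, Use 0 4 0, Use 3 4 0, 
     Use 6 4 0, Use 0 1 0, Split 2 0, Use 1 2 0, Use 4 2 0, Use 9 2 0, Use 1 2 0, Use 4 2 0, 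
     Use 0 4 0, Use 4 9 0, Use 4 0 5, Use 1 2 0, Use 4 2 0, Use 0 4 0, Use 3 4 0, Use 8 4 0, 
     Use 9 5 0, Use 0 8 0, Use 1 9 0, Split 7 0, Use 5 1 0, Use 1 2 0, Use 0 4 0, Use 9 4 0, 
     Use 4 5 0, Use 4 9 0, Use 6 1 5, Use 2 3 5, Use 6 3 5, Use 7 3 5, Use 5 4 5, Use 6 4 5, 
     Split 3 0, Use 3 1 0, Use 0 1 0, Use 0 4 0, Use 1 0 5, Split 3 0, Use 3 1 0, Use 0 2 0, 
     Use 0 3 0, Use 1 4 0, Use 4 1 0, Use 1 3 0, Use 4 3 0, Use 1 7 0, Use 0 4 5, Split 5 0, 
     Split 2 0, Use 3 1 0, Use 1 4 0, Use 2 5 0, Use 6 5 0, Use 7 5 0, Closed [1,5], Use 3 1 0, 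
     Use 3 2 0, Use 7 2 0, Use 1 4 0, Use 7 5 0, Closed [1,5], Use 9 4 0, Use 5 4 0, Use 1 3 0, 
     Use 3 4 0, Use 3 7 0, Use 3 4 0, Use 3 8 0, Use 4 1 0, Use 4 3 0, Split 5 0, Use 1 3 0, 
     Use 5 3 0, Use 8 3 0, Split 2 0, Use 2 1 0, Use 3 1 0, Use 7 1 0, Closed [1,5], Use 2 1 0, 
     Use 3 1 0, Use 7 1 0, Closed [1,5], Use 5 1 0, Use 1 3 0, Use 5 1 0, Use 4 3 0, Split 3 0, 
     Use 1 3 0, Use 4 1 0, Use 1 3 0, Use 4 3 0, Use 0 4 0, Use 8 4 0, Use 4 8 0, Use 0 9 0, 
     Use 5 9 0, Use 5 1 5, Use 6 1 5, Use 8 1 5, Split 2 0, Use 2 1 0, Use 4 1 0, Use 1 3 0, 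
     Use 7 4 0, Use 4 3 0, Use 4 1 0, Split 2 0, Use 0 2 0, Use 0 2 0, Use 0 2 0, Use 0 3 0, 
     Use 1 3 0, Use 5 3 0, Use 0 2 0, Use 0 3 0, Use 2 4 0, Use 1 6 0, Use 3 6 0, Use 0 8 0]"

definition search5_2 :: "instr list" where
  "search5_2 =
    [Use 7 0 5, Split 9 0, Use 3 1 0, Use 1 2 0, Split 8 0, Use 4 3 0, Use 1 4 0, Use 4 1 0, 
     Use 4 3 0, Use 3 4 0, Use 4 5 0, Use 4 1 0, Use 4 3 0, Use 3 4 0, Use 8 5 0, Use 4 1 0, 
     Use 3 4 0, Use 4 1 0, Use 8 3 0, Use 3 4 0, Use 4 1 0, Use 3 4 0, Split 5 0, Use 3 4 0, 
     Use 1 3 0, Use 5 6 0, Use 9 7 5, Use 8 9 5, Use 2 1 0, Use 3 1 0, Use 3 4 0, Use 0 5 0, 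
     Use 3 4 0, Use 1 3 0, Use 3 4 0, Use 1 3 0, Use 8 6 0, Use 0 8 0, Use 3 4 0, Use 5 1 0, 
     Use 1 3 0, Use 0 4 0, Use 9 4 0, Use 0 6 0, Use 2 6 0, Use 0 9 0, Split 7 0, Use 0 1 0, 
     Use 3 4 0, Use 1 3 0, Split 7 0, Use 0 1 0, Use 1 3 0, Use 8 7 0, Use 0 8 0, Use 0 1 0, 
     Use 0 7 0, Use 0 1 0, Use 1 3 0, Use 0 6 5, Use 4 1 0, Use 5 1 0, Use 2 3 0, Use 0 1 0, 
     Use 1 3 0, Use 2 7 0, Use 4 7 0, Use 0 1 0, Use 1 3 0, Use 1 0 5, Use 1 3 0, Use 4 1 0, 
     Split 9 0, Use 0 4 0, Split 2 0, Use 4 2 0, Use 0 2 0, Use 5 1 0, Use 1 2 0, Use 4 2 0, 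
     Use 7 2 0, Use 8 4 0, Split 3 0, Use 3 1 0, Use 1 2 0, Use 2 3 5, Use 2 9 5, Use 1 2 0, 
     Use 0 9 0, Use 1 2 0, Use 5 9 0, Use 5 1 0, Use 0 4 0, Use 2 9 0, Use 2 1 0, Use 0 4 0, 
     Split 8 0, Use 0 1 0, Use 9 1 0, Use 1 3 0, Use 9 1 0, Use 0 1 0, Use 1 8 0, Use 9 1 0, 
     Use 0 1 0, Use 9 1 0, Use 0 5 0, Use 0 4 0, Split 2 0, Use 1 2 0, Use 1 2 0, Use 1 2 0, 
     Use 3 2 0, Use 2 9 0, Use 2 9 0, Use 1 2 0, Use 0 9 0, Use 2 9 0, Use 6 1 5, Use 0 3 5, 
     Use 0 4 0, Split 2 0, Use 1 2 0, Use 4 2 0, Use 4 2 0, Use 1 2 0, Use 1 2 0, Use 2 9 0, 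
     Use 6 3 5, Use 7 6 5, Use 1 2 0, Use 9 1 0, Use 7 4 0, Use 2 7 0, Use 8 7 0, Use 0 4 0, 
     Split 2 0, Use 0 2 0, Use 4 2 0, Use 1 2 0, Use 1 2 0, Use 4 2 0, Use 5 2 0, Use 6 2 0, 
     Use 1 2 0, Use 4 9 0, Use 1 0 5, Use 1 2 0, Use 2 9 0, Use 0 4 0, Split 2 0, Use 1 2 0, 
     Use 1 2 0, Use 2 1 0, Use 0 2 0, Use 1 2 0, Use 2 4 0, Use 3 9 0, Use 3 4 5, Use 1 2 0, 
     Use 9 4 0, Use 4 5 0, Use 5 9 0, Split 9 0, Use 0 1 0, Use 0 4 0, Use 1 9 0, Use 4 9 0, 
     Use 3 2 0, Use 0 1 0, Use 4 9 0, Use 0 4 0, Use 1 9 0, Use 0 4 0, Use 1 9 0, Use 2 1 0, 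
     Use 4 2 0, Use 0 1 0, Use 0 4 0, Split 1 5, Use 0 9 0, Use 1 0 5, Use 1 0 5, Use 1 0 5, 
     Use 1 0 5, Use 2 1 5, Use 1 0 5, Use 9 0 5, Use 0 1 5, Use 1 0 5, Use 0 1 0, Use 0 4 0, 
     Split 6 0, Use 1 6 0, Use 5 4 0, Use 9 5 0, Use 5 6 0, Use 6 4 0, Use 1 6 0, Use 1 6 0]"

definition search5_3 :: "instr list" where
  "search5_3 =
    [Use 9 8 0, Use 4 9 0, Use 4 9 0, Use 2 1 0, Use 4 2 0, Use 0 1 0, Use 0 4 0, Use 1 0 5, 
     Split 5 0, Use 9 4 0, Split 8 0, Use 8 4 0, Use 4 5 0, Use 4 7 0, Use 8 4 0, Use 9 1 0, 
     Split 2 0, Use 2 1 0, Use 1 4 0, Use 5 4 0, Split 3 0, Use 4 1 0, Use 3 2 0, Use 2 4 0, 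
     Closed [1,5], Use 4 1 0, Use 3 2 0, Use 5 3 0, Closed [1,5], Use 0 2 0, Use 2 1 0, Use 4 2 0, 
     Use 8 2 0, Split 3 0, Use 3 1 0, Use 4 1 0, Use 8 1 0, Closed [1,5], Use 3 1 0, Use 4 1 0, 
     Use 8 1 0, Closed [1,5], Use 4 2 0, Use 8 4 0, Use 8 5 0, Use 8 4 0, Use 5 1 0, Use 0 5 0, 
     Use 1 5 0, Use 7 5 0, Use 2 0 5, Use 5 4 0, Use 1 6 0, Use 5 6 0, Use 2 9 0, Use 4 9 0, 
     Use 5 1 0, Use 5 1 0, Use 0 5 0, Split 2 0, Use 0 2 0, Use 3 2 0, Use 4 2 0, Use 1 4 0, 
     Use 3 2 0, Use 2 4 0, Use 4 1 0, Split 6 0, Use 1 2 0, Use 8 2 0, Use 1 2 0, Use 2 1 0, 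
     Use 2 1 0, Use 1 2 0, Use 5 2 0, Use 6 2 0, Use 0 4 0, Use 3 4 0, Use 7 4 0, Use 8 4 0, 
     Use 9 4 0, Defer, Use 4 2 0, Use 1 4 0, Use 7 6 0, Use 0 7 0, Use 4 6 5, Use 5 6 5, Use 3 9 5, 
     Use 4 9 5, Use 0 1 0, Use 6 2 0, Use 5 4 0, Split 8 0, Use 6 1 0, Use 0 2 0, Use 3 2 0, 
     Use 4 2 0, Use 5 2 0, Use 9 2 0, Use 0 4 0, Split 6 0, Use 2 1 0, Split 5 0, Use 0 1 0, 
     Use 1 4 0, Use 6 5 0, Use 1 6 0, Use 0 1 0, Use 0 5 0, Use 0 1 0, Use 0 5 0, Use 0 1 0, 
     Use 1 0 5, Use 0 1 5, Use 0 1 0, Use 1 4 0, Use 1 0 5, Use 1 4 0, Use 2 1 0, Split 9 0, 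
     Use 4 2 0, Use 0 4 0, Use 2 1 0, Use 1 2 0, Use 0 4 0, Use 0 9 0, Use 0 4 0, Use 0 9 0, 
     Use 4 2 0, Use 0 4 0, Use 2 1 0, Use 1 2 0, Use 4 2 0, Use 0 4 0, Use 5 1 5, Use 4 2 0, 
     Use 0 4 0, Use 0 1 5, Split 5 0, Use 0 1 0, Use 4 2 0, Use 9 4 0, Use 5 9 0, Use 4 2 0, 
     Use 1 4 0, Use 4 5 0, Use 1 7 0, Use 4 2 0, Use 1 4 0, Use 7 5 0, Use 0 7 0, Use 4 2 0, 
     Use 1 4 0, Use 0 1 0, Use 4 2 0, Use 1 4 0, Use 2 7 0, Use 4 2 0, Use 1 4 0]"

text \<open>The one surviving state is completely filled, so it determines the table. Both columns
  equal their inverses: the base translations are involutions.\<close>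

lemma search_5:
  "run 5 [initial_state 5] (search5_1 @ search5_2 @ search5_3) =
    [(([Some 0, Some 5, Some 2, Some 3, Some 9, Some 1, Some 8, Some 7, Some 6, Some 4],
     [Some 0, Some 5, Some 2, Some 3, Some 9, Some 1, Some 8, Some 7, Some 6, Some 4]), ([Some 1, Some 0, Some 8, Some 3, Some 7, Some 5, Some 6, Some 4, Some 2, Some 9],
     [Some 1, Some 0, Some 8, Some 3, Some 7, Some 5, Some 6, Some 4, Some 2, Some 9]))]"
  unfolding run_def
  \<comment> \<open>The weak congruence rules evaluate only the discriminating argument, so branches
    not taken are never rewritten.\<close>
  by (simp only: eval_5 search5_1_def search5_2_def search5_3_def
    cong: option.case_cong_weak if_weak_cong)

section \<open>Certificate for p = 7\<close>

definition search7_1 :: "instr list" where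
  "search7_1 =
    [Split 6 0, Use 0 6 0, Split 2 0, Use 0 1 0, Split 11 0, Use 1 2 0, Use 1 2 0, Use 1 2 0, 
     Use 1 2 0, Use 13 2 0, Use 10 3 0, Use 13 2 0, Use 1 2 0, Use 13 2 0, Use 7 3 0, Use 11 6 0, 
     Use 6 7 0, Use 9 7 0, Use 1 9 0, Use 1 2 0, Use 1 2 0, Use 6 3 0, Use 1 2 0, Use 3 2 0, 
     Use 11 2 0, Use 13 2 0, Use 4 2 0, Use 6 2 0, Use 4 2 0, Use 6 2 0, Use 0 3 0, Use 1 6 0, 
     Use 0 2 0, Use 0 1 0, Use 1 6 0, Split 8 0, Use 0 7 0, Use 0 7 0, Use 0 7 0, Use 2 1 0, 
     Use 6 2 0, Use 8 2 0, Use 0 7 0, Use 0 7 0, Use 7 6 0, Use 0 7 0, Use 2 1 0, Use 1 8 0, 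
     Use 9 8 0, Use 8 9 0, Use 0 1 0, Use 1 6 0, Use 8 13 0, Split 4 0, Use 6 4 0, Use 8 2 0, 
     Use 1 4 0, Use 6 4 0, Use 6 4 0, Use 6 8 0, Use 10 8 0, Use 8 2 0, Use 1 4 0, Use 6 4 0, 
     Use 0 1 0, Use 1 6 0, Split 4 0, Use 1 4 0, Use 1 4 0, Use 13 4 0, Use 6 4 0, Use 3 6 0, 
     Use 13 4 0, Use 6 2 0, Use 13 4 0, Use 1 4 0, Use 13 4 0, Use 6 9 0, Use 3 13 0, Use 8 13 0, 
     Use 9 13 0, Use 0 4 7, Use 8 2 0, Use 0 1 0, Use 1 6 0, Split 4 0, Use 4 2 0, Use 2 4 0, 
     Use 10 4 0, Use 8 2 0, Use 6 4 0, Use 4 2 0, Use 1 4 0, Use 10 4 0, Use 10 4 0, Use 4 13 0, 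
     Use 10 4 0, Use 12 6 0, Use 0 10 0, Use 5 10 0, Use 0 12 0, Use 0 1 0, Use 1 6 0, Split 3 0, 
     Use 3 1 0, Use 13 2 0, Use 3 1 0, Use 5 2 0, Use 2 3 0, Use 6 3 0, Use 3 1 0, Use 1 2 0, 
     Use 1 2 0, Use 2 6 0, Use 1 10 0, Use 2 11 0, Use 3 1 0, Use 2 3 0, Use 0 1 0, Use 1 6 0, 
     Split 3 0, Use 0 3 0, Use 6 3 0, Use 0 3 0, Use 6 3 0, Use 6 3 0, Use 2 6 0, Use 3 8 0, 
     Use 1 13 0, Use 5 13 0, Use 2 6 0, Use 2 9 0, Use 2 6 0, Use 1 10 0, Use 3 12 0, Use 1 2 0, 
     Split 5 0, Use 5 6 0, Use 6 5 0, Use 0 6 0, Use 6 1 0, Use 6 5 0, Use 5 6 0, Use 0 12 0, 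
     Use 4 5 0, Use 6 5 0, Use 6 1 0, Use 0 6 0, Use 5 6 0, Use 5 13 0, Use 10 4 0, Use 13 6 0, 
     Use 5 7 0, Use 12 2 7, Use 7 4 0, Split 2 0, Use 0 2 0, Use 0 2 0, Use 0 2 0, Use 7 1 0, 
     Use 7 1 0, Use 4 1 0, Use 0 6 0, Use 5 6 0, Use 0 6 0, Use 5 6 0, Split 3 0, Use 1 3 0, 
     Use 6 3 0, Use 2 3 0, Use 2 3 0, Use 6 3 0, Use 2 6 0, Use 0 1 0, Use 6 5 0, Use 1 6 0, 
     Use 0 1 0, Use 3 5 0, Use 0 1 0, Use 6 5 0, Use 12 6 0, Use 0 6 0, Use 5 6 0, Use 0 6 0, 
     Use 5 6 0, Split 3 0, Use 1 3 0, Use 6 3 0, Use 6 3 0, Use 2 3 0, Use 2 3 0, Use 6 3 0, 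
     Use 0 1 0, Use 3 5 0, Use 0 1 0, Use 2 3 0, Use 0 1 0, Use 6 3 0, Use 0 6 0, Use 0 6 0]"

definition search7_2 :: "instr list" where
  "search7_2 =
    [Use 5 6 0, Use 11 5 0, Split 4 0, Use 1 4 0, Use 5 1 0, Use 5 1 0, Use 5 1 0, Use 5 1 0, 
     Use 5 1 0, Use 5 1 0, Use 5 1 0, Use 4 6 0, Split 4 0, Use 0 1 0, Use 0 6 0, Use 3 6 0, 
     Use 2 3 0, Use 1 4 0, Use 2 4 0, Use 1 4 0, Use 0 6 0, Use 13 12 0, Use 4 13 0, Use 3 4 0, 
     Use 0 1 0, Use 0 6 0, Use 6 13 0, Use 4 2 0, Use 0 1 0, Use 0 6 0, Use 13 6 0, Use 0 7 0, 
     Use 0 1 0, Use 0 6 0, Split 5 0, Use 5 4 0, Use 4 5 0, Use 12 5 0, Use 4 6 0, Use 4 5 0, 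
     Use 6 1 0, Use 5 4 0, Use 2 5 0, Use 6 5 0, Use 4 5 0, Use 5 6 0, Use 2 5 0, Use 6 1 0, 
     Use 0 13 0, Use 1 0 7, Use 0 1 7, Use 4 5 0, Use 0 1 0, Use 0 6 0, Split 5 0, Use 4 6 0, 
     Use 4 5 0, Use 6 5 0, Use 6 1 0, Use 5 4 0, Use 4 5 0, Use 6 5 0, Use 4 6 0, Use 6 5 0, 
     Use 4 6 0, Use 5 1 0, Use 8 5 0, Use 4 5 0, Use 4 6 0, Use 12 6 0, Use 1 11 0, Use 0 1 0, 
     Use 0 6 0, Use 6 4 0, Use 2 6 0, Use 0 6 0, Use 0 1 0, Use 0 6 0, Split 5 0, Use 4 5 0, 
     Use 11 5 0, Use 4 5 0, Use 6 5 0, Use 6 5 0, Use 4 6 0, Use 4 5 0, Use 6 5 0, Use 5 1 0, 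
     Use 13 5 0, Use 7 6 0, Use 13 6 0, Use 5 1 0, Split 2 0, Use 1 2 0, Use 0 2 0, Use 6 2 0, 
     Use 0 2 0, Use 0 2 0, Use 5 6 0, Use 6 2 0, Use 2 4 0, Use 0 1 0, Use 0 6 0, Split 5 0, 
     Use 4 5 0, Use 6 5 0, Use 6 5 0, Use 4 5 0, Use 0 5 0, Use 4 5 0, Use 6 5 0, Use 4 5 0, 
     Use 10 4 0, Use 4 6 0, Use 6 1 0, Use 4 5 0, Split 3 0, Use 6 3 0, Use 1 4 0, Use 0 6 0, 
     Split 2 0, Use 1 2 0, Use 3 2 0, Use 1 2 0, Use 2 3 0, Use 2 3 0, Use 7 3 0, Use 9 3 0, 
     Use 5 3 0, Use 6 3 0, Use 2 3 0, Use 9 3 0, Use 3 1 0, Use 0 2 0, Use 1 2 0, Use 6 3 0, 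
     Use 3 5 0, Use 6 3 0, Use 6 3 0, Use 0 6 0, Split 9 0, Use 2 3 0, Use 9 3 0, Use 9 3 0, 
     Use 9 3 0, Use 9 3 0, Use 9 3 0, Use 10 3 0, Use 7 6 0, Use 8 6 0, Use 9 3 0, Use 11 3 0, 
     Use 9 3 0, Use 12 3 0, Use 9 3 0, Use 0 3 0, Use 0 6 0, Split 5 0, Use 1 5 0, Use 3 5 0, 
     Use 0 1 0, Use 1 3 0, Use 1 5 0, Use 0 1 0, Use 2 3 0, Use 0 5 0, Use 0 1 0, Use 1 5 0, 
     Use 5 6 0, Use 5 12 0, Use 5 6 0, Use 0 1 0, Use 6 5 0, Use 0 1 0, Use 1 5 0, Use 0 6 0, 
     Split 12 0, Use 12 6 0, Use 6 3 0, Use 12 6 0, Use 0 12 0, Use 12 6 0, Use 12 6 0, Use 6 3 0, 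
     Use 0 12 0, Use 6 3 0, Use 12 6 0, Use 0 12 0, Use 1 13 0, Use 8 2 7, Use 3 6 0, Use 1 4 0, 
     Use 12 6 0, Use 3 6 0, Use 0 6 0, Use 0 6 0, Use 5 6 0, Use 3 5 0, Use 0 6 0, Split 4 0]"

definition search7_3 :: "instr list" where
  "search7_3 =
    [Use 3 4 0, Use 5 4 0, Use 4 1 0, Use 0 3 0, Use 1 4 0, Use 4 1 0, Use 0 3 0, Use 4 1 0, 
     Use 6 3 0, Use 5 6 0, Use 0 1 0, Use 5 4 0, Use 3 5 0, Use 0 3 0, Use 3 4 0, Use 4 1 0, 
     Use 13 3 0, Use 9 6 0, Use 4 1 0, Use 3 4 0, Use 0 6 0, Use 13 6 0, Split 4 0, Use 3 4 0, 
     Use 1 4 0, Use 6 4 0, Use 0 4 0, Use 3 4 0, Use 3 6 0, Use 7 9 0, Use 1 4 0, Use 4 7 0, 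
     Use 0 13 0, Use 0 3 0, Use 1 7 0, Use 4 1 0, Use 13 4 0, Use 3 6 0, Use 0 1 0, Split 2 0, 
     Use 1 2 0, Use 2 13 0, Use 6 13 0, Use 3 1 0, Use 4 2 0, Use 1 2 0, Use 1 6 0, Use 1 2 0, 
     Use 2 6 0, Use 3 10 0, Use 1 2 0, Use 8 2 0, Use 0 8 0, Use 6 13 0, Use 0 6 7, Use 4 2 0, 
     Use 1 4 0, Use 8 13 0, Split 3 0, Use 3 2 0, Use 0 3 0, Use 3 1 0, Use 3 1 0, Use 4 1 0, 
     Use 3 1 0, Use 1 2 0, Use 0 6 0, Use 13 0 7, Use 1 2 0, Use 0 6 0, Split 9 0, Use 3 2 0, 
     Use 6 3 0, Use 1 6 0, Use 1 6 0, Use 1 6 0, Use 1 6 0, Use 1 6 0, Use 1 6 0, Use 1 6 0, 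
     Use 1 6 0, Use 0 6 0, Use 2 6 0, Use 3 13 0, Use 1 0 7, Use 4 1 7, Use 1 2 0, Use 0 6 0, 
     Use 2 13 0, Use 9 3 7, Use 8 9 7, Use 7 8 7, Split 5 0, Use 6 1 0, Use 0 5 0, Use 0 2 0, 
     Use 6 1 0, Use 6 1 0, Use 6 1 0, Use 0 5 0, Use 0 2 0, Use 5 1 0, Use 4 2 0, Use 1 2 0, 
     Use 0 6 0, Split 7 0, Use 13 6 0, Use 13 6 0, Use 13 6 0, Use 13 6 0, Use 0 7 0, Use 0 7 0, 
     Use 13 6 0, Use 13 6 0, Use 13 6 0, Use 2 9 0, Use 7 13 0, Use 0 1 0, Use 0 6 0, Use 1 0 7, 
     Split 5 0, Use 5 1 0, Use 2 4 0, Use 5 6 0, Use 1 3 0, Use 5 6 0, Use 5 4 0, Use 5 6 0, 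
     Use 6 1 0, Use 6 5 0, Use 0 6 7, Split 4 0, Use 4 1 0, Use 0 3 0, Use 1 4 0, Use 0 4 0, 
     Use 1 5 0, Use 5 1 0, Use 1 4 0, Use 5 4 0, Use 1 10 0, Use 6 5 7, Split 7 0, Split 3 0, 
     Use 5 3 0, Use 4 1 0, Use 1 5 0, Use 10 7 0, Split 2 0, Use 3 1 0, Use 1 6 0, Use 2 7 0, 
     Use 8 7 0, Use 9 7 0, Closed [1,7], Use 3 1 0, Use 3 2 0, Use 9 2 0, Use 1 6 0, Use 9 7 0, 
     Closed [1,7], Use 6 3 0, Use 4 1 0, Use 4 3 0, Use 10 3 0, Use 1 5 0, Use 10 7 0, Split 2 0, 
     Use 2 1 0, Use 3 1 0, Use 9 1 0, Closed [1,7], Use 2 1 0, Use 3 1 0, Use 9 1 0, Closed [1,7], 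
     Use 13 6 0, Use 12 5 0, Use 7 5 0, Use 7 6 0, Use 7 5 0, Use 1 4 0, Use 1 4 0, Use 4 5 0, 
     Use 4 11 0, Use 4 6 0, Use 4 12 0, Use 5 1 0, Use 5 4 0, Split 7 0, Use 1 4 0, Use 7 4 0, 
     Use 11 4 0, Split 2 0, Use 2 1 0, Use 6 4 0, Use 12 4 0, Split 3 0, Use 4 1 0, Use 3 2 0]"

definition search7_4 :: "instr list" where
  "search7_4 =
    [Use 0 4 0, Closed [1,7], Use 4 1 0, Use 3 2 0, Use 6 3 0, Closed [1,7], Use 0 2 0, Use 2 1 0, 
     Use 4 2 0, Use 10 2 0, Split 3 0, Use 3 1 0, Use 4 1 0, Use 10 1 0, Closed [1,7], Use 3 1 0, 
     Use 4 1 0, Use 10 1 0, Closed [1,7], Use 0 2 0, Use 7 1 0, Use 1 4 0, Use 1 4 0, Use 7 1 0, 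
     Use 1 4 0, Use 5 4 0, Use 5 6 0, Use 6 1 0, Split 2 0, Use 2 1 0, Use 0 5 0, Use 3 2 0, 
     Use 1 2 0, Use 10 2 0, Use 0 2 0, Use 10 2 0, Use 13 2 0, Use 0 5 0, Use 4 2 0, Use 1 4 0, 
     Use 5 4 0, Use 9 4 0, Use 1 2 0, Use 5 6 0, Use 6 1 0, Use 2 10 0, Use 1 6 7, Use 5 6 7, 
     Use 2 1 0, Use 5 6 0, Use 5 11 0, Use 6 1 0, Use 13 1 0, Use 6 5 0, Use 5 12 0, Use 3 6 7, 
     Use 1 4 0, Use 5 6 0, Use 5 12 0, Use 6 1 0, Use 6 5 0, Split 7 0, Use 12 5 0, Split 4 0, 
     Use 1 4 0, Use 1 4 0, Use 5 4 0, Use 5 1 0, Use 1 4 0, Use 5 4 0, Use 5 7 0, Use 12 7 0, 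
     Split 2 0, Use 2 1 0, Use 0 5 0, Use 13 5 0, Split 3 0, Use 4 1 0, Use 3 2 0, Use 1 5 0, 
     Closed [1,7], Use 4 1 0, Use 3 2 0, Use 12 3 0, Closed [1,7], Use 0 2 0, Use 2 1 0, Use 4 2 0, 
     Use 10 2 0, Split 3 0, Use 3 1 0, Use 4 1 0, Use 10 1 0, Closed [1,7], Use 3 1 0, Use 4 1 0, 
     Use 10 1 0, Closed [1,7], Use 0 2 0, Use 5 4 0, Use 1 4 0, Use 7 4 0, Use 10 4 0, Use 1 4 0, 
     Use 5 4 0, Use 4 6 0, Use 5 7 0, Use 12 7 0, Split 2 0, Use 2 1 0, Use 6 4 0, Use 12 4 0, 
     Split 3 0, Use 4 1 0, Use 3 2 0, Use 0 4 0, Closed [1,7], Use 4 1 0, Use 3 2 0, Use 6 3 0, 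
     Closed [1,7], Use 1 2 0, Use 2 1 0, Use 4 2 0, Use 10 2 0, Split 3 0, Use 3 1 0, Use 4 1 0, 
     Use 10 1 0, Closed [1,7], Use 3 1 0, Use 4 1 0, Use 10 1 0, Closed [1,7], Use 1 2 0, Use 7 1 0, 
     Use 1 7 0, Use 7 5 0, Use 1 7 0, Use 4 9 0, Use 13 6 0, Use 0 7 0, Use 2 7 0, Use 7 1 0, 
     Use 12 5 0, Use 7 1 0, Use 1 5 0, Use 3 7 0, Use 6 7 0, Use 6 5 0, Split 13 0, Use 0 6 0, 
     Use 5 13 0, Use 5 6 7, Use 6 5 0, Use 12 6 0, Use 7 2 7, Use 0 6 0, Split 5 0, Use 3 5 0, 
     Use 5 13 0, Use 6 13 0, Use 1 0 7, Use 0 6 7, Use 0 13 0, Use 5 13 0, Use 5 1 0, Use 5 13 0, 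
     Use 6 7 0, Use 5 13 0, Use 7 6 7, Use 13 5 0, Use 2 6 0, Use 5 13 0, Use 0 1 0, Use 2 9 0, 
     Use 6 1 0, Use 0 13 0, Use 11 5 0, Use 3 11 0, Use 0 13 0, Use 6 13 0, Use 1 0 7, Use 0 6 0, 
     Split 5 0, Use 5 13 0, Use 6 5 0, Use 4 12 0, Use 5 13 0, Use 4 5 0, Use 6 1 0, Use 11 5 0, 
     Use 5 13 0, Use 13 3 0, Use 11 10 0, Use 5 13 0, Use 5 13 0, Use 5 6 0, Use 4 6 7, Use 6 9 7]"

definition search7_5 :: "instr list" where
  "search7_5 =
    [Use 4 7 0, Use 2 4 7, Use 5 13 0, Use 6 1 0, Use 5 13 0, Use 5 6 7, Use 8 6 7, Use 5 10 7, 
     Use 5 13 0, Split 2 0, Use 1 2 0, Use 0 2 0, Use 1 2 0, Use 0 2 0, Use 0 2 0, Use 1 2 0, 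
     Use 5 6 0, Use 6 7 0, Use 1 2 0, Use 2 5 0, Use 1 2 0, Use 6 5 0, Use 0 6 0, Split 9 0, 
     Use 0 1 0, Use 1 9 0, Use 0 6 7, Use 0 1 0, Use 6 13 0, Use 6 0 7, Use 0 8 7, Use 13 1 0, 
     Use 11 6 0, Use 0 1 0, Use 0 1 0, Use 1 9 0, Use 6 0 7, Use 8 6 7, Use 0 8 7, Use 0 1 0, 
     Use 2 9 0, Use 6 9 0, Use 1 0 7, Use 3 1 7, Use 0 1 0, Use 0 6 7, Use 0 13 7, Use 1 13 7, 
     Use 5 13 7, Use 0 9 0, Use 0 1 0, Use 6 13 0, Use 11 13 0, Use 6 0 7, Use 12 6 7, Use 12 8 7, 
     Use 0 11 7, Use 0 1 0, Use 13 9 0, Use 6 0 7, Use 9 0 7, Use 5 6 7, Use 0 1 0, Use 0 6 7, 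
     Split 11 0, Use 6 13 0, Use 6 13 0, Use 6 13 0, Use 12 1 0, Use 11 6 0, Use 6 13 0, Use 1 6 0, 
     Use 6 13 0, Use 6 13 0, Use 8 6 0, Use 1 8 0, Use 0 1 0, Split 2 0, Use 8 2 0, Use 2 6 0, 
     Use 8 2 0, Use 10 2 0, Use 1 6 0, Use 9 0 7, Use 0 6 7, Use 11 9 7, Use 7 11 7, Use 3 2 0, 
     Use 0 2 0, Use 8 2 0, Use 7 6 0, Use 0 7 0, Use 5 13 0, Use 5 13 0, Use 5 6 7, Use 5 1 0, 
     Use 5 13 0, Use 7 1 0, Use 0 7 0, Use 0 6 0, Split 9 0, Use 1 9 0, Use 0 1 0, Use 1 9 0, 
     Use 6 9 0, Use 1 13 0, Use 7 2 7, Use 8 2 7, Use 0 6 7, Use 0 1 0, Use 1 9 0, Use 6 0 7, 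
     Use 0 6 7, Use 7 8 7, Use 12 11 7, Use 7 1 0, Use 0 1 0, Use 0 1 0, Use 2 9 0, Use 0 1 0, 
     Use 1 13 0, Use 6 0 7, Use 0 1 0, Use 1 9 0, Use 1 13 0, Use 6 13 0, Use 0 2 7, Use 8 2 7, 
     Use 4 6 7, Use 0 1 0, Use 1 9 0, Use 0 1 0, Use 1 9 0, Use 8 13 0, Use 6 0 7, Use 8 0 7, 
     Use 9 6 7, Use 0 8 7, Use 5 8 7, Use 0 1 0, Use 1 9 0, Use 6 0 7, Use 0 6 7, Use 0 6 0, 
     Split 12 0, Use 13 1 0, Use 1 12 0, Split 8 0, Use 2 1 0, Use 0 2 0, Use 8 2 0, Use 8 2 0, 
     Use 8 2 0, Use 8 2 0, Use 8 2 0, Use 2 1 0, Use 13 2 0, Use 7 6 0, Use 8 2 0, Use 13 1 0, 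
     Use 6 3 0, Use 13 3 0, Use 13 1 0, Use 3 4 0, Use 9 4 0, Use 13 4 0, Use 6 5 0, Use 13 1 0, 
     Use 6 5 0, Use 13 1 0, Use 13 1 0, Use 2 10 0, Use 5 6 7, Use 10 1 0, Use 3 2 0, Use 6 3 0, 
     Use 13 1 0, Use 12 11 0, Use 7 13 0, Use 13 1 0, Use 13 1 0, Use 13 1 0, Use 0 13 0, Use 7 13 0, 
     Use 7 1 7, Use 0 8 7, Use 0 6 0, Split 9 0, Use 0 9 0, Use 1 9 0, Use 4 13 0, Use 0 1 0, 
     Use 6 13 0, Use 6 0 7, Use 0 6 7, Use 0 1 0, Split 11 0, Use 1 9 0, Use 1 10 0, Use 1 9 0]"

definition search7_6 :: "instr list" where
  "search7_6 =
    [Use 6 10 0, Use 0 11 0, Use 1 9 0, Use 12 1 0, Use 13 1 0, Use 1 9 0, Use 3 10 0, Use 12 10 0, 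
     Use 11 1 0, Use 1 9 0, Use 1 9 0, Use 10 9 0, Use 1 10 0, Use 1 9 0, Use 1 9 0, Use 1 9 0, 
     Split 10 0, Use 1 9 0, Use 1 9 0, Use 1 9 0, Use 1 9 0, Use 10 1 0, Use 1 9 0, Use 1 9 0, 
     Use 1 9 0, Use 1 9 0, Use 10 1 0, Use 1 9 0, Use 0 1 0, Use 9 1 0, Use 1 8 0, Use 0 1 0, 
     Use 6 13 0, Use 0 1 0, Split 8 0, Use 0 8 0, Use 0 8 0, Use 0 8 0, Use 0 8 0, Use 9 1 0, 
     Use 0 8 0, Use 0 8 0, Use 9 1 0, Use 8 6 0, Use 9 6 0, Use 12 6 0, Use 1 8 0, Use 6 8 0, 
     Use 0 9 0, Use 0 8 0, Use 2 9 0, Use 1 0 7, Use 6 0 7, Use 3 1 7, Use 0 1 0, Split 8 0, 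
     Use 0 8 0, Use 1 8 0, Use 0 8 0, Use 0 8 0, Use 9 1 0, Use 0 8 0, Use 1 8 0, Use 13 9 0, 
     Use 0 8 0, Use 12 6 0, Use 0 12 0, Use 0 1 0, Use 1 0 7, Use 7 1 7, Use 5 6 7, Use 1 10 7, 
     Use 7 10 7, Use 1 11 7, Use 6 2 0, Use 1 4 0, Use 0 6 0, Split 5 7, Use 5 6 7, Use 5 6 7, 
     Use 5 6 7, Use 0 1 0, Use 1 0 7, Split 10 0, Use 10 1 0, Use 10 1 0, Use 0 9 0, Use 10 1 0, 
     Use 6 10 0, Use 10 1 0, Use 3 9 0, Use 0 10 0, Use 10 1 0, Use 10 1 0, Use 10 1 0, Use 1 9 0, 
     Use 10 1 0, Use 10 13 0, Use 10 1 0, Use 9 10 0, Use 6 5 7, Use 5 6 7, Use 3 12 7, Use 5 3 7, 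
     Use 1 2 0, Use 5 6 7, Use 5 2 7, Use 0 3 0, Use 5 6 7, Split 8 7, Use 6 1 0, Use 4 6 0, 
     Use 6 8 7, Use 6 8 7, Use 6 8 7, Use 8 3 7, Use 6 8 7, Use 3 8 7, Use 6 1 0, Use 3 5 7, 
     Use 6 1 0, Use 1 3 7, Use 11 5 7, Use 4 6 7, Use 6 8 7, Use 6 8 7, Use 6 10 7, Use 5 6 7, 
     Use 4 5 7, Use 5 6 7, Use 4 13 7, Use 0 13 0, Use 7 1 7, Use 5 4 7, Use 5 6 7, Use 11 5 7, 
     Use 6 8 7, Use 5 6 7, Use 11 9 7, Use 13 9 7, Use 1 13 0, Use 0 6 7, Use 5 6 7, Use 5 6 7, 
     Use 1 13 0, Use 6 11 7, Use 5 4 7, Use 0 6 0, Split 5 7, Use 5 6 7, Use 4 13 0, Use 1 4 0, 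
     Use 2 5 0, Use 4 5 0, Use 2 6 0, Use 3 6 0, Use 0 13 0, Use 5 6 7, Use 5 6 7, Use 5 6 7, 
     Use 0 1 0, Use 6 5 7, Use 5 6 7, Use 12 6 7, Use 5 6 7, Split 8 7, Use 6 1 0, Use 4 6 0, 
     Use 8 6 7, Use 0 1 0, Use 6 0 7, Use 8 2 7, Use 8 2 7, Use 6 8 7, Use 6 8 7, Use 6 8 7, 
     Use 2 9 7, Use 0 1 0, Use 6 8 7, Use 8 2 7, Use 2 5 7, Use 6 8 7, Use 5 6 7, Use 0 13 0, 
     Use 9 3 7, Split 2 7, Use 1 13 0, Use 1 13 0, Use 3 2 7, Use 9 2 7, Use 3 2 7, Use 1 2 7, 
     Use 3 2 7, Use 1 2 7, Use 2 1 7, Use 5 6 7, Use 6 5 7, Use 5 6 7, Use 4 5 7, Use 3 13 0]"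

definition search7_7 :: "instr list" where
  "search7_7 =
    [Use 0 4 7, Use 0 6 7, Use 5 6 7, Use 5 6 7, Use 0 9 7, Use 0 1 0, Use 11 9 0, Use 13 11 0, 
     Use 1 0 7, Use 9 1 7, Use 5 6 7, Use 1 13 0, Use 1 2 7, Use 0 6 0, Split 9 0, Use 1 9 0, 
     Use 1 9 0, Use 6 9 0, Use 0 12 0, Use 1 9 0, Use 11 9 0, Use 13 11 0, Use 9 13 0, Use 1 9 0, 
     Use 1 9 0, Use 0 1 0, Use 1 9 0, Use 2 9 0, Use 1 0 7, Use 3 1 7, Use 0 3 7, Use 0 1 0, 
     Use 1 9 0, Use 0 6 7, Use 0 1 0, Use 1 9 0, Use 6 13 0, Use 7 0 7, Use 0 1 0, Use 0 1 0, 
     Use 1 9 0, Use 0 6 0, Split 12 0, Use 12 6 0, Use 1 0 7, Use 6 0 7, Use 12 6 0, Split 11 7, 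
     Use 11 6 7, Use 6 11 7, Use 0 1 0, Use 11 6 7, Use 1 11 7, Use 4 11 7, Use 11 6 7, Use 11 6 7, 
     Use 11 6 7, Use 0 1 0, Use 13 9 0, Use 1 12 0, Use 11 6 7, Use 11 6 7, Use 7 10 7, Use 11 6 0, 
     Use 5 6 7, Use 11 6 7, Use 12 6 7, Use 1 11 7, Use 4 11 7, Use 9 11 7, Use 11 6 7, Use 13 1 0, 
     Use 6 3 0, Use 11 6 0, Use 13 12 0, Use 1 13 0, Use 12 6 0, Use 0 12 0, Use 4 12 0, Use 13 12 0, 
     Use 7 2 7, Use 5 6 7, Use 0 8 7, Use 12 6 0, Use 1 12 0, Use 4 12 0, Use 13 1 0, Use 12 13 0, 
     Use 7 1 0, Use 6 7 0, Use 13 1 0, Use 12 6 0, Use 12 13 0, Use 0 6 7, Use 11 6 7, Use 12 6 0, 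
     Use 13 12 0, Use 11 6 7, Use 10 11 7, Use 12 6 0, Use 5 6 7, Use 12 6 0, Use 1 12 0, Use 4 3 7, 
     Use 3 4 7, Use 13 1 0, Use 6 13 7, Use 0 1 0, Split 13 0, Use 0 6 0, Split 2 7, Use 1 13 0, 
     Use 1 13 0, Use 1 13 0, Use 1 13 0, Use 2 1 0, Use 8 2 0, Use 1 13 0, Split 4 0, Use 0 3 0, 
     Use 3 1 0, Use 0 2 0, Use 4 2 0, Use 4 1 0, Use 4 3 0, Use 4 3 0, Use 10 3 0, Use 0 3 0, 
     Use 2 4 0, Use 9 3 0, Use 0 4 0, Use 4 1 0, Use 3 4 0, Use 12 6 0, Use 6 12 0, Use 7 1 7, 
     Use 13 1 7, Use 1 13 0, Use 7 1 0, Use 2 7 0, Use 5 7 0, Use 1 13 0, Use 8 1 0, Use 7 1 0, 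
     Use 1 2 0, Use 1 13 0, Use 0 9 0, Use 6 1 0, Split 7 0, Use 7 5 0, Use 7 5 0, Use 13 6 0, 
     Use 7 1 0, Use 0 2 0, Use 1 5 0, Use 0 5 0, Use 5 7 0, Use 9 7 0, Use 5 7 0, Use 1 13 0, 
     Use 0 1 0, Use 6 13 0, Use 10 0 7, Use 5 10 7, Use 1 13 0, Use 10 6 0, Use 1 10 0, Use 1 13 0, 
     Use 12 6 0, Use 1 0 7, Use 7 1 7, Use 0 6 0, Use 4 13 0, Use 4 5 7, Use 1 4 0, Use 5 4 7, 
     Split 5 0, Use 11 1 0, Use 5 1 0, Use 6 1 0, Use 5 1 0, Use 6 5 0, Use 0 5 0, Use 1 5 0, 
     Use 5 1 0, Use 6 1 0, Use 1 5 0, Use 4 5 0, Use 0 6 0, Split 10 0, Use 0 1 0, Use 0 1 0, 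
     Use 6 13 0, Use 1 10 0, Use 4 13 0, Use 0 1 0, Use 3 10 0, Use 4 13 0, Use 1 0 7, Use 5 1 7]"

definition search7_8 :: "instr list" where
  "search7_8 =
    [Use 0 1 0, Use 6 13 0, Use 0 1 0, Use 6 13 0, Use 5 7 0, Use 0 1 0, Use 6 13 0, Use 7 5 7, 
     Use 5 0 7, Use 5 1 0, Use 0 1 0, Use 6 13 0, Use 0 1 0, Use 6 13 0, Use 11 1 0, Use 13 10 0, 
     Use 10 0 7, Use 6 5 7, Use 0 1 0, Use 6 13 0, Use 10 13 0, Use 0 5 7, Use 0 6 0, Split 4 0, 
     Use 1 4 0, Use 5 4 0, Use 6 5 0, Use 1 4 0, Use 1 4 0, Use 10 4 0, Use 4 13 0, Use 6 2 0, 
     Split 3 0, Use 3 2 0, Use 2 3 0, Use 4 1 0, Use 0 3 0, Use 0 3 0, Use 1 4 0, Use 0 4 0, 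
     Use 1 4 0, Use 9 3 0, Use 0 4 0, Use 0 3 0, Use 4 13 0, Split 3 0, Use 6 3 0, Use 4 1 0, 
     Use 0 3 0, Use 6 3 0, Use 0 3 0, Use 0 3 0, Use 10 4 0, Use 9 3 0, Use 0 4 0, Use 0 3 0, 
     Use 12 6 0, Use 3 12 0, Use 4 13 0, Use 4 13 0, Split 3 0, Use 6 3 0, Use 4 1 0, Use 0 3 0, 
     Use 6 3 0, Use 0 3 0, Use 0 3 0, Use 6 5 7, Use 2 6 7, Use 4 1 0, Use 6 3 0, Use 1 4 0, 
     Use 3 6 0, Use 4 1 0, Use 10 4 0, Use 3 6 0, Use 4 13 0, Use 4 5 7, Use 3 4 0, Use 0 8 0, 
     Use 4 13 0, Use 13 4 0, Use 13 6 0, Use 1 13 0, Use 0 6 0, Split 10 0, Use 1 10 0, Use 1 10 0, 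
     Use 0 1 0, Use 1 10 0, Use 0 1 0, Use 1 10 0, Use 6 10 0, Use 11 5 7, Use 0 11 7, Use 0 1 0, 
     Use 1 10 0, Use 1 10 0, Use 11 5 7, Use 0 1 0, Use 1 10 0, Use 6 13 0, Use 4 5 7, Use 1 11 0, 
     Use 0 1 0, Use 1 10 0, Use 8 13 0, Use 0 9 7, Use 2 1 0, Use 6 2 0, Use 0 1 0, Use 1 10 0, 
     Split 12 0, Use 13 1 0, Use 10 2 0, Use 12 2 0, Use 13 1 0, Use 6 3 0, Use 13 1 0, Use 13 1 0, 
     Use 6 5 0, Use 13 1 0, Use 13 1 0, Use 9 6 0, Use 13 1 0, Use 12 6 0, Use 4 11 0, Use 13 1 0, 
     Use 13 1 0, Use 0 6 0, Split 10 0, Use 0 1 0, Split 3 0, Use 4 3 0, Use 13 3 0, Use 6 3 0, 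
     Use 0 3 0, Use 6 3 0, Use 13 3 0, Use 10 4 0, Use 10 3 0, Use 13 6 0, Use 0 10 0, Use 4 3 0, 
     Use 1 4 0, Split 4 0, Use 13 3 0, Use 4 3 0, Use 4 1 0, Use 13 3 0, Use 4 1 0, Use 10 4 0, 
     Use 0 3 0, Use 4 1 0, Use 3 6 0, Use 13 3 0, Use 0 4 0, Use 13 3 0, Use 0 1 0, Use 6 13 0, 
     Use 0 1 0, Use 1 10 0, Use 1 11 0, Use 0 1 0, Use 0 1 0, Use 3 10 0, Use 4 13 0, Use 0 1 0, 
     Use 6 13 0, Use 1 10 0, Use 0 1 0, Use 6 13 0, Use 0 1 0, Use 1 10 0, Use 6 0 7, Use 9 6 7, 
     Use 0 1 0, Use 0 13 0, Use 6 13 0, Use 1 0 7, Use 12 0 7, Use 0 1 7, Use 0 6 0, Split 10 0, 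
     Use 1 10 0, Use 0 1 0, Use 6 13 0, Use 0 1 0, Split 3 0, Use 1 3 0, Use 10 3 0, Use 1 3 0, 
     Use 6 3 0, Use 6 3 0, Use 13 3 0, Use 9 6 0, Use 10 9 0, Use 13 3 0, Use 13 3 0, Use 6 10 0]"

definition search7_9 :: "instr list" where
  "search7_9 =
    [Use 3 0 7, Use 13 3 0, Use 3 10 0, Use 9 13 0, Use 11 13 0, Use 3 0 7, Use 3 10 0, Use 0 1 0, 
     Use 1 10 0, Use 1 9 0, Use 0 1 0, Use 3 10 0, Use 1 0 7, Use 4 1 7, Use 4 5 7, Use 0 1 0, 
     Use 10 13 0, Use 1 0 7, Use 0 1 7, Use 11 1 7, Use 8 5 7, Use 0 1 0, Split 3 0, Use 0 3 0, 
     Use 4 3 0, Use 6 3 0, Use 1 3 0, Use 3 5 0, Use 6 3 0, Use 6 3 0, Use 4 3 0, Use 1 4 0, 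
     Use 13 3 0, Use 13 3 0, Use 10 13 0, Use 1 0 7, Use 0 1 0, Use 6 13 0, Use 1 0 7, Use 2 1 7, 
     Use 1 2 7, Use 0 1 0, Split 8 0, Use 1 8 0, Use 7 6 0, Use 1 8 0, Use 1 8 0, Use 1 8 0, 
     Use 1 10 0, Use 1 8 0, Use 1 8 0, Use 1 8 0, Use 13 10 0, Use 2 1 0, Use 8 2 0, Use 0 1 0, 
     Use 0 6 0, Split 4 7, Use 10 4 7, Use 4 5 7, Use 3 13 0, Split 4 0, Use 13 1 0, Use 0 3 0, 
     Use 2 3 0, Use 0 3 0, Use 4 1 0, Use 4 1 0, Use 4 1 0, Use 0 4 0, Use 3 4 0, Use 3 4 0, 
     Use 6 4 0, Use 1 6 0, Use 4 5 7, Use 0 1 0, Use 1 0 7, Use 7 1 7, Use 5 4 7, Use 5 4 7, 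
     Use 4 5 7, Use 11 5 7, Use 4 5 7, Split 10 0, Use 0 10 0, Use 0 10 0, Use 0 1 0, Use 1 10 0, 
     Use 1 11 0, Use 0 1 0, Use 0 10 0, Use 3 10 0, Use 3 13 0, Use 0 10 0, Use 0 1 0, Use 0 1 0, 
     Use 6 13 0, Use 0 10 0, Use 0 1 0, Use 0 13 0, Use 7 1 7, Use 5 4 7, Use 4 5 7, Use 4 5 7, 
     Use 4 5 7, Use 9 8 7, Use 10 8 7, Use 4 10 7, Use 2 1 7, Use 4 5 7, Split 3 7, Use 9 3 7, 
     Use 3 4 7, Use 10 4 7, Use 0 9 7, Use 2 9 7, Use 5 9 7, Use 5 9 7, Use 4 3 7, Use 5 9 7, 
     Use 0 1 0, Use 0 10 0, Use 3 4 7, Use 5 9 7, Use 5 13 7, Use 5 9 7, Use 1 11 7, Use 5 11 7, 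
     Use 9 3 7, Use 5 9 7, Use 0 13 0, Use 4 5 7, Use 4 10 7, Use 7 12 7, Use 9 12 7, Use 11 12 7, 
     Use 4 13 7, Use 4 5 7, Use 5 4 7, Use 4 5 7, Use 0 6 0, Split 4 7, Use 4 5 7, Use 4 5 7, 
     Use 7 4 7, Use 9 6 0, Use 0 9 0, Use 1 9 0, Use 11 9 0, Use 2 11 0, Use 4 5 7, Use 0 1 0, 
     Use 1 0 7, Use 4 1 7, Use 0 4 7, Use 5 4 7, Use 4 5 7, Split 8 7, Use 5 8 7, Use 7 8 7, 
     Use 8 2 7, Use 8 2 7, Use 5 8 7, Use 8 5 7, Use 0 1 0, Use 2 8 7, Use 10 4 7, Use 6 8 7, 
     Use 2 10 7, Use 5 8 7, Use 7 8 7, Use 11 8 7, Use 5 8 7, Use 8 2 7, Use 3 4 7, Use 3 8 7, 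
     Use 4 5 7, Use 0 13 0, Use 9 3 7, Split 8 7, Use 7 3 7, Use 8 4 7, Use 1 5 7, Use 9 8 7, 
     Use 8 4 7, Use 9 5 7, Use 8 3 7, Use 9 4 7, Use 5 8 7, Use 8 5 7, Use 0 1 0, Use 2 1 7, 
     Use 3 2 7, Use 8 2 7, Use 9 8 7, Use 4 5 7, Use 4 5 7, Use 3 13 7, Use 0 13 0, Use 7 1 7]"

definition search7_10 :: "instr list" where
  "search7_10 =
    [Use 4 5 7, Use 10 4 7, Use 7 10 7, Use 4 5 7, Use 11 9 7, Use 13 9 7, Use 5 11 7, Use 11 13 7, 
     Use 12 13 7, Use 3 4 0, Use 2 6 0, Use 4 5 7, Use 4 5 7, Use 5 4 7, Use 0 6 0, Split 10 0, 
     Use 1 10 0, Use 0 1 0, Use 6 13 0, Use 1 0 7, Use 0 1 7, Use 1 10 0, Use 1 10 0, Use 1 10 0, 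
     Use 0 1 0, Use 1 10 0, Use 1 8 0, Use 0 10 0, Use 8 13 0, Use 4 0 7, Use 0 1 0, Use 1 10 0, 
     Use 4 5 7, Use 8 5 7, Use 4 8 7, Use 3 13 7, Use 0 1 0, Use 0 1 0, Use 1 10 0, Use 6 13 0, 
     Use 10 0 7, Use 0 1 0, Use 1 10 0, Use 0 6 0, Split 12 0, Use 12 6 0, Use 5 6 7, Use 6 8 7, 
     Use 7 12 7, Use 12 6 0, Use 6 13 0, Use 4 5 7, Use 12 6 0, Split 4 0, Use 4 1 0, Use 1 4 0, 
     Use 3 4 0, Use 13 1 0, Use 12 13 0, Use 5 4 7, Use 11 5 7, Use 0 4 0, Use 13 1 0, Use 1 4 0, 
     Use 13 1 0, Use 3 4 0, Use 13 1 0, Use 13 1 0, Use 12 4 0, Use 7 6 0, Use 1 7 0, Use 12 6 0, 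
     Use 0 12 0, Use 3 12 0, Use 12 6 0, Use 1 12 0, Use 13 1 0, Use 0 12 0, Use 12 13 0, Use 1 0 7, 
     Use 1 2 7, Use 12 6 0, Use 12 13 0, Use 10 5 7, Use 12 6 0, Use 13 12 0, Use 1 13 0, Use 6 13 0, 
     Use 1 0 7, Use 1 2 7, Use 13 1 0, Use 12 6 0, Use 4 5 7, Split 13 0, Use 0 6 0, Split 2 7, 
     Use 1 13 0, Use 1 13 0, Use 1 13 0, Use 1 13 0, Use 2 1 0, Use 8 2 0, Use 2 3 0, Use 7 6 0, 
     Use 12 6 0, Use 1 13 0, Use 5 2 7, Use 5 4 7, Use 2 11 7, Use 1 13 0, Use 2 4 7, Use 5 6 0, 
     Use 6 9 0, Use 1 13 0, Use 7 1 0, Use 1 6 0, Use 2 7 0, Use 11 7 0, Use 1 8 0, Use 1 13 0, 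
     Split 5 0, Use 13 5 0, Use 6 5 0, Use 12 6 0, Use 13 5 0, Use 13 5 0, Use 0 8 0, Use 13 5 0, 
     Use 4 5 0, Use 0 5 0, Use 1 6 0, Use 0 8 0, Use 13 5 0, Use 1 13 0, Use 9 1 0, Use 8 6 0, 
     Use 1 13 0, Use 9 6 0, Use 6 9 0, Use 1 13 0, Use 0 1 0, Use 6 13 0, Use 11 0 7, Use 13 9 0, 
     Use 6 11 0, Use 1 13 0, Use 7 2 7, Use 12 6 0, Use 13 12 0, Use 6 2 7, Use 6 4 7, Use 0 6 0, 
     Split 11 0, Use 0 1 0, Use 1 11 0, Use 0 4 7, Use 1 11 0, Use 2 3 0, Use 0 1 0, Use 4 11 0, 
     Use 1 0 7, Use 5 1 7, Use 7 1 7, Use 0 1 0, Split 3 0, Use 2 3 0, Use 1 6 0, Use 6 3 0, 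
     Use 6 3 0, Use 7 1 0, Use 6 3 0, Use 6 3 0, Use 11 3 0, Use 1 8 0, Use 3 10 0, Use 13 3 0, 
     Use 3 10 0, Use 2 3 0, Use 1 6 0, Use 0 11 0, Use 3 0 7, Use 1 11 0, Use 3 13 0, Use 0 1 0, 
     Use 0 1 0, Use 3 4 7, Use 4 3 7, Use 4 10 7, Use 12 6 0, Use 6 12 0, Use 1 13 0, Use 0 1 0, 
     Split 8 0, Use 1 8 0, Use 11 8 0, Use 13 10 0, Use 6 13 0, Use 6 13 0, Use 6 13 0, Use 2 1 0]"

definition search7_11 :: "instr list" where
  "search7_11 =
    [Use 6 2 0, Use 8 2 0, Use 6 13 0, Use 6 13 0, Use 10 6 0, Use 1 8 0, Use 10 8 0, Use 4 13 0, 
     Use 6 13 0, Use 0 1 0, Use 12 6 0, Use 1 12 0, Use 12 0 7, Use 3 4 7, Use 7 12 7, Use 13 1 0, 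
     Use 9 4 0, Use 9 6 0, Use 10 6 0, Use 0 1 0, Use 6 13 0, Use 0 1 0, Split 3 0, Use 2 3 0, 
     Use 1 6 0, Use 6 11 0, Use 6 3 0, Use 6 3 0, Use 1 11 0, Use 7 1 0, Use 0 3 0, Use 11 4 0, 
     Use 1 11 0, Use 3 4 7, Use 4 8 7, Use 1 11 0, Use 8 4 7, Use 10 4 7, Use 10 6 7, Use 1 11 0, 
     Use 0 4 7, Use 1 11 0, Use 0 6 0, Use 3 13 0, Use 3 4 7, Use 3 1 0, Use 13 3 0, Use 4 3 7, 
     Split 5 0, Use 4 1 0, Use 6 1 0, Use 0 2 0, Use 6 1 0, Use 4 1 0, Use 6 1 0, Use 0 2 0, 
     Use 0 6 0, Split 0 7, Use 0 1 0, Use 6 13 0, Use 0 1 0, Use 13 11 0, Use 8 13 0, Use 0 1 0, 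
     Use 6 13 0, Use 7 4 7, Use 11 1 0, Use 6 13 0, Use 7 1 0, Use 6 13 0, Use 13 1 0, Use 4 7 0, 
     Use 6 13 0, Use 2 1 0, Use 0 1 0, Use 0 1 0, Use 6 13 0, Use 0 10 0, Use 0 1 0, Use 6 13 0, 
     Use 6 13 0, Use 13 1 0, Use 0 6 0, Split 3 0, Use 3 13 0, Use 4 1 0, Use 0 3 0, Use 6 3 0, 
     Use 6 3 0, Use 2 3 0, Use 6 3 0, Use 1 11 0, Use 3 13 0, Use 13 3 0, Use 7 4 7, Use 3 10 0, 
     Use 6 13 0, Use 3 13 0, Use 3 13 0, Use 3 13 0, Use 3 4 7, Use 4 1 0, Use 0 4 0, Use 3 4 0, 
     Use 3 13 0, Split 2 0, Use 1 2 0, Use 3 2 0, Use 8 2 0, Use 8 2 0, Use 2 1 0, Use 5 2 0, 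
     Use 2 1 0, Use 8 2 0, Use 8 2 0, Use 2 3 0, Use 8 2 0, Use 0 6 0, Split 11 0, Use 0 1 0, 
     Split 5 0, Use 11 5 0, Use 13 5 0, Use 5 8 0, Use 11 5 0, Use 6 5 0, Use 10 5 0, Use 0 4 7, 
     Use 1 3 0, Use 11 5 0, Use 0 4 0, Use 13 11 0, Use 5 0 7, Use 0 4 7, Use 11 5 0, Use 6 1 0, 
     Split 3 0, Use 0 3 0, Use 4 3 0, Use 5 3 0, Use 2 3 0, Use 6 3 0, Use 2 3 0, Use 6 3 0, 
     Use 1 5 0, Use 5 3 0, Use 0 5 0, Use 1 3 0, Use 11 3 0, Use 1 5 0, Use 13 5 0, Use 5 8 0, 
     Use 4 11 0, Use 13 11 0, Use 3 13 0, Use 8 13 0, Use 0 1 0, Use 6 13 0, Use 0 1 0, Use 0 1 0, 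
     Use 1 11 0, Use 4 11 0, Use 0 1 0, Use 6 13 0, Use 4 0 7, Use 0 1 0, Use 6 13 0, Use 0 1 0, 
     Use 1 11 0, Use 0 12 7, Use 1 11 0, Use 0 1 0, Use 1 11 0, Use 13 11 0, Use 0 1 0, Use 0 13 0, 
     Use 1 0 7, Use 7 1 7, Use 0 6 0, Split 11 0, Use 0 1 0, Use 1 11 0, Use 6 11 0, Use 4 0 7, 
     Use 0 2 7, Use 0 1 0, Use 4 11 0, Use 0 1 0, Use 1 11 0, Use 5 6 0, Use 0 1 0, Use 4 11 0, 
     Use 1 0 7, Use 11 0 7, Use 1 4 7, Use 5 4 7, Split 9 0, Use 1 11 0, Use 1 11 0, Use 1 11 0]"

definition search7_12 :: "instr list" where
  "search7_12 =
    [Use 1 11 0, Use 1 11 0, Use 1 11 0, Use 1 11 0, Use 1 11 0, Use 1 11 0, Use 0 1 0, Use 1 0 7, 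
     Use 0 1 0, Use 1 0 7, Use 4 1 7, Use 3 4 7, Use 2 3 0, Use 2 6 0, Use 11 6 0, Use 0 11 0, 
     Use 0 1 0, Split 3 0, Use 0 3 0, Use 13 3 0, Use 2 6 0, Use 6 3 0, Use 2 3 0, Use 6 3 0, 
     Use 8 3 0, Use 6 3 0, Use 3 13 0, Use 1 0 7, Use 3 13 0, Use 1 0 7, Use 4 1 7, Use 9 3 0, 
     Use 9 6 0, Use 3 10 0, Use 0 1 0, Use 3 13 0, Use 6 3 0, Use 9 3 0, Use 12 3 0, Use 0 6 0, 
     Split 3 7, Use 4 3 7, Use 3 4 7, Use 10 4 7, Use 3 4 7, Split 8 7, Use 3 8 7, Use 8 3 7, 
     Use 7 4 7, Use 8 2 7, Use 9 8 7, Use 8 9 7, Use 8 2 7, Use 11 3 7, Use 12 4 7, Use 5 8 7, 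
     Use 6 8 7, Use 2 13 0, Use 4 8 7, Use 4 8 7, Use 4 8 7, Use 2 10 7, Use 4 8 7, Use 6 13 0, 
     Use 3 2 7, Use 1 8 7, Use 3 4 7, Use 3 4 7, Use 3 4 7, Use 11 5 7, Use 3 11 7, Use 0 13 0, 
     Use 5 13 0, Use 11 1 7, Use 7 3 7, Use 5 4 7, Use 9 5 7, Use 3 4 7, Use 3 6 7, Use 0 4 0, 
     Use 3 4 7, Use 0 1 0, Use 1 0 7, Split 2 7, Use 1 13 0, Use 1 13 0, Use 6 11 0, Use 13 11 0, 
     Use 6 11 0, Use 6 11 0, Use 6 11 0, Use 1 2 7, Use 2 1 7, Use 1 13 0, Use 3 4 7, Use 3 4 7, 
     Use 4 3 7, Use 3 4 7, Use 0 11 7, Use 0 1 0, Use 12 1 0, Use 8 11 0, Use 3 4 7, Use 1 13 0, 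
     Use 2 3 7, Use 3 4 7, Use 12 13 7, Use 1 13 0, Use 2 3 7, Use 0 6 0, Split 3 7, Use 9 3 7, 
     Use 3 4 7, Use 4 6 7, Use 6 1 0, Use 6 5 0, Use 10 5 0, Use 13 10 0, Use 3 4 7, Use 0 1 0, 
     Use 1 0 7, Use 7 1 7, Use 7 3 7, Use 7 9 7, Use 12 9 7, Use 0 10 7, Use 4 3 7, Use 3 4 7, 
     Use 3 4 7, Use 3 2 7, Use 3 4 7, Use 3 4 7, Use 3 4 7, Split 9 7, Use 9 3 7, Use 4 5 7, 
     Use 5 8 7, Use 4 5 7, Use 9 8 7, Use 4 5 7, Use 4 8 7, Use 4 5 7, Use 8 5 7, Use 5 8 7, 
     Use 9 3 7, Use 4 5 7, Use 4 5 7, Use 3 8 7, Use 4 5 7, Use 5 8 7, Use 9 3 7, Use 3 4 7, 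
     Use 9 8 7, Use 10 8 7, Use 9 10 7, Use 3 13 7, Use 0 13 0, Use 3 4 7, Use 3 9 7, Use 13 9 7, 
     Use 3 4 7, Use 1 13 0, Use 2 3 7, Use 3 4 7, Use 5 4 7, Split 10 7, Use 6 1 0, Use 5 6 0, 
     Use 0 9 0, Use 13 9 0, Use 5 13 0, Use 4 3 7, Use 4 3 7, Use 4 3 7, Use 4 3 7, Use 4 3 7, 
     Use 4 3 7, Use 1 13 0, Use 2 3 7, Use 4 3 7, Use 3 4 7, Use 0 6 0, Split 11 0, Use 1 11 0, 
     Use 1 11 0, Use 1 11 0, Use 0 1 0, Use 4 11 0, Use 1 0 7, Use 1 4 7, Use 1 11 0, Use 0 1 0, 
     Use 1 11 0, Use 1 8 0, Use 0 11 0, Use 8 13 0, Use 9 3 7, Use 0 1 0, Use 1 11 0, Split 3 0]"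

definition search7_13 :: "instr list" where
  "search7_13 =
    [Use 7 3 0, Use 13 6 0, Use 2 3 0, Use 2 6 0, Use 6 3 0, Use 2 3 0, Use 6 3 0, Use 12 6 0, 
     Use 6 3 0, Use 0 4 7, Use 6 3 0, Use 7 3 0, Use 10 3 0, Use 0 1 0, Use 0 1 0, Use 1 11 0, 
     Use 0 10 7, Use 0 1 0, Use 1 11 0, Use 0 6 0, Split 12 0, Use 12 6 0, Use 1 12 0, Use 8 3 7, 
     Use 4 5 7, Use 12 6 0, Split 8 0, Use 0 8 0, Use 0 8 0, Use 1 12 0, Use 8 1 0, Use 6 7 0, 
     Use 0 8 0, Use 2 1 0, Use 2 12 0, Use 0 8 0, Use 6 8 0, Use 2 12 0, Use 1 13 0, Use 4 2 7, 
     Use 0 8 0, Use 1 12 0, Use 6 12 0, Use 0 13 0, Use 12 6 0, Use 6 13 0, Use 3 4 7, Use 12 1 0, 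
     Use 12 6 0, Use 0 1 0, Use 9 4 7, Use 7 9 7, Use 7 12 7, Use 1 8 0, Use 13 1 0, Use 13 1 0, 
     Use 12 6 0, Use 0 12 0, Use 2 3 7, Use 12 6 0, Use 13 12 0, Use 1 13 0, Use 7 2 7, Use 12 6 0, 
     Use 12 13 0, Use 13 1 0, Use 12 6 0, Use 1 13 0, Use 7 2 7, Use 13 1 0, Use 12 6 0, Use 1 12 0, 
     Use 3 4 7, Use 0 9 7, Use 4 13 7, Split 13 0, Use 0 6 0, Split 12 0, Use 0 1 0, Use 12 6 0, 
     Use 1 13 0, Use 7 0 7, Use 0 2 7, Use 0 1 0, Use 12 6 0, Use 0 1 0, Use 13 1 0, Use 12 6 0, 
     Use 12 6 0, Use 0 12 0, Use 0 1 0, Use 12 6 0, Use 11 3 7, Use 2 1 0, Use 6 1 0, Use 0 1 0, 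
     Use 12 6 0, Use 1 12 0, Use 0 12 7, Use 5 12 7, Use 2 1 0, Use 7 1 0, Use 0 1 0, Use 12 6 0, 
     Use 13 0 7, Use 3 13 7, Use 13 1 0, Use 10 6 0, Use 13 6 0, Use 12 6 0, Use 13 12 0, Use 0 1 0, 
     Use 12 6 0, Use 12 13 0, Use 13 0 7, Use 0 6 0, Split 12 0, Use 0 1 0, Use 12 6 0, Use 1 12 0, 
     Use 3 13 0, Use 6 13 0, Use 0 1 0, Use 5 12 0, Use 0 1 0, Use 12 6 0, Use 0 1 0, Use 13 1 0, 
     Use 12 6 0, Use 0 1 0, Use 12 6 0, Split 9 0, Use 13 1 0, Use 0 12 0, Use 13 9 0, Use 13 9 0, 
     Use 13 1 0, Use 13 1 0, Use 4 9 0, Use 13 9 0, Use 6 1 0, Use 13 9 0, Use 13 9 0, Use 0 1 0, 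
     Use 12 6 0, Use 1 12 0, Use 3 0 7, Use 0 1 0, Use 12 6 0, Use 0 1 0, Use 13 1 0, Use 12 6 0, 
     Use 3 0 7, Use 3 2 7, Use 0 1 0, Use 6 13 0, Use 0 6 0, Split 12 0, Use 13 1 0, Use 1 2 0, 
     Use 6 2 0, Use 0 4 0, Use 13 1 0, Use 6 3 0, Use 12 6 0, Use 3 12 0, Use 13 1 0, Use 6 5 0, 
     Use 13 1 0, Use 0 1 0, Use 13 1 0, Use 5 9 0, Use 0 1 0, Use 13 1 0, Use 6 10 0, Use 2 13 0, 
     Use 12 13 0, Use 13 0 7, Use 9 3 7, Use 0 1 0, Use 13 1 0, Use 0 11 0, Use 13 12 0, Use 8 3 7, 
     Use 13 1 0, Use 0 1 0, Use 13 1 0, Use 0 7 0, Use 0 6 0, Use 2 13 0, Use 2 3 7, Use 1 2 0, 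
     Use 9 6 0, Use 5 9 0, Use 13 9 0, Use 3 2 7, Use 11 2 7, Split 3 0, Use 3 1 0, Use 3 1 0]"

definition search7_14 :: "instr list" where
  "search7_14 =
    [Use 3 1 0, Use 2 3 0, Use 5 3 0, Use 0 3 0, Use 4 3 0, Use 0 6 0, Split 12 0, Use 0 1 0, 
     Use 1 12 0, Use 0 1 0, Use 5 12 0, Use 2 13 0, Use 1 12 0, Use 0 1 0, Use 13 1 0, Use 6 13 0, 
     Use 5 0 7, Use 0 1 0, Use 1 12 0, Use 6 13 0, Use 7 0 7, Use 0 1 0, Use 1 12 0, Use 0 1 0, 
     Use 1 12 0, Use 6 13 0, Use 2 9 0, Use 13 9 0, Use 1 12 0, Use 9 3 7, Use 0 1 0, Use 6 13 0, 
     Use 0 6 0, Split 2 0, Use 1 2 0, Use 1 2 0, Use 12 2 0, Use 1 6 0, Use 13 10 0, Use 1 2 0, 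
     Use 4 2 0, Use 1 4 0, Use 2 13 0, Use 2 13 0, Use 1 2 0, Use 2 13 0, Split 4 0, Use 1 4 0, 
     Use 1 4 0, Use 0 4 0, Use 1 4 0, Use 4 2 0, Use 0 4 0, Use 10 4 0, Use 6 4 0, Use 2 3 7, 
     Use 13 3 7, Use 2 12 7, Use 6 4 0, Use 1 2 0, Use 2 13 0, Use 10 13 0, Use 11 1 0, Use 6 2 0, 
     Use 2 13 0, Use 1 2 0, Use 2 13 0, Use 7 13 0, Use 2 3 7, Use 3 8 7, Use 13 8 7, Use 3 12 7, 
     Use 13 12 7, Use 0 6 0, Split 2 7, Use 2 3 7, Use 1 13 0, Use 2 3 7, Use 4 3 7, Use 13 4 7, 
     Use 2 13 7, Use 2 1 0, Use 1 13 0, Use 1 2 7, Use 2 3 7, Use 1 5 7, Use 2 3 7, Use 12 6 7, 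
     Use 0 13 0, Use 12 1 7, Use 12 3 7, Use 10 1 0, Use 11 1 0, Use 2 3 7, Use 0 1 0, Split 2 0, 
     Use 1 2 0, Use 1 2 0, Use 2 1 0, Use 1 2 0, Use 1 2 0, Use 1 2 0, Use 4 2 0, Use 6 2 0, 
     Use 1 2 0, Use 0 12 0, Use 1 2 0, Use 7 2 0, Use 13 6 0, Use 3 2 7, Use 2 3 7, Use 9 3 7, 
     Use 2 3 7, Use 2 3 7, Use 8 11 7, Use 13 6 0, Use 1 13 0, Use 12 13 0, Use 7 2 7, Use 2 3 7, 
     Use 0 12 7, Use 0 1 0, Use 12 6 0, Use 12 7 0, Use 10 12 0, Use 1 13 0, Use 2 3 7, Use 2 3 7, 
     Use 3 8 7, Use 7 8 7, Use 2 3 7, Use 3 2 7, Use 0 6 0, Split 12 0, Use 0 1 0, Use 1 12 0, 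
     Use 5 12 0, Use 0 1 0, Use 6 13 0, Use 0 1 0, Use 5 12 0, Use 1 0 7, Use 12 0 7, Use 7 1 7, 
     Use 2 3 7, Use 1 6 0, Use 2 6 0, Use 0 1 0, Use 12 6 0, Use 1 8 0, Use 13 12 0, Use 1 0 7, 
     Use 8 0 7, Use 0 1 0, Use 13 1 0, Use 1 0 7, Use 0 1 0, Use 13 1 0, Use 6 13 0, Use 3 9 7, 
     Use 5 9 7, Use 5 6 0, Use 10 6 0, Use 0 1 0, Use 5 12 0, Use 6 5 0, Use 0 1 0, Split 2 0, 
     Use 1 2 0, Use 1 2 0, Use 2 1 0, Use 1 2 0, Use 8 2 0, Use 4 2 0, Use 6 2 0, Use 7 2 0, 
     Use 1 2 0, Use 1 2 0, Use 1 2 0, Use 2 13 0, Use 7 2 0, Use 0 7 0, Use 1 2 0, Use 0 1 0, 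
     Use 0 1 0, Use 6 13 0, Use 8 3 7, Use 1 8 7, Use 0 6 0, Split 2 0, Use 1 2 0, Use 1 2 0, 
     Use 1 6 0, Use 6 12 0, Use 3 1 7, Use 1 2 0, Use 4 2 0, Use 13 2 0, Use 1 4 0, Use 1 2 0]"

definition search7_15 :: "instr list" where
  "search7_15 =
    [Use 3 2 0, Use 2 3 0, Use 1 2 0, Use 1 2 0, Split 4 0, Use 1 4 0, Use 1 4 0, Use 6 4 0, 
     Use 1 4 0, Use 8 4 0, Use 11 4 0, Use 13 6 0, Use 4 2 0, Use 1 4 0, Use 6 2 0, Use 2 4 0, 
     Use 0 5 0, Use 6 4 0, Use 13 6 0, Use 0 7 0, Use 1 0 7, Use 0 1 7, Use 1 2 0, Use 2 3 7, 
     Use 8 2 7, Use 3 8 7, Use 1 2 0, Use 2 13 0, Use 0 1 0, Use 1 0 7, Use 13 1 7, Use 9 3 7, 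
     Use 1 2 0, Use 6 13 0, Use 0 1 0, Use 1 6 0, Use 2 13 0, Use 0 6 0, Split 12 0, Use 0 12 0, 
     Use 1 12 0, Use 0 1 0, Use 5 12 0, Use 1 0 7, Use 1 3 7, Use 0 1 0, Use 12 6 0, Use 0 11 0, 
     Use 1 12 0, Use 13 1 0, Use 1 12 0, Use 13 12 0, Use 8 13 0, Use 11 13 0, Use 0 1 0, Use 0 1 0, 
     Use 1 12 0, Use 13 0 7, Use 8 3 7, Use 0 12 7, Use 0 1 0, Use 1 12 0, Split 11 0, Use 0 11 0, 
     Use 10 6 0, Use 6 10 0, Use 7 10 0, Use 0 11 0, Use 11 6 0, Use 0 11 0, Use 0 11 0, Use 13 1 0, 
     Use 6 1 0, Use 12 6 0, Use 0 1 0, Use 1 12 0, Use 0 6 0, Split 2 0, Use 1 2 0, Use 1 2 0, 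
     Use 2 1 0, Use 1 2 0, Use 10 2 0, Use 13 2 0, Use 1 2 0, Use 4 2 0, Use 2 4 0, Use 6 2 0, 
     Use 2 4 0, Use 0 5 0, Use 0 2 0, Use 1 2 0, Use 2 3 7, Use 1 13 7, Use 1 2 7, Use 0 13 7, 
     Use 1 2 0, Use 5 3 7, Use 6 5 7, Use 1 2 0, Use 2 13 0, Use 2 1 0, Use 1 2 0, Use 9 3 7, 
     Use 8 13 7, Split 13 0, Use 0 1 0, Use 0 6 0, Use 1 13 0, Use 6 13 0, Use 2 1 0, Use 8 2 0, 
     Use 11 3 0, Use 2 6 0, Use 0 1 0, Use 6 13 0, Use 0 1 0, Use 0 6 0, Split 1 7, Use 0 13 0, 
     Use 1 0 7, Use 0 13 0, Use 2 1 7, Use 1 0 7, Use 1 0 7, Use 1 2 7, Use 1 0 7, Use 0 1 7, 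
     Use 7 1 7, Use 7 2 7, Use 13 4 7, Use 4 5 7, Use 1 0 7, Use 0 1 7, Use 2 1 7, Use 7 8 7, 
     Use 1 2 7, Use 2 1 7, Use 1 2 7, Use 8 7 0, Use 1 0 7, Use 1 2 7, Use 9 6 0, Use 8 13 0, 
     Use 8 0 7, Use 2 1 7, Use 0 1 0, Use 0 6 0, Split 1 7, Use 0 13 0, Use 1 0 7, Use 0 13 0, 
     Use 0 1 7, Use 0 13 0, Use 1 0 7, Use 1 0 7, Use 1 0 7, Use 1 0 7, Use 1 2 7, Use 10 1 0, 
     Use 10 6 0, Use 6 10 0, Use 1 0 7, Use 0 1 7, Use 1 2 7, Use 4 10 0, Use 9 10 0, Use 1 0 7, 
     Use 0 1 7, Use 2 1 7, Use 7 13 7, Use 1 2 7, Use 1 0 7, Use 2 1 7, Use 7 1 7, Use 7 5 7, 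
     Use 11 5 7, Use 3 8 7, Use 0 6 0, Use 1 13 0, Use 0 1 0, Use 0 6 0, Use 1 13 0, Use 6 13 0, 
     Use 2 1 0, Use 5 6 0, Use 6 8 0, Use 2 11 0, Use 0 1 0, Use 0 6 0, Split 1 7, Use 0 13 0, 
     Use 1 0 7, Use 1 0 7, Use 1 0 7, Use 1 0 7, Use 1 2 7, Use 1 2 7, Use 1 2 7, Use 1 3 7]"

definition search7_16 :: "instr list" where
  "search7_16 =
    [Use 0 5 0, Use 1 0 7, Use 2 1 7, Use 1 0 7, Use 7 1 7, Use 1 2 7, Use 3 2 7, Use 3 9 7, 
     Use 1 0 7, Use 0 1 0, Use 0 6 0, Split 1 7, Use 0 13 0, Use 1 0 7, Use 7 1 7, Use 1 2 7, 
     Use 1 0 7, Use 1 0 7, Use 1 0 7, Use 2 1 7, Use 1 2 7, Use 1 0 7, Use 0 1 7, Use 1 0 7, 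
     Use 2 1 7, Use 1 0 7, Use 1 2 7, Use 3 2 7, Use 2 3 7, Use 0 1 0, Use 0 6 0, Split 1 7, 
     Use 0 13 0, Use 1 0 7, Use 0 13 0, Use 1 0 7, Use 4 0 7, Use 5 1 7, Use 0 13 0, Use 1 0 7, 
     Use 1 0 7, Use 1 0 7, Use 1 0 7, Use 1 2 7, Use 1 0 7, Use 6 0 7, Use 0 6 7, Use 1 0 7, 
     Use 0 1 7, Use 1 0 7, Use 1 0 7, Use 1 2 7, Use 0 8 7, Use 0 1 0, Use 0 6 0, Split 1 7, 
     Use 0 13 0, Use 1 0 7, Use 1 2 7, Use 0 13 0, Use 1 0 7, Use 1 0 7, Use 1 6 7, Use 0 2 0, 
     Use 1 0 7, Use 1 0 7, Use 1 0 7, Use 1 0 7, Use 13 0 7, Use 7 1 7, Use 0 2 7, Use 1 0 7, 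
     Use 7 1 7, Use 1 0 7, Use 1 0 7, Use 2 1 7, Use 0 1 0, Use 0 6 0, Use 1 0 7, Split 13 7, 
     Use 13 1 0, Split 5 0, Use 5 1 0, Use 2 4 0, Use 6 5 0, Use 5 10 0, Use 6 5 0, Use 6 1 0, 
     Use 6 5 0, Use 13 8 0, Use 6 1 0, Use 6 5 0, Use 5 6 0, Use 13 6 0, Use 6 7 0, Split 4 0, 
     Use 1 4 0, Use 1 4 0, Use 5 1 0, Use 1 4 0, Use 11 7 0, Split 2 0, Use 2 1 0, Use 1 6 0, 
     Use 7 6 0, Split 3 0, Use 4 1 0, Use 3 2 0, Use 8 6 0, Closed [1,7], Use 4 1 0, Use 3 2 0, 
     Use 6 3 0, Closed [1,7], Use 1 2 0, Use 2 1 0, Use 4 2 0, Use 10 2 0, Split 3 0, Use 3 1 0, 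
     Use 4 1 0, Use 10 1 0, Closed [1,7], Use 3 1 0, Use 4 1 0, Use 10 1 0, Closed [1,7], Use 1 2 0, 
     Use 1 4 0, Use 1 4 0, Use 5 1 0, Use 1 4 0, Use 7 4 0, Split 2 0, Use 2 1 0, Use 6 4 0, 
     Use 12 4 0, Split 3 0, Use 4 1 0, Use 3 2 0, Use 0 4 0, Closed [1,7], Use 4 1 0, Use 3 2 0, 
     Use 12 3 0, Closed [1,7], Use 0 2 0, Use 2 1 0, Use 4 2 0, Use 10 2 0, Split 3 0, Use 3 1 0, 
     Use 4 1 0, Use 10 1 0, Closed [1,7], Use 3 1 0, Use 4 1 0, Use 10 1 0, Closed [1,7], Use 0 2 0, 
     Use 6 5 0, Use 11 13 7, Use 6 1 0, Use 7 5 0, Use 12 5 0, Use 5 7 0, Use 6 7 0, Use 1 9 0, 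
     Use 6 5 0, Use 13 10 7, Use 6 5 0, Use 1 9 7, Use 6 13 7, Use 6 1 0, Use 6 1 0, Use 6 5 0, 
     Use 12 5 0, Use 5 6 0, Use 6 7 0, Split 4 0, Use 1 4 0, Use 1 4 0, Use 5 1 0, Use 1 4 0, 
     Use 5 7 0, Split 2 0, Use 2 1 0, Use 0 5 0, Use 13 5 0, Split 3 0, Use 4 1 0, Use 3 2 0, 
     Use 1 5 0, Closed [1,7], Use 4 1 0, Use 3 2 0, Use 6 3 0, Closed [1,7], Use 0 2 0, Use 2 1 0]"

definition search7_17 :: "instr list" where
  "search7_17 =
    [Use 4 2 0, Use 10 2 0, Split 3 0, Use 3 1 0, Use 4 1 0, Use 10 1 0, Closed [1,7], Use 3 1 0, 
     Use 4 1 0, Use 10 1 0, Closed [1,7], Use 0 2 0, Use 1 4 0, Use 1 4 0, Use 5 1 0, Use 4 5 0, 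
     Use 5 7 0, Split 2 0, Use 2 1 0, Use 6 4 0, Use 12 4 0, Split 3 0, Use 4 1 0, Use 3 2 0, 
     Use 0 4 0, Closed [1,7], Use 4 1 0, Use 3 2 0, Use 12 3 0, Closed [1,7], Use 4 2 0, Use 2 1 0, 
     Use 4 2 0, Use 10 2 0, Split 3 0, Use 3 1 0, Use 4 1 0, Use 10 1 0, Closed [1,7], Use 3 1 0, 
     Use 4 1 0, Use 10 1 0, Closed [1,7], Use 4 2 0, Use 6 13 0, Use 12 0 7, Use 13 0 7, Use 3 2 7, 
     Use 2 3 7, Use 8 3 7, Use 9 4 7, Use 4 5 7, Use 6 5 7, Use 6 13 0, Use 13 1 0, Use 6 3 0, 
     Use 12 3 0, Use 6 13 0, Use 13 0 7, Use 10 5 7, Use 13 5 7, Use 6 13 0, Use 13 0 7, Use 0 6 7, 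
     Use 0 13 7, Use 1 13 7, Use 6 13 7, Use 12 13 7, Use 2 1 0, Use 12 1 0, Use 3 2 0, Use 11 2 0, 
     Use 13 0 7, Use 13 0 7, Use 13 10 7, Use 13 0 7, Use 10 11 7, Use 13 0 7, Use 0 12 7, Use 13 1 0, 
     Use 12 6 0, Split 13 0, Use 0 6 0, Split 12 0, Use 13 1 0, Use 13 1 0, Use 1 4 0, Use 13 1 0, 
     Use 0 5 0, Use 13 1 0, Use 13 1 0, Use 13 1 0, Use 13 9 0, Use 1 13 0, Use 13 1 0, Use 12 6 0, 
     Use 6 12 0, Use 1 13 0, Use 5 10 7, Use 7 11 7, Use 13 1 0, Use 6 12 0, Use 12 1 0, Use 0 3 0, 
     Use 13 1 0, Use 13 1 0, Use 0 6 0, Split 0 7, Use 0 1 0, Use 0 1 0, Use 7 1 0, Use 6 3 0, 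
     Use 13 3 0, Use 0 1 0, Use 1 0 7, Use 0 1 0, Use 0 1 7, Use 7 2 0, Use 0 1 0, Use 1 0 7, 
     Use 0 1 7, Use 7 1 0, Use 0 4 0, Use 7 6 0, Use 3 11 0, Use 12 6 0, Use 0 12 0, Use 1 13 0, 
     Use 1 0 7, Use 1 0 7, Use 0 1 0, Use 0 1 7, Use 1 0 7, Use 0 1 7, Use 13 9 0, Use 9 13 0, 
     Use 11 5 7, Use 5 10 7, Use 2 11 7, Use 0 1 0, Use 0 6 0, Split 7 0, Use 7 1 0, Use 1 4 0, 
     Use 3 4 0, Use 0 1 0, Use 1 0 7, Use 4 2 0, Use 0 4 0, Use 0 1 0, Use 0 1 0, Use 1 0 7, 
     Use 0 1 0, Use 1 0 7, Use 0 1 7, Use 13 6 0, Use 10 4 7, Use 2 1 0, Use 0 1 0, Use 13 6 0, 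
     Use 6 13 0, Use 1 0 7, Use 10 4 7, Use 0 10 7, Use 0 12 7, Use 0 1 0, Use 1 0 7, Use 0 1 7, 
     Split 3 0, Use 0 3 0, Use 6 3 0, Use 13 3 0, Use 9 6 0, Use 3 9 0, Use 6 3 0, Use 6 3 0, 
     Use 0 3 0, Use 9 3 0, Use 6 3 0, Use 0 3 0, Use 0 1 0, Use 1 0 7, Use 0 1 0, Use 1 0 7, 
     Use 0 1 0, Use 1 0 7, Use 0 1 7, Use 8 1 0, Use 1 8 0, Use 6 0 7, Use 8 0 7, Use 2 1 7, 
     Use 0 6 0, Split 0 7, Use 0 1 0, Use 0 1 0, Use 13 6 0, Use 6 13 0, Use 1 0 7, Use 9 3 0]"

definition search7_18 :: "instr list" where
  "search7_18 =
    [Use 0 1 0, Use 1 0 7, Use 0 1 7, Use 7 1 0, Use 0 2 0, Use 0 1 0, Use 1 0 7, Use 0 1 0, 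
     Use 13 6 0, Use 1 0 7, Use 0 1 7, Use 11 1 0, Use 12 1 0, Use 0 1 0, Use 0 1 7, Use 0 1 0, 
     Use 1 0 7, Use 0 1 7, Use 2 1 7, Use 7 8 7, Use 13 7 0, Use 1 0 7, Use 1 0 7, Use 0 1 0, 
     Use 0 6 0, Split 7 0, Use 7 1 0, Use 7 1 0, Use 1 7 0, Use 1 13 0, Use 0 1 0, Use 1 0 7, 
     Use 6 3 0, Use 0 1 0, Use 1 7 0, Use 1 0 7, Use 0 1 7, Use 8 2 0, Use 10 2 0, Use 1 5 0, 
     Use 0 7 0, Use 0 1 0, Use 0 1 0, Use 7 1 0, Use 13 6 0, Use 0 7 0, Use 1 7 0, Use 9 8 0, 
     Use 3 9 0, Use 0 1 0, Use 7 1 0, Use 1 7 0, Use 0 1 7, Use 11 1 7, Use 3 9 7, Use 12 9 7, 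
     Use 7 10 7, Use 0 1 0, Use 1 7 0, Use 0 1 0, Use 7 1 0, Use 1 7 0, Use 1 0 7, Use 11 1 7, 
     Use 8 11 7, Use 1 6 0, Use 0 1 0, Use 1 0 7, Use 0 6 0, Use 0 1 7, Use 7 1 7, Split 2 0, 
     Use 1 6 0, Split 12 0, Use 1 2 0, Use 10 2 0, Use 12 2 0, Use 1 2 0, Use 1 2 0, Use 7 2 0, 
     Use 1 2 0, Use 8 2 0, Use 8 7 0, Use 10 7 0, Use 1 8 0, Use 7 2 0, Use 1 2 0, Use 1 2 0, 
     Use 1 6 0, Use 7 13 0, Use 1 8 7, Use 3 1 0, Use 13 2 0, Use 11 7 0, Use 12 1 0, Use 7 2 0, 
     Use 2 4 0, Use 5 4 0, Split 8 0, Use 4 2 0, Use 0 2 0, Use 1 2 0, Use 1 2 0, Use 6 2 0, 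
     Use 8 2 0, Use 10 2 0, Use 11 2 0, Use 6 2 0, Use 1 2 0, Use 3 2 0, Use 1 2 0, Use 1 2 0, 
     Use 1 6 0, Use 8 7 0, Use 1 8 0, Split 5 0, Use 0 5 0, Use 0 2 0, Use 0 5 0, Use 0 5 0, 
     Use 0 5 0, Use 0 5 0, Use 4 7 0, Use 4 0 7, Use 0 3 7, Use 0 2 0, Use 0 5 0, Use 6 1 0, 
     Use 0 2 0, Split 4 0, Use 6 4 0, Use 4 2 0, Use 1 4 0, Use 1 4 0, Use 6 2 0, Use 1 4 0, 
     Use 6 4 0, Use 9 4 0, Use 11 6 0, Use 6 4 0, Use 1 4 0, Use 6 4 0, Use 7 13 0, Use 3 1 7, 
     Use 0 3 7, Use 6 2 0, Use 1 4 0, Use 6 4 0, Use 7 13 0, Split 8 0, Use 2 1 0, Use 8 1 0, 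
     Use 4 2 0, Use 10 2 0, Use 2 8 0, Use 1 2 0, Use 1 2 0, Use 8 1 0, Use 1 2 0, Use 8 2 0, 
     Use 2 6 0, Use 8 1 0, Use 1 2 0, Use 1 2 0, Use 8 2 0, Use 1 6 0, Use 10 6 0, Use 8 7 0, 
     Split 11 0, Use 13 2 0, Use 1 4 0, Use 13 2 0, Use 4 5 0, Use 13 2 0, Use 13 2 0, Use 13 2 0, 
     Use 10 6 0, Use 2 10 0, Use 13 2 0, Use 13 2 0, Use 6 7 0, Use 0 12 0, Use 13 2 0, Use 0 6 0, 
     Split 0 7, Use 0 1 0, Use 0 1 0, Use 13 6 0, Use 0 1 0, Use 1 0 7, Use 1 0 7, Use 0 1 0, 
     Use 1 0 7, Use 0 1 7, Use 2 7 0, Use 2 13 0, Use 2 0 7, Use 0 1 0, Use 1 0 7, Use 0 1 7]"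

definition search7_19 :: "instr list" where
  "search7_19 =
    [Use 7 11 0, Use 10 3 7, Use 10 6 7, Use 1 8 7, Use 1 0 7, Use 0 1 0, Use 0 1 0, Use 1 0 7, 
     Use 0 1 7, Use 2 1 7, Use 13 8 7, Use 0 12 7, Use 1 0 7, Use 0 1 7, Use 11 9 7, Use 6 12 7, 
     Use 7 12 7, Use 10 12 7, Use 1 0 7, Use 0 1 0, Use 0 6 0, Split 0 7, Use 0 1 0, Use 0 1 0, 
     Use 13 6 0, Use 0 1 0, Use 13 6 0, Use 6 13 0, Use 0 1 7, Use 0 10 7, Use 4 11 7, Use 5 11 7, 
     Use 8 11 7, Use 0 1 0, Use 1 0 7, Use 1 0 7, Use 1 0 7, Use 0 1 0, Use 1 0 7, Use 0 1 7, 
     Use 3 7 0, Use 4 11 0, Use 0 4 0, Use 0 1 0, Use 6 13 0, Use 1 0 7, Use 0 1 0, Use 1 0 7, 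
     Use 0 1 0, Use 1 0 7, Use 7 1 0, Use 0 1 0, Use 0 6 0, Split 0 7, Use 0 1 0, Use 0 1 0, 
     Use 13 6 0, Use 6 13 0, Use 0 1 0, Use 1 0 7, Use 2 1 0, Use 0 2 0, Use 5 2 0, Use 9 2 0, 
     Use 13 2 0, Use 1 0 7, Use 1 0 7, Use 0 1 0, Use 1 0 7, Use 0 1 7, Split 5 0, Use 6 5 0, 
     Use 5 1 0, Use 0 4 0, Use 6 5 0, Use 10 5 0, Use 6 5 0, Use 7 5 0, Use 6 5 0, Use 13 6 0, 
     Use 6 5 0, Use 6 1 0, Use 0 1 0, Use 6 13 0, Use 1 0 7, Use 0 1 0, Use 1 0 7, Use 7 0 7, 
     Use 11 9 7, Use 13 9 7, Use 6 12 7, Use 9 12 7, Use 13 12 7, Use 0 1 0, Use 0 1 0, Use 1 0 7, 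
     Use 0 1 7, Use 8 1 7, Use 0 1 0, Use 0 6 0, Split 0 7, Use 0 1 0, Use 0 1 0, Use 13 6 0, 
     Use 0 1 0, Use 13 6 0, Use 6 13 0, Use 1 0 7, Use 10 0 7, Use 7 9 7, Use 11 9 7, Use 1 0 7, 
     Use 0 1 0, Use 1 0 7, Use 0 1 7, Split 9 0, Use 6 7 0, Use 6 7 0, Use 7 6 0, Use 6 7 0, 
     Use 6 7 0, Use 7 6 0, Use 6 7 0, Use 6 7 0, Use 0 1 0, Use 1 0 7, Use 1 0 7, Use 0 1 0, 
     Use 13 6 0, Use 0 1 7, Use 1 0 7, Use 0 1 0, Use 1 0 7, Use 0 1 7, Use 2 9 7, Use 3 9 7, 
     Use 1 12 7, Use 7 1 0, Use 13 6 0, Use 1 7 0, Use 9 7 0, Use 11 7 0, Use 0 1 0, Use 0 1 0, 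
     Use 0 6 0, Split 7 0, Use 7 1 0, Use 0 1 0, Use 1 0 7, Use 0 1 0, Use 7 1 0, Use 1 0 7, 
     Use 0 1 7, Use 7 6 0, Use 8 6 0, Use 0 1 0, Use 7 1 0, Use 0 1 7, Use 11 4 7, Use 4 5 7, 
     Use 1 7 0, Use 1 7 0, Use 13 6 0, Use 1 7 0, Use 0 1 0, Use 7 1 0, Use 1 0 7, Use 0 1 0, 
     Use 7 1 0, Use 1 0 7, Use 0 1 0, Use 1 7 0, Use 0 1 7]"

text \<open>Each branch ends in a conflict of entries or in the invariant set
  \<open>{1, 7}\<close>.\<close>

lemma search_7:
  "run 7 [initial_state 7] (search7_1 @ search7_2 @ search7_3 @ search7_4 @ search7_5 @ search7_6 @
      search7_7 @ search7_8 @ search7_9 @ search7_10 @ search7_11 @ search7_12 @ search7_13 @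
      search7_14 @ search7_15 @ search7_16 @ search7_17 @ search7_18 @ search7_19) =
    []"
  unfolding run_def
  by (simp only: eval_7 search7_1_def search7_2_def search7_3_def search7_4_def search7_5_def
      search7_6_def search7_7_def search7_8_def search7_9_def search7_10_def search7_11_def
      search7_12_def search7_13_def search7_14_def search7_15_def search7_16_def search7_17_def
      search7_18_def search7_19_def
    cong: option.case_cong_weak if_weak_cong)

text \<open>Entry \<open>a\<close> of row \<open>b\<close> is \<open>a \<star> b\<close>. This is the quandle of the transpositions of five points
  under conjugation.\<close>

definition table_10 :: "nat list list" where
  "table_10 =
    [[0, 5, 2, 3, 9, 1, 8, 7, 6, 4],
     [5, 1, 6, 3, 4, 0, 2, 9, 8, 7],
     [0, 6, 2, 7, 4, 8, 1, 3, 5, 9],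
     [0, 1, 7, 3, 8, 5, 9, 2, 4, 6],
     [9, 1, 2, 8, 4, 7, 6, 5, 3, 0],
     [1, 0, 8, 3, 7, 5, 6, 4, 2, 9],
     [8, 2, 1, 9, 4, 5, 6, 7, 0, 3],
     [0, 9, 3, 2, 5, 4, 6, 7, 8, 1],
     [6, 1, 5, 4, 3, 2, 0, 7, 8, 9],
     [4, 7, 2, 6, 0, 5, 3, 1, 8, 9]]"

text \<open>With indices modulo 5, label \<open>i < 5\<close> is the transposition
  \<open>(i, i+1)\<close> and label \<open>5 + i\<close> is \<open>(i, i+2)\<close>, the sides and
  diagonals of a pentagon; the shift is conjugation by the 5-cycle. Conjugating
  \<open>(1, 2)\<close> by \<open>(0, 1)\<close> gives \<open>(0, 2)\<close>, which is the seed
  \<open>t 1 0 = 5\<close>.\<close>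

definition star_10 :: "nat \<Rightarrow> nat \<Rightarrow> nat" where
  "star_10 a b = table_10 ! b ! a"

text \<open>Turns bounded quantifiers into finite enumerations, so that the laws of the table are
  checked instance by instance.\<close>

lemma less_10_iff: "(\<forall>a<10. P a) \<longleftrightarrow> list_all P [0..<10]"
  by (auto simp: list_all_iff)

lemma star_10_less: "\<forall>a<10. \<forall>b<10. star_10 a b < 10"
  by (simp only: less_10_iff upt_10 list.pred_inject star_10_def table_10_def nth_10 rel_simps simp_thms)

lemma star_10_idem: "\<forall>a<10. star_10 a a = a"
  by (simp only: less_10_iff upt_10 list.pred_inject star_10_def table_10_def nth_10 rel_simps simp_thms)

lemma star_10_involutory: "\<forall>a<10. \<forall>b<10. star_10 (star_10 a b) b = a"
  by (simp only: less_10_iff upt_10 list.pred_inject star_10_def table_10_def nth_10 rel_simps simp_thms)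

lemma star_10_distrib:
  "\<forall>a<10. \<forall>b<10. \<forall>c<10. star_10 (star_10 a b) c = star_10 (star_10 a c) (star_10 b c)"
  by (simp only: less_10_iff upt_10 list.pred_inject star_10_def table_10_def nth_10 rel_simps simp_thms)

lemma quandle_10: "quandle {..<10} star_10"
proof
  fix a b :: nat assume ab: "a \<in> {..<10}" "b \<in> {..<10}"
  show "star_10 a b \<in> {..<10}" "star_10 a a = a"
    using ab star_10_less star_10_idem by simp_all
  show "star_10 (star_10 a b) c = star_10 (star_10 a c) (star_10 b c)" if "c \<in> {..<10}" for c
    using ab that star_10_distrib by blast
  show "\<exists>!c. c \<in> {..<10} \<and> star_10 c b = a"
  proof
    \<comment> \<open>Translations are involutions, so the right quotient of \<open>a\<close> by
      \<open>b\<close> is \<open>star_10 a b\<close> itself.\<close>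
    show "star_10 a b \<in> {..<10} \<and> star_10 (star_10 a b) b = a"
      using ab star_10_less star_10_involutory by simp
  next
    fix c assume "c \<in> {..<10} \<and> star_10 c b = a"
    then show "c = star_10 a b"
      using ab star_10_involutory by auto
  qed
qed

lemma connected_quandle_10: "connected_quandle {..<10} star_10"
proof -
  interpret quandle "{..<10}" star_10 by (rule quandle_10)
  show ?thesis
  proof (rule no_invariant_imp_connected)
    fix S assume S: "S \<subseteq> {..<10}" "S \<noteq> {}"
      and inv: "\<And>a b. \<lbrakk>a \<in> S; b \<in> {..<10}\<rbrakk> \<Longrightarrow> star_10 a b \<in> S"
    \<comment> \<open>As translations are involutions, membership in \<open>S\<close> is passed
      along an entry in both directions.\<close>
    have step: "a \<in> S \<longleftrightarrow> c \<in> S" if "star_10 a b = c" "a < 10" "b < 10" for a b c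
      using inv[of a b] inv[of c b] that star_10_involutory by auto
    \<comment> \<open>Nine entries that form a spanning tree on the ten labels.\<close>
    have edges: "0 \<in> S \<longleftrightarrow> 1 \<in> S"
      "1 \<in> S \<longleftrightarrow> 2 \<in> S"
      "2 \<in> S \<longleftrightarrow> 3 \<in> S"
      "3 \<in> S \<longleftrightarrow> 4 \<in> S"
      "1 \<in> S \<longleftrightarrow> 5 \<in> S"
      "2 \<in> S \<longleftrightarrow> 6 \<in> S"
      "3 \<in> S \<longleftrightarrow> 7 \<in> S"
      "4 \<in> S \<longleftrightarrow> 8 \<in> S"
      "0 \<in> S \<longleftrightarrow> 9 \<in> S"
      using step[of 0 5 1] step[of 1 6 2] step[of 2 7 3] step[of 3 8 4] step[of 1 0 5] step[of 2 1 6]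
        step[of 3 2 7] step[of 4 3 8] step[of 0 4 9]
      by (simp_all add: star_10_def table_10_def)
    have "\<exists>x<10. x \<in> S"
      using S by auto
    then have "0 \<in> S \<or> 1 \<in> S \<or> 2 \<in> S \<or> 3 \<in> S \<or> 4 \<in> S \<or> 5 \<in> S \<or> 6 \<in> S \<or> 7 \<in> S \<or> 8 \<in> S \<or> 9 \<in> S"
      by (auto simp: numeral_eq_Suc less_Suc_eq)
    then have "\<forall>a<10. a \<in> S"
      unfolding less_10_iff upt_10 using edges by (simp only: list.pred_inject simp_thms)
    with S show "S = {..<10}" by auto
  qed
qed

definition solution_10 :: state where
  "solution_10 =
    (([Some 0, Some 5, Some 2, Some 3, Some 9, Some 1, Some 8, Some 7, Some 6, Some 4],
      [Some 0, Some 5, Some 2, Some 3, Some 9, Some 1, Some 8, Some 7, Some 6, Some 4]),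
     ([Some 1, Some 0, Some 8, Some 3, Some 7, Some 5, Some 6, Some 4, Some 2, Some 9],
      [Some 1, Some 0, Some 8, Some 3, Some 7, Some 5, Some 6, Some 4, Some 2, Some 9]))"

lemma search_5_solution:
  "run 5 [initial_state 5] (search5_1 @ search5_2 @ search5_3) = [solution_10]"
  unfolding solution_10_def by (rule search_5)

text \<open>The two stored columns, spread out by the shifts, reproduce all hundred entries of the
  transposition quandle.\<close>

lemma val_solution_10: "\<forall>a<10. \<forall>b<10. val 5 solution_10 a b = Some (star_10 a b)"
  by (simp only: less_10_iff list.pred_inject star_10_def table_10_def solution_10_def eval_5
      cong: option.case_cong_weak if_weak_cong)

section \<open>From tables back to quandles\<close>

lemma no_connected_quandle_14:
  assumes "connected_quandle Q s" shows "card Q \<noteq> 14"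
proof
  assume "card Q = 14"
  interpret quandle Q s using assms by (simp add: connected_quandle_def)
  have "card Q = 2 * 7" "prime (7 :: nat)"
    using \<open>card Q = 14\<close> by simp_all
  then obtain t where "shift_table 7 t" and t: "t 0 0 = 0" "t 7 7 = 7" "t 1 0 = 7"
    by (rule ex_shift_table[OF assms])
  interpret shift_table 7 t by fact
  have "\<exists>s\<in>set [initial_state 7]. knows s"
    using initial_state_sound t by simp
  \<comment> \<open>Some state of the final worklist would have to agree with \<open>t\<close>, but
    that list is empty.\<close>
  from run_sound[OF this] show False
    using search_7 by (metis empty_iff list.set(1))
qed

lemma connected_quandle_10_unique:
  assumes "connected_quandle Q s" "card Q = 10"
  shows "isomorphic_quandles Q s {..<10} star_10"
proof -
  interpret quandle Q s using assms by (simp add: connected_quandle_def)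
  have "card Q = 2 * 5" "prime (5 :: nat)"
    using assms(2) by simp_all
  then obtain e t where e': "bij_betw e {..<2 * 5} Q" and "shift_table 5 t"
    and t: "t 0 0 = 0" "t 5 5 = 5" "t 1 0 = 5"
    and hom': "\<forall>i<2 * 5. \<forall>j<2 * 5. e (t i j) = s (e i) (e j)"
    by (rule ex_shift_table[OF assms(1)])
  have e: "bij_betw e {..<10} Q" and hom: "\<And>i j. \<lbrakk>i < 10; j < 10\<rbrakk> \<Longrightarrow> e (t i j) = s (e i) (e j)"
    using e' hom' by simp_all
  interpret shift_table 5 t by fact
  have "\<exists>s\<in>set [initial_state 5]. knows s"
    using initial_state_sound t by simp
  \<comment> \<open>The final worklist is a singleton, so its only state is the one that agrees with
    \<open>t\<close>.\<close>
  from run_sound[OF this] have knows: "knows solution_10"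
    using search_5_solution by (metis empty_iff empty_set list.set_intros(1) set_ConsD)
  have t_eq: "t i j = star_10 i j" if "i < 10" "j < 10" for i j
    using val_sound(1)[OF knows, of i j] val_solution_10 that by simp
  define f where "f = inv_into {..<10} e"
  have f: "bij_betw f Q {..<10}"
    unfolding f_def using e by (rule bij_betw_inv_into)
  have f_e: "f (e i) = i" if "i < 10" for i
    unfolding f_def using e that by (simp add: bij_betw_inv_into_left)
  have "f (s x y) = star_10 (f x) (f y)" if "x \<in> Q" "y \<in> Q" for x y
  proof -
    obtain i j where ij: "i < 10" "j < 10" "x = e i" "y = e j"
      using \<open>x \<in> Q\<close> \<open>y \<in> Q\<close> e by (auto simp: bij_betw_def)
    have "f (s x y) = f (e (star_10 i j))"
      using ij hom t_eq by simp
    then show ?thesis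
      using ij f_e star_10_less by simp
  qed
  with f bij_betw_imp_funcset[OF f] have "f \<in> quandle_iso Q s {..<10} star_10"
    by (simp add: quandle_iso_def quandle_hom_def)
  then show ?thesis
    by (auto simp: isomorphic_quandles_def)
qed

theorem mainTheorem1:
  shows "(\<nexists>(Q :: 'a set) s. connected_quandle Q s \<and> card Q = 14) \<and>
    (\<exists>(Q\<^sub>0 :: nat set) s\<^sub>0. connected_quandle Q\<^sub>0 s\<^sub>0 \<and> card Q\<^sub>0 = 10 \<and>
      (\<forall>(Q :: 'a set) s. connected_quandle Q s \<and> card Q = 10 \<longrightarrow>
        isomorphic_quandles Q s Q\<^sub>0 s\<^sub>0))"
proof (intro conjI exI)
  show "\<nexists>(Q :: 'a set) s. connected_quandle Q s \<and> card Q = 14"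
    using no_connected_quandle_14 by blast
  \<comment> \<open>The representative lives on the naturals, since \<open>'a\<close> may have fewer
    than ten elements.\<close>
  show "connected_quandle {..<10} star_10" "card {..<10 :: nat} = 10"
    using connected_quandle_10 by simp_all
  show "\<forall>(Q :: 'a set) s. connected_quandle Q s \<and> card Q = 10 \<longrightarrow>
      isomorphic_quandles Q s {..<10} star_10"
    using connected_quandle_10_unique by blast
qed

end
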